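(* There is an $\epsilon>0$ such that if the divergence-free initial condition $\psi$ (not required to be real-valued) satisfies $\|\psi\|_2<\epsilon$, then there is a global regular solution to the Navier-Stokes system $$u_t-\Delta u+u\cdot\nabla u+\nabla p=0\ \text{ in }\ \mathbb{T}^3\times(0,\infty),\qquad u(x,0)=\psi,\quad \operatorname{div}u=0,$$ with periodic boundary conditions.
   Context: $\mathbb{T}^3=[0,1]^3$ with periodic boundary conditions; $u$ and $\psi$ are vector fields with three components. The Fourier expansion of $f$ on $\mathbb{T}^3$ is $\sum_{\mathbf{k}\in\mathbb{Z}^3}f_{\mathbf{k}}\exp(2\pi i\langle x,\mathbf{k}\rangle)$. For $\alpha>0$, $\Phi(\alpha)$ is the space of periodic distributions $f$ on $\mathbb{T}^3$ with $f_0=0$ and $|f_{\mathbf{k}}|\le c/|\mathbf{k}|^\alpha$ for all $\mathbf{k}\ne0$ and some constant $c$, with norm $\|f\|_\alpha=\sup_{\mathbf{k}\in\mathbb{Z}^3\setminus\{0\}}|\mathbf{k}|^\alpha|f_{\mathbf{k}}|$. Thus $\|\cdot\|_2$ is the norm of $\Phi(2)$, not the $L^2$ norm; writing $\|\psi\|_2<\epsilon$ includes $\psi\in\Phi(2)\subset L^2(\mathbb{T}^3)$, in particular $\psi_0=0$. A global regular solution is a weakly continuous function $u:[0,\infty)\to L^2(\mathbb{T}^3)$ with $u(0)=\psi$ which is $C^\infty$ on $\mathbb{T}^3\times(0,\infty)$ and which, together with some spatially periodic smooth pressure $p$, satisfies the equations pointwise on $\mathbb{T}^3\times(0,\infty)$.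 In the complex-valued case $u\cdot\nabla u=\sum_j u^j\partial_j u$ (no complex conjugation). *)

theory Defs
  imports "HOL-Analysis.Analysis"
begin

section \<open>Functions on the torus\<close>

text \<open>Functions on the three-dimensional torus are \<open>\<int>\<^sup>3\<close>-periodic functions on \<^typ>\<open>real^3\<close>;
  integrals are taken over one period cell with respect to Lebesgue measure.\<close>

definition ivec :: "int^3 \<Rightarrow> real^3" where
  "ivec k = (\<chi> j. of_int (k $ j))"

definition periodic :: "(real^3 \<Rightarrow> 'b) \<Rightarrow> bool" where
  "periodic f \<longleftrightarrow> (\<forall>x k. f (x + ivec k) = f x)"

abbreviation torus :: "(real^3) measure" where
  "torus \<equiv> lebesgue_on (cbox 0 One)"

text \<open>Square-integrable vector fields. Elements are functions, not classes modulo null sets,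
  so equality of two elements of \<open>L\<^sup>2\<close> is almost-everywhere equality.\<close>

definition L2_torus :: "(real^3 \<Rightarrow> complex^3) set" where
  "L2_torus = {f. periodic f \<and> f \<in> borel_measurable torus \<and> integrable torus (\<lambda>x. (norm (f x))\<^sup>2)}"

definition L2_inner :: "(real^3 \<Rightarrow> complex^3) \<Rightarrow> (real^3 \<Rightarrow> complex^3) \<Rightarrow> complex" where
  "L2_inner f g = (LINT x|torus. (\<Sum>j\<in>UNIV. f x $ j * cnj (g x $ j)))"

definition fourier_coeff :: "(real^3 \<Rightarrow> complex^3) \<Rightarrow> int^3 \<Rightarrow> complex^3" where
  "fourier_coeff f k =
     (\<chi> j. LINT x|torus. f x $ j * exp (- (2 * of_real pi * \<i> * of_real (x \<bullet> ivec k))))"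

text \<open>The square-integrable elements of the space \<open>\<Phi>(\<alpha>)\<close> of periodic distributions with
  \<open>f\<^sub>0 = 0\<close> and \<open>f\<^sub>k = O(|k|\<^sup>-\<^sup>\<alpha>)\<close>. For \<open>\<alpha> > 3/2\<close>, in particular for \<open>\<alpha> = 2\<close>, the
  coefficients are square-summable over \<open>\<int>\<^sup>3\<close>, so this is all of \<open>\<Phi>(\<alpha>)\<close>.\<close>

definition Phi :: "real \<Rightarrow> (real^3 \<Rightarrow> complex^3) set" where
  "Phi \<alpha> = {f \<in> L2_torus. fourier_coeff f 0 = 0 \<and>
     (\<exists>c. \<forall>k. k \<noteq> 0 \<longrightarrow> norm (fourier_coeff f k) \<le> c / norm (ivec k) powr \<alpha>)}"

text \<open>Meaningful only on \<^term>\<open>Phi \<alpha>\<close>, where the supremum is over a bounded set of reals.\<close>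

definition Phi_norm :: "real \<Rightarrow> (real^3 \<Rightarrow> complex^3) \<Rightarrow> real" where
  "Phi_norm \<alpha> f = (SUP k\<in>UNIV - {0}. norm (ivec k) powr \<alpha> * norm (fourier_coeff f k))"

section \<open>Smoothness and differential operators\<close>

text \<open>\<open>C\<^sup>n\<close> and \<open>C\<^sup>\<infinity>\<close> on an open set \<open>S\<close>, via iterated directional derivatives.\<close>

primrec Ck_on :: "nat \<Rightarrow> 'a::real_normed_vector set \<Rightarrow> ('a \<Rightarrow> 'b::real_normed_vector) \<Rightarrow> bool" where
  "Ck_on 0 S f \<longleftrightarrow> continuous_on S f"
| "Ck_on (Suc n) S f \<longleftrightarrow> (\<forall>x\<in>S. f differentiable (at x)) \<and>
     (\<forall>v. Ck_on n S (\<lambda>x. frechet_derivative f (at x) v))"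

definition smooth_on :: "'a::real_normed_vector set \<Rightarrow> ('a \<Rightarrow> 'b::real_normed_vector) \<Rightarrow> bool" where
  "smooth_on S f \<longleftrightarrow> (\<forall>n. Ck_on n S f)"

definition partial :: "3 \<Rightarrow> (real^3 \<Rightarrow> 'b::real_normed_vector) \<Rightarrow> real^3 \<Rightarrow> 'b" where
  "partial j f x = frechet_derivative f (at x) (axis j 1)"

definition gradient :: "(real^3 \<Rightarrow> complex) \<Rightarrow> real^3 \<Rightarrow> complex^3" where
  "gradient p x = (\<chi> j. partial j p x)"

definition divergence :: "(real^3 \<Rightarrow> complex^3) \<Rightarrow> real^3 \<Rightarrow> complex" where
  "divergence v x = (\<Sum>j\<in>UNIV. partial j (\<lambda>y. v y $ j) x)"

definition laplacian :: "(real^3 \<Rightarrow> complex^3) \<Rightarrow> real^3 \<Rightarrow> complex^3" where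
  "laplacian v x = (\<Sum>j\<in>UNIV. partial j (partial j v) x)"

text \<open>The nonlinear term \<open>v \<cdot> \<nabla>v\<close>, without complex conjugation.\<close>

definition convection :: "(real^3 \<Rightarrow> complex^3) \<Rightarrow> real^3 \<Rightarrow> complex^3" where
  "convection v x = (\<Sum>j\<in>UNIV. v x $ j *s partial j v x)"

text \<open>Vanishing divergence in the sense of periodic distributions.\<close>

definition weakly_divergence_free :: "(real^3 \<Rightarrow> complex^3) \<Rightarrow> bool" where
  "weakly_divergence_free v \<longleftrightarrow>
     (\<forall>\<phi>::real^3 \<Rightarrow> complex. periodic \<phi> \<and> smooth_on UNIV \<phi> \<longrightarrow>
        (LINT x|torus. (\<Sum>j\<in>UNIV. v x $ j * partial j \<phi> x)) = 0)"

section \<open>Global regular solutions\<close>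

text \<open>The solution is written as \<open>u t x\<close>, with time first; its values at \<open>t < 0\<close> are irrelevant.\<close>

definition weakly_continuous_L2 :: "(real \<Rightarrow> real^3 \<Rightarrow> complex^3) \<Rightarrow> bool" where
  "weakly_continuous_L2 u \<longleftrightarrow> (\<forall>t\<ge>0. u t \<in> L2_torus) \<and>
     (\<forall>g\<in>L2_torus. continuous_on {0..} (\<lambda>t. L2_inner (u t) g))"

definition navier_stokes ::
  "(real \<Rightarrow> real^3 \<Rightarrow> complex^3) \<Rightarrow> (real \<Rightarrow> real^3 \<Rightarrow> complex) \<Rightarrow> bool" where
  "navier_stokes u p \<longleftrightarrow> (\<forall>t>0. \<forall>x.
     vector_derivative (\<lambda>s. u s x) (at t) - laplacian (u t) x + convection (u t) x
       + gradient (p t) x = 0 \<and>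
     divergence (u t) x = 0)"

definition global_regular_solution ::
  "(real^3 \<Rightarrow> complex^3) \<Rightarrow> (real \<Rightarrow> real^3 \<Rightarrow> complex^3) \<Rightarrow> bool" where
  "global_regular_solution \<psi> u \<longleftrightarrow>
     weakly_continuous_L2 u \<and>
     (AE x in torus. u 0 x = \<psi> x) \<and>
     smooth_on (UNIV \<times> {0<..}) (\<lambda>(x, t). u t x) \<and>
     (\<exists>p. (\<forall>t>0. periodic (p t)) \<and>
          smooth_on (UNIV \<times> {0<..}) (\<lambda>(x, t). p t x) \<and>
          navier_stokes u p)"

end

theory Submission
  imports Defs
begin

text \<open>Fourier series turn the system into a fixed point problem for sequences. After the Leray
projection \<open>P\<^sub>k\<close> has removed the pressure, the coefficients satisfy
\<open>u\<^sub>k(t) = exp (-\<lambda>\<^sub>k t) \<psi>\<^sub>k - \<integral>\<^sub>0\<^sup>t exp (-\<lambda>\<^sub>k (t - s)) P\<^sub>k \<Sum>\<^sub>l 2\<pi>\<i> (k \<cdot> u\<^sub>l(s)) u\<^bsub>k-l\<^esub>(s) ds\<close>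
with \<open>\<lambda>\<^sub>k = 4\<pi>\<^sup>2 |k|\<^sup>2\<close>. The decay \<open>|k|\<^sup>-\<^sup>2\<close> is the critical one. In dimension three
the sum \<open>\<Sum>\<^sub>l |l|\<^sup>-\<^sup>2 |k - l|\<^sup>-\<^sup>2\<close> is of order \<open>|k|\<^sup>-\<^sup>1\<close> (lemma \<open>inv_sq_convolution\<close>), which
compensates the factor \<open>|k|\<close> of the derivative, and the time integral of the heat factor supplies
\<open>|k|\<^sup>-\<^sup>2\<close> again. The quadratic term is thus bounded in the same norm, globally in time, and
Picard iteration converges if the data are small (theorem \<open>mild_solution_exists\<close>).

To obtain regularity, the iteration is run with the smaller weight \<open>exp (-\<surd>t |k|) |k|\<^sup>-\<^sup>2\<close>.
The exponential is submultiplicative along convolutions, and since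
\<open>(\<surd>t - \<surd>s) |k| \<le> 1 + \<lambda>\<^sub>k (t - s) / 2\<close> it costs only a constant and half of the heat factor
(lemma \<open>gevrey_duhamel_bound\<close>). The fixed point therefore has exponentially decaying coefficients
at every positive time. Differentiating the equation transfers this decay to all time derivatives
(lemma \<open>smooth_family_bootstrap\<close>), so the Fourier series of the velocity and of the pressure can be
differentiated termwise and solve the system pointwise (lemma \<open>vsynth_navier_stokes\<close>).

At time zero the coefficients are only square summable. Weak continuity there follows from three
facts: each coefficient is continuous on \<open>[0, \<infinity>)\<close>, the \<open>L\<^sup>2\<close> norms are bounded, and trigonometric
polynomials are dense in \<open>L\<^sup>2\<close> of the torus (theorem \<open>trig_approximable_square_integrable\<close>). Density
is obtained from the Stone-Weierstrass theorem on the image of the torus in \<open>\<complex>\<^sup>3\<close>.\<close>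

section \<open>Lattice sums\<close>

text \<open>The maximum norm replaces the Euclidean norm on the lattice because its balls are cubes, whose
  points can be counted exactly. Its values are natural numbers, so that they index the shells.\<close>

definition sup_norm :: "int^3 \<Rightarrow> nat" where
  "sup_norm k = Max (range (\<lambda>j. nat \<bar>k $ j\<bar>))"

lemma sup_norm_le_iff: "sup_norm k \<le> m \<longleftrightarrow> (\<forall>j. \<bar>k $ j\<bar> \<le> int m)"
  unfolding sup_norm_def by (subst Max_le_iff) (auto simp: nat_le_iff)

lemma abs_le_sup_norm: "\<bar>k $ j\<bar> \<le> int (sup_norm k)"
  using sup_norm_le_iff[of k "sup_norm k"] by simp

lemma sup_norm_triangle: "sup_norm (k + l) \<le> sup_norm k + sup_norm l"
proof -
  have "\<bar>(k + l) $ j\<bar> \<le> int (sup_norm k + sup_norm l)" for j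
    using abs_le_sup_norm[of k j] abs_le_sup_norm[of l j] by simp
  thus ?thesis unfolding sup_norm_le_iff by blast
qed

lemma sup_norm_split: "sup_norm k \<le> sup_norm l + sup_norm (k - l)"
  using sup_norm_triangle[of l "k - l"] by simp

lemma sup_norm_0 [simp]: "sup_norm 0 = 0"
  using sup_norm_le_iff[of 0 0] by simp

lemma sup_norm_eq_0_iff [simp]: "sup_norm k = 0 \<longleftrightarrow> k = 0"
  using sup_norm_le_iff[of k 0] by (auto simp: vec_eq_iff)

lemma sup_norm_pos_iff [simp]: "0 < sup_norm k \<longleftrightarrow> k \<noteq> 0"
  using sup_norm_eq_0_iff[of k] by linarith

lemma card_sup_norm_le: "finite {l. sup_norm l \<le> m}" "card {l. sup_norm l \<le> m} = (2 * m + 1) ^ 3"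
proof -
  let ?A = "{- int m..int m}"
  let ?f = "\<lambda>(a, b, c). vector [a, b, c] :: int^3"
  have eq: "{l. sup_norm l \<le> m} = ?f ` (?A \<times> ?A \<times> ?A)"
  proof (intro equalityI subsetI)
    fix l assume "l \<in> {l. sup_norm l \<le> m}"
    hence *: "\<bar>l $ j\<bar> \<le> int m" for j by (simp add: sup_norm_le_iff)
    have "l = ?f (l $ 1, l $ 2, l $ 3)"
      by (simp add: vec_eq_iff forall_3 vector_3)
    moreover have "(l $ 1, l $ 2, l $ 3) \<in> ?A \<times> ?A \<times> ?A"
      using *[of 1] *[of 2] *[of 3] by auto
    ultimately show "l \<in> ?f ` (?A \<times> ?A \<times> ?A)" by blast
  qed (auto simp: sup_norm_le_iff forall_3 vector_3)
  show "finite {l. sup_norm l \<le> m}" unfolding eq by simp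
  have inj: "inj_on ?f (?A \<times> ?A \<times> ?A)"
    by (auto simp: inj_on_def vec_eq_iff forall_3 vector_3)
  show "card {l. sup_norm l \<le> m} = (2 * m + 1) ^ 3"
    unfolding eq card_image[OF inj]
    by (simp add: card_cartesian_product power3_eq_cube nat_add_distrib nat_mult_distrib)
qed

text \<open>A shell is the difference of two cubes, and \<open>(2m + 1)\<^sup>3 - (2m - 1)\<^sup>3 = 24m\<^sup>2 + 2\<close>.\<close>

lemma card_sup_norm_eq:
  assumes "m > 0"
  shows "finite {l. sup_norm l = m}" "real (card {l. sup_norm l = m}) \<le> 26 * (real m)\<^sup>2"
proof -
  obtain p where m: "m = Suc p" using assms by (cases m) auto
  have eq: "{l. sup_norm l = m} = {l. sup_norm l \<le> m} - {l. sup_norm l \<le> p}"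
    unfolding m by auto
  show "finite {l. sup_norm l = m}" unfolding eq using card_sup_norm_le by simp
  have "card {l. sup_norm l = m} = (2 * m + 1) ^ 3 - (2 * p + 1) ^ 3"
    unfolding eq by (subst card_Diff_subset) (auto simp: card_sup_norm_le m)
  also have "real \<dots> = real ((2 * m + 1) ^ 3) - real ((2 * p + 1) ^ 3)"
    by (intro of_nat_diff power_mono) (auto simp: m)
  also have "\<dots> = 24 * (real m)\<^sup>2 + 2"
    by (simp add: m power3_eq_cube power2_eq_square algebra_simps)
  also have "\<dots> \<le> 26 * (real m)\<^sup>2"
    using assms by (simp add: )
  finally show "real (card {l. sup_norm l = m}) \<le> 26 * (real m)\<^sup>2" .
qed

abbreviation weight :: "int^3 \<Rightarrow> real" where
  "weight k \<equiv> 1 + real (sup_norm k)"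

text \<open>Grouping a radial lattice sum by shells leaves a sum over radii with weight \<open>26m\<^sup>2\<close>. The
  value at the origin, where this weight vanishes, has to be zero.\<close>

lemma sum_shells_le:
  fixes f :: "nat \<Rightarrow> real"
  assumes "finite F" and nonneg: "\<And>m. f m \<ge> 0" and "f 0 = 0"
  shows "\<exists>M. (\<Sum>l\<in>F. f (sup_norm l)) \<le> (\<Sum>m=1..M. 26 * (real m)\<^sup>2 * f m)"
proof -
  obtain M where M: "\<And>l. l \<in> F \<Longrightarrow> sup_norm l \<le> M"
    using finite_imageI[OF assms(1), of sup_norm] by (meson finite_nat_set_iff_bounded_le image_eqI)
  let ?S = "\<lambda>m. {l. sup_norm l = m}"
  have "(\<Sum>l\<in>F. f (sup_norm l)) = (\<Sum>l\<in>F - {0}. f (sup_norm l))"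
    using assms by (intro sum.mono_neutral_right) auto
  also have "\<dots> \<le> (\<Sum>l\<in>(\<Union>m\<in>{1..M}. ?S m). f (sup_norm l))"
  proof (intro sum_mono2)
    show "finite (\<Union>m\<in>{1..M}. ?S m)" using card_sup_norm_eq by force
    show "F - {0} \<subseteq> (\<Union>m\<in>{1..M}. ?S m)"
      using M by (auto simp: Suc_le_eq)
  qed (auto intro: nonneg)
  also have "\<dots> = (\<Sum>m=1..M. \<Sum>l\<in>?S m. f (sup_norm l))"
    using card_sup_norm_eq by (intro sum.UNION_disjoint) force+
  also have "\<dots> = (\<Sum>m=1..M. real (card (?S m)) * f m)"
    by (intro sum.cong) auto
  also have "\<dots> \<le> (\<Sum>m=1..M. 26 * (real m)\<^sup>2 * f m)"
    by (intro sum_mono mult_right_mono card_sup_norm_eq nonneg) auto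
  finally show ?thesis by blast
qed

text \<open>The critical decay rate. The convention \<open>1 / 0 = 0\<close> makes it vanish at the origin, so a bound by
  a multiple of it also says that the mean value is zero.\<close>

definition inv_sq :: "int^3 \<Rightarrow> real" where
  "inv_sq l = 1 / (real (sup_norm l))\<^sup>2"

lemma inv_sq_nonneg [simp]: "inv_sq l \<ge> 0" by (simp add: inv_sq_def)
lemma inv_sq_0 [simp]: "inv_sq 0 = 0" by (simp add: inv_sq_def)
lemma inv_sq_le_1: "inv_sq l \<le> 1"
proof (cases "l = 0")
  case False
  hence "1 \<le> (real (sup_norm l))\<^sup>2" by (simp add: Suc_le_eq)
  thus ?thesis by (simp add: inv_sq_def divide_le_eq)
qed simp

text \<open>The radii up to \<open>N\<close> contribute at most \<open>1/N\<close>; beyond \<open>N\<close> the sum is dominated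
  by a telescoping one, as \<open>1/(m + 1)\<^sup>2 \<le> 1/m - 1/(m + 1)\<close>.\<close>

lemma sum_inverse_max_sq_le:
  assumes "N > 0"
  shows "(\<Sum>m=1..M. 1 / (real (max N m))\<^sup>2) \<le> 2 / real N"
proof (cases "M \<le> N")
  case True
  have "(\<Sum>m=1..M. 1 / (real (max N m))\<^sup>2) = (\<Sum>m=1..M. 1 / (real N)\<^sup>2)"
    using True by (intro sum.cong) (auto simp: max_def)
  also have "\<dots> = real M / (real N)\<^sup>2" by simp
  also have "\<dots> \<le> 2 / real N"
    using True assms by (simp add: power2_eq_square field_simps)
  finally show ?thesis .
next
  case False
  have "(\<Sum>m=1..M. 1 / (real (max N m))\<^sup>2) \<le> 2 / real N - 1 / real M" if "N \<le> M" for M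
    using that
  proof (induction M rule: dec_induct)
    case base
    have "(\<Sum>m=1..N. 1 / (real (max N m))\<^sup>2) = (\<Sum>m=1..N. 1 / (real N)\<^sup>2)"
      by (intro sum.cong) (auto simp: max_def)
    also have "\<dots> = 2 / real N - 1 / real N" using assms by (simp add: power2_eq_square)
    finally show ?case by simp
  next
    case (step M)
    have pos: "real M > 0" using step assms by simp
    have "1 / (real (Suc M))\<^sup>2 \<le> 1 / (real M * real (Suc M))"
      using pos by (intro divide_left_mono) (auto simp: power2_eq_square)
    also have "\<dots> = 1 / real M - 1 / real (Suc M)"
      using pos by (simp add: field_simps)
    finally have "1 / (real (Suc M))\<^sup>2 \<le> 1 / real M - 1 / real (Suc M)" .
    thus ?case using step by (simp add: max_def)
  qed
  from this[of M] False show ?thesis by (smt (verit) of_nat_0_le_iff divide_nonneg_nonneg nat_le_linear)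
qed

lemma sum_inv_sq_max_le:
  assumes "finite F" "N > 0"
  shows "(\<Sum>l\<in>F. inv_sq l / (real (max N (sup_norm l)))\<^sup>2) \<le> 52 / real N"
proof -
  obtain M where "(\<Sum>l\<in>F. (\<lambda>m. 1 / (real m)\<^sup>2 / (real (max N m))\<^sup>2) (sup_norm l))
      \<le> (\<Sum>m=1..M. 26 * (real m)\<^sup>2 * (1 / (real m)\<^sup>2 / (real (max N m))\<^sup>2))"
    using sum_shells_le[OF assms(1), of "\<lambda>m. 1 / (real m)\<^sup>2 / (real (max N m))\<^sup>2"] by auto
  also have "\<dots> = 26 * (\<Sum>m=1..M. 1 / (real (max N m))\<^sup>2)"
    unfolding sum_distrib_left by (intro sum.cong) auto
  also have "\<dots> \<le> 26 * (2 / real N)"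
    by (intro mult_left_mono sum_inverse_max_sq_le assms) auto
  finally show ?thesis by (simp add: inv_sq_def)
qed

text \<open>The convolution of the critical rate with itself gains one power of \<open>|k|\<close> in dimension
  three. Up to exchanging \<open>l\<close> and \<open>k - l\<close> one may assume
  \<open>|l| \<le> |k - l|\<close>. Then \<open>max |k| |l| \<le> 2 |k - l|\<close>, and replacing \<open>|k - l|\<close> accordingly, at the cost
  of a factor 4, leaves a sum that is radial in \<open>l\<close> and at most \<open>52 / |k|\<close>.\<close>

lemma inv_sq_convolution_finite:
  assumes "finite F"
  shows "real (sup_norm k) * (\<Sum>l\<in>F. inv_sq l * inv_sq (k - l)) \<le> 416"
proof (cases "k = 0")
  case False
  define N where "N = sup_norm k"
  have N: "N > 0" using False by (simp add: N_def)
  define g where "g l = inv_sq l / (real (max N (sup_norm l)))\<^sup>2" for l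
  have g0: "g l \<ge> 0" for l by (simp add: g_def)
  have half: "inv_sq l * inv_sq (k - l) \<le> 4 * g l" if "sup_norm l \<le> sup_norm (k - l)" for l
  proof -
    have "N \<le> 2 * sup_norm (k - l)"
      using sup_norm_split[of k l] that by (simp add: N_def)
    hence le: "real (max N (sup_norm l)) \<le> 2 * real (sup_norm (k - l))" using that by linarith
    have "(real (max N (sup_norm l)))\<^sup>2 \<le> (2 * real (sup_norm (k - l)))\<^sup>2"
      by (intro power_mono le) auto
    hence "inv_sq (k - l) \<le> 4 / (real (max N (sup_norm l)))\<^sup>2"
      using N \<open>N \<le> 2 * sup_norm (k - l)\<close>
      by (simp add: inv_sq_def divide_simps power2_eq_square)
    hence "inv_sq l * inv_sq (k - l) \<le> inv_sq l * (4 / (real (max N (sup_norm l)))\<^sup>2)"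
      by (intro mult_left_mono) auto
    thus ?thesis by (simp add: g_def mult_ac)
  qed
  \<comment> \<open>One of the two summands covers each of the cases \<open>|l| \<le> |k - l|\<close> and \<open>|l| > |k - l|\<close>.\<close>
  have le: "inv_sq l * inv_sq (k - l) \<le> 4 * g l + 4 * g (k - l)" for l
  proof (cases "sup_norm l \<le> sup_norm (k - l)")
    case True thus ?thesis using half[of l] g0[of "k - l"] by linarith
  next
    case False thus ?thesis using half[of "k - l"] g0[of l] by (simp add: mult.commute)
  qed
  have inj: "inj_on (\<lambda>l. k - l) F" by (auto simp: inj_on_def)
  have "(\<Sum>l\<in>F. inv_sq l * inv_sq (k - l)) \<le> (\<Sum>l\<in>F. 4 * g l + 4 * g (k - l))"
    by (intro sum_mono le)
  also have "\<dots> = 4 * (\<Sum>l\<in>F. g l) + 4 * (\<Sum>l\<in>(\<lambda>l. k - l) ` F. g l)"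
    by (simp add: sum.distrib sum_distrib_left sum.reindex[OF inj])
  also have "\<dots> \<le> 4 * (52 / real N) + 4 * (52 / real N)"
    unfolding g_def using assms N by (intro add_mono mult_left_mono sum_inv_sq_max_le) auto
  finally have "real N * (\<Sum>l\<in>F. inv_sq l * inv_sq (k - l)) \<le> real N * (416 / real N)"
    by (intro mult_left_mono) auto
  thus ?thesis using N by (simp add: N_def)
qed simp

lemma inv_sq_squared_summable: "(\<lambda>l. (inv_sq l)\<^sup>2) summable_on UNIV"
proof (rule nonneg_bdd_above_summable_on)
  show "bdd_above (sum (\<lambda>l. (inv_sq l)\<^sup>2) ` {F. F \<subseteq> UNIV \<and> finite F})"
  proof (rule bdd_aboveI2)
    fix F :: "(int^3) set" assume "F \<in> {F. F \<subseteq> UNIV \<and> finite F}"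
    hence "finite F" by simp
    have "(inv_sq l)\<^sup>2 = inv_sq l / (real (max 1 (sup_norm l)))\<^sup>2" for l
      by (cases "l = 0") (auto simp: inv_sq_def power2_eq_square max_def Suc_le_eq)
    thus "sum (\<lambda>l. (inv_sq l)\<^sup>2) F \<le> 52"
      using sum_inv_sq_max_le[OF \<open>finite F\<close>, of 1] by simp
  qed
qed simp

lemma inv_sq_convolution_summable: "(\<lambda>l. inv_sq l * inv_sq (k - l)) summable_on UNIV"
proof (rule summable_on_comparison_test)
  have "(\<lambda>l. (inv_sq (k - l))\<^sup>2) summable_on UNIV"
    using inv_sq_squared_summable
    by (subst summable_on_reindex_bij_betw[of "\<lambda>l. k - l" UNIV UNIV "\<lambda>l. (inv_sq l)\<^sup>2"])
       (auto intro!: bij_betwI[where g = "\<lambda>l. k - l"])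
  thus "(\<lambda>l. (inv_sq l)\<^sup>2 + (inv_sq (k - l))\<^sup>2) summable_on UNIV"
    by (intro summable_on_add inv_sq_squared_summable)
  show "inv_sq l * inv_sq (k - l) \<le> (inv_sq l)\<^sup>2 + (inv_sq (k - l))\<^sup>2" for l
    using sum_squares_bound[of "inv_sq l" "inv_sq (k - l)"]
      mult_nonneg_nonneg[OF inv_sq_nonneg inv_sq_nonneg, of l "k - l"] by linarith
qed auto

lemma inv_sq_convolution:
  "real (sup_norm k) * (\<Sum>\<^sub>\<infinity>l. inv_sq l * inv_sq (k - l)) \<le> 416"
proof (cases "k = 0")
  case False
  have "(\<Sum>\<^sub>\<infinity>l. inv_sq l * inv_sq (k - l)) \<le> 416 / real (sup_norm k)"
  proof (rule infsum_le_finite_sums[OF inv_sq_convolution_summable])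
    fix F :: "(int^3) set" assume "finite F"
    from inv_sq_convolution_finite[OF this, of k]
    show "(\<Sum>l\<in>F. inv_sq l * inv_sq (k - l)) \<le> 416 / real (sup_norm k)"
      using False by (simp add: pos_le_divide_eq mult.commute)
  qed
  thus ?thesis using False by (simp add: field_simps)
qed simp

lemma inverse_weight_summable: "(\<lambda>l. 1 / weight l ^ 4) summable_on UNIV"
proof -
  have "(\<lambda>l. 1 / weight l ^ 4) summable_on (UNIV - {0})"
  proof (rule summable_on_comparison_test)
    show "(\<lambda>l. (inv_sq l)\<^sup>2) summable_on (UNIV - {0})"
      using inv_sq_squared_summable by (rule summable_on_subset_banach) auto
    show "1 / weight l ^ 4 \<le> (inv_sq l)\<^sup>2" if "l \<in> UNIV - {0}" for l
    proof -
      have "(inv_sq l)\<^sup>2 = 1 / (real (sup_norm l)) ^ 4" by (simp add: inv_sq_def power_divide)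
      also have "\<dots> \<ge> 1 / weight l ^ 4"
        using that by (auto intro!: divide_left_mono power_mono)
      finally show ?thesis .
    qed
  qed auto
  thus ?thesis using summable_on_insert_iff[of "\<lambda>l. 1 / weight l ^ 4" 0 "UNIV - {0}"]
    by (simp add: insert_Diff[of 0 UNIV, simplified])
qed

lemma sup_norm_le_norm_ivec: "real (sup_norm k) \<le> norm (ivec k)"
proof -
  have "sup_norm k \<in> range (\<lambda>j. nat \<bar>k $ j\<bar>)" unfolding sup_norm_def by (intro Max_in) auto
  then obtain j where "sup_norm k = nat \<bar>k $ j\<bar>" by blast
  hence "real (sup_norm k) = \<bar>ivec k $ j\<bar>" by (simp add: ivec_def)
  also have "\<dots> \<le> norm (ivec k)" by (rule component_le_norm_cart)
  finally show ?thesis .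
qed

lemma norm_ivec_le_sup_norm: "norm (ivec k) \<le> 3 * real (sup_norm k)"
proof -
  have "norm (ivec k) \<le> (\<Sum>j\<in>UNIV. \<bar>ivec k $ j\<bar>)" by (rule norm_le_l1_cart)
  also have "\<dots> \<le> (\<Sum>j\<in>(UNIV :: 3 set). real (sup_norm k))"
  proof (rule sum_mono)
    fix j show "\<bar>ivec k $ j\<bar> \<le> real (sup_norm k)"
      using abs_le_sup_norm[of k j] by (simp add: ivec_def)
  qed
  finally show ?thesis by simp
qed

section \<open>Gevrey bounds and the fixed point\<close>

text \<open>Picard iteration from zero. Distances are measured relative to the weight \<open>w\<close>. As \<open>w \<le> 1\<close>,
  convergence relative to \<open>w\<close> is, for each index, uniform in time, and so the limit is again
  continuous in time.\<close>

lemma weighted_contraction_fixed_point: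
  fixes T :: "('i \<Rightarrow> real \<Rightarrow> 'b::banach) \<Rightarrow> 'i \<Rightarrow> real \<Rightarrow> 'b" and w :: "'i \<Rightarrow> real \<Rightarrow> real"
    and \<delta> :: real
  defines "K \<equiv> \<lambda>u. (\<forall>k. continuous_on {0..} (u k)) \<and> (\<forall>k. \<forall>t\<ge>0. norm (u k t) \<le> \<delta> * w k t)"
  assumes w: "\<And>k t. 0 \<le> w k t" "\<And>k t. t \<ge> 0 \<Longrightarrow> w k t \<le> 1" and "\<delta> \<ge> 0"
    and self: "\<And>u. K u \<Longrightarrow> K (T u)"
    and contr: "\<And>u v D k t. K u \<Longrightarrow> K v \<Longrightarrow> D \<ge> 0 \<Longrightarrow>
      (\<And>k t. t \<ge> 0 \<Longrightarrow> norm (u k t - v k t) \<le> D * w k t) \<Longrightarrow> t \<ge> 0 \<Longrightarrow>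
      norm (T u k t - T v k t) \<le> D / 2 * w k t"
  shows "\<exists>u. K u \<and> (\<forall>k. \<forall>t\<ge>0. u k t = T u k t)"
proof -
  define U where "U n = (T ^^ n) (\<lambda>k t. 0)" for n
  have U_Suc: "U (Suc n) = T (U n)" for n by (simp add: U_def)
  have KU: "K (U n)" for n
  proof (induction n)
    case 0 show ?case using w \<open>\<delta> \<ge> 0\<close> by (simp add: U_def K_def)
  next
    case (Suc n) thus ?case using self by (simp add: U_Suc)
  qed
  have step: "norm (U (Suc n) k t - U n k t) \<le> \<delta> * (1/2) ^ n * w k t" if "t \<ge> 0" for n k t
    using that
  proof (induction n arbitrary: k t)
    case 0
    thus ?case using KU[of 1] by (simp add: K_def U_def)
  next
    case (Suc n)
    have "norm (T (U (Suc n)) k t - T (U n) k t) \<le> \<delta> * (1/2) ^ n / 2 * w k t"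
      using \<open>\<delta> \<ge> 0\<close> by (intro contr KU Suc) auto
    thus ?case by (simp add: U_Suc)
  qed
  have tail: "norm (U (n + m) k t - U n k t) \<le> \<delta> * w k t * (2 * (1/2) ^ n - 2 * (1/2) ^ (n + m))"
    if "t \<ge> 0" for n m k t
  proof (induction m)
    case (Suc m)
    have "norm (U (n + Suc m) k t - U n k t)
        \<le> norm (U (Suc (n + m)) k t - U (n + m) k t) + norm (U (n + m) k t - U n k t)"
      using norm_triangle_ineq[of "U (Suc (n + m)) k t - U (n + m) k t" "U (n + m) k t - U n k t"]
      by simp
    also have "\<dots> \<le> \<delta> * (1/2) ^ (n + m) * w k t
        + \<delta> * w k t * (2 * (1/2) ^ n - 2 * (1/2) ^ (n + m))"
      by (intro add_mono step that Suc)
    also have "\<dots> = \<delta> * w k t * (2 * (1/2) ^ n - 2 * (1/2) ^ (n + Suc m))"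
      by (simp add: algebra_simps)
    finally show ?case .
  qed simp
  have tail': "norm (U m k t - U n k t) \<le> 2 * \<delta> * (1/2) ^ n * w k t"
    if "t \<ge> 0" "n \<le> m" for n m k t
  proof -
    have "norm (U m k t - U n k t) \<le> \<delta> * w k t * (2 * (1/2) ^ n - 2 * (1/2) ^ m)"
      using tail[OF that(1), of n "m - n" k] that(2) by simp
    also have "\<dots> \<le> \<delta> * w k t * (2 * (1/2) ^ n)"
      using \<open>\<delta> \<ge> 0\<close> w by (intro mult_left_mono) auto
    finally show ?thesis by (simp add: mult_ac)
  qed
  have null: "(\<lambda>n. 2 * \<delta> * (1/2) ^ n * w k t) \<longlonglongrightarrow> 0" for k t
    by (intro tendsto_mult_left_zero tendsto_mult_right_zero LIMSEQ_power_zero) auto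
  have null1: "(\<lambda>n. 2 * \<delta> * (1/2) ^ n) \<longlonglongrightarrow> 0"
    by (intro tendsto_mult_right_zero LIMSEQ_power_zero) auto
  define u where "u k t = lim (\<lambda>n. U n k t)" for k t
  have conv: "(\<lambda>n. U n k t) \<longlonglongrightarrow> u k t" if "t \<ge> 0" for k t
  proof -
    have "Cauchy (\<lambda>n. U n k t)"
    proof (rule metric_CauchyI)
      fix e :: real assume "e > 0"
      with null[of k t] obtain N where N: "2 * \<delta> * (1/2) ^ N * w k t < e / 2"
        by (metis (no_types, lifting) eventually_happens' half_gt_zero order_tendstoD(2) sequentially_bot)
      show "\<exists>M. \<forall>m\<ge>M. \<forall>n\<ge>M. dist (U m k t) (U n k t) < e"
      proof (intro exI allI impI)
        fix m n assume "m \<ge> N" "n \<ge> N"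
        thus "dist (U m k t) (U n k t) < e"
          using tail'[OF that, of N m k] tail'[OF that, of N n k] N
            dist_triangle2[of "U m k t" "U n k t" "U N k t"] by (simp add: dist_norm)
      qed
    qed
    thus ?thesis unfolding u_def using Cauchy_convergent_iff convergent_LIMSEQ_iff by blast
  qed
  have dist_u: "norm (u k t - U n k t) \<le> 2 * \<delta> * (1/2) ^ n * w k t" if "t \<ge> 0" for n k t
  proof (rule LIMSEQ_le_const2)
    show "(\<lambda>m. norm (U m k t - U n k t)) \<longlonglongrightarrow> norm (u k t - U n k t)"
      by (intro tendsto_intros conv that)
    show "\<exists>N. \<forall>m\<ge>N. norm (U m k t - U n k t) \<le> 2 * \<delta> * (1/2) ^ n * w k t"
      using tail'[OF that] by blast
  qed
  have Ku: "K u"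
    unfolding K_def
  proof (intro conjI allI impI)
    fix k
    have "uniform_limit {0..} (\<lambda>n. U n k) (u k) sequentially"
    proof (rule uniform_limitI)
      fix e :: real assume "e > 0"
      have "\<forall>\<^sub>F n in sequentially. 2 * \<delta> * (1/2) ^ n < e"
        using null1 \<open>e > 0\<close> by (rule order_tendstoD)
      thus "\<forall>\<^sub>F n in sequentially. \<forall>t\<in>{0..}. dist (U n k t) (u k t) < e"
      proof eventually_elim
        case (elim n)
        show ?case
        proof
          fix t :: real assume "t \<in> {0..}"
          hence "norm (u k t - U n k t) \<le> 2 * \<delta> * (1/2) ^ n * w k t" using dist_u by auto
          also have "\<dots> \<le> 2 * \<delta> * (1/2) ^ n * 1"
            using \<open>t \<in> {0..}\<close> \<open>\<delta> \<ge> 0\<close> by (intro mult_left_mono w) auto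
          finally show "dist (U n k t) (u k t) < e"
            using elim by (simp add: dist_norm norm_minus_commute)
        qed
      qed
    qed
    thus "continuous_on {0..} (u k)"
      by (rule uniform_limit_theorem[rotated]) (use KU in \<open>auto simp: K_def\<close>)
  next
    fix k and t :: real assume "t \<ge> 0"
    show "norm (u k t) \<le> \<delta> * w k t"
      by (rule LIMSEQ_le_const2[OF tendsto_norm[OF conv[OF \<open>t \<ge> 0\<close>]]])
         (use KU \<open>t \<ge> 0\<close> in \<open>auto simp: K_def\<close>)
  qed
  have "u k t = T u k t" if "t \<ge> 0" for k t
  proof -
    have le: "norm (U (Suc n) k t - T u k t) \<le> \<delta> * (1/2) ^ n * w k t" for n
    proof -
      have "norm (T u k t - T (U n) k t) \<le> 2 * \<delta> * (1/2) ^ n / 2 * w k t"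
        using \<open>\<delta> \<ge> 0\<close> by (intro contr Ku KU dist_u that) auto
      thus ?thesis by (simp add: U_Suc norm_minus_commute)
    qed
    have "(\<lambda>n. \<delta> * (1/2) ^ n * w k t) \<longlonglongrightarrow> 0"
      by (intro tendsto_mult_left_zero tendsto_mult_right_zero LIMSEQ_power_zero) auto
    hence "(\<lambda>n. U (Suc n) k t - T u k t) \<longlonglongrightarrow> 0"
      by (rule Lim_null_comparison[rotated]) (use le in auto)
    hence "(\<lambda>n. U (Suc n) k t) \<longlonglongrightarrow> T u k t" by (simp add: LIM_zero_iff)
    moreover have "(\<lambda>n. U (Suc n) k t) \<longlonglongrightarrow> u k t" using conv[OF that] by (rule LIMSEQ_Suc)
    ultimately show ?thesis using LIMSEQ_unique by blast
  qed
  with Ku show ?thesis by blast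
qed

text \<open>Since \<open>(\<surd>t - \<surd>s)\<^sup>2 \<le> t - s\<close>, the loss \<open>(\<surd>t - \<surd>s) n\<close> from replacing the weight
  \<open>exp (-\<surd>s n)\<close> at time \<open>s\<close> by the weight \<open>exp (-\<surd>t n)\<close> at the later time \<open>t\<close> is at
  most a constant plus half of the exponent \<open>lam (t - s)\<close> of the heat kernel.\<close>

lemma gevrey_heat_exponent:
  fixes n lam s t :: real
  assumes "0 \<le> s" "s \<le> t" "n \<ge> 0" "n\<^sup>2 \<le> lam"
  shows "lam * s - sqrt s * n \<le> 1 - sqrt t * n + lam * t / 2 + lam * s / 2"
proof -
  define p q where "p = sqrt t" and "q = sqrt s"
  have pq: "0 \<le> q" "q \<le> p" "t = p\<^sup>2" "s = q\<^sup>2" using assms by (auto simp: p_def q_def)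
  have "(p - q)\<^sup>2 \<le> p\<^sup>2 - q\<^sup>2"
    using pq mult_left_mono[OF pq(2) pq(1)] by (simp add: power2_eq_square algebra_simps)
  hence "n\<^sup>2 * (p - q)\<^sup>2 \<le> lam * (t - s)"
    using assms pq order_trans[OF zero_le_power2 assms(4)] by (intro mult_mono) auto
  moreover have "2 * ((p - q) * n) \<le> 1 + n\<^sup>2 * (p - q)\<^sup>2"
    using zero_le_power2[of "1 - (p - q) * n"] by (simp add: power2_eq_square algebra_simps)
  ultimately have "2 * ((p - q) * n) \<le> 2 + lam * (t - s)" by linarith
  thus ?thesis by (simp add: p_def q_def algebra_simps)
qed

text \<open>After the change of weight, half of the heat kernel is left; its time integral is at most
  \<open>2 / lam\<close>, which supplies the two powers of \<open>n\<close>.\<close>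

lemma gevrey_duhamel_bound:
  fixes f :: "real \<Rightarrow> 'b::banach"
  assumes f: "continuous_on {0..} f" "\<And>s. s \<ge> 0 \<Longrightarrow> norm (f s) \<le> M * exp (- (sqrt s * n))"
    and "M \<ge> 0" "n > 0" "n\<^sup>2 \<le> lam" "t \<ge> 0"
  shows "norm (exp (- (lam * t)) *\<^sub>R integral {0..t} (\<lambda>s. exp (lam * s) *\<^sub>R f s))
    \<le> 2 * exp 1 * M * exp (- (sqrt t * n)) / n\<^sup>2"
proof -
  have lam: "lam > 0" using assms by (smt (verit) zero_less_power)
  define c where "c = M * exp (1 - sqrt t * n + lam * t / 2)"
  have c: "c \<ge> 0" using \<open>M \<ge> 0\<close> by (simp add: c_def)
  have "((\<lambda>s. exp (lam / 2 * s)) has_integral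
      (exp (lam / 2 * t) / (lam / 2) - exp (lam / 2 * 0) / (lam / 2))) {0..t}"
    using lam \<open>t \<ge> 0\<close>
    by (intro fundamental_theorem_of_calculus)
       (auto intro!: derivative_eq_intros simp flip: has_real_derivative_iff_has_vector_derivative)
  hence int: "((\<lambda>s. c * exp (lam / 2 * s)) has_integral
      (c * ((exp (lam / 2 * t) - 1) / (lam / 2)))) {0..t}"
    using has_integral_mult_right[of "\<lambda>s. exp (lam / 2 * s)" _ _ c]
    by (simp add: diff_divide_distrib)
  have "norm (integral {0..t} (\<lambda>s. exp (lam * s) *\<^sub>R f s))
      \<le> integral {0..t} (\<lambda>s. c * exp (lam / 2 * s))"
  proof (rule integral_norm_bound_integral)
    show "(\<lambda>s. exp (lam * s) *\<^sub>R f s) integrable_on {0..t}"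
      by (intro integrable_continuous_interval continuous_intros continuous_on_subset[OF f(1)]) auto
    show "(\<lambda>s. c * exp (lam / 2 * s)) integrable_on {0..t}" using int by blast
    fix s assume s: "s \<in> {0..t}"
    have "norm (exp (lam * s) *\<^sub>R f s) \<le> exp (lam * s) * (M * exp (- (sqrt s * n)))"
      using f(2)[of s] s by (simp add: mult_left_mono)
    also have "\<dots> = M * exp (lam * s - sqrt s * n)" by (simp add: exp_diff exp_minus field_simps)
    also have "\<dots> \<le> M * exp (1 - sqrt t * n + lam * t / 2 + lam * s / 2)"
      using gevrey_heat_exponent[of s t n lam] s assms by (intro mult_left_mono) auto
    also have "\<dots> = c * exp (lam / 2 * s)" by (simp add: c_def flip: exp_add)
    finally show "norm (exp (lam * s) *\<^sub>R f s) \<le> c * exp (lam / 2 * s)" .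
  qed
  also have "\<dots> = c * ((exp (lam / 2 * t) - 1) / (lam / 2))" using int by (rule integral_unique)
  also have "\<dots> \<le> c * (exp (lam / 2 * t) / (lam / 2))"
    using lam c by (intro mult_left_mono divide_right_mono) auto
  also have "\<dots> = 2 * M * exp (1 - sqrt t * n + lam * t) / lam"
    by (simp add: c_def field_simps flip: exp_add)
  finally have "norm (exp (- (lam * t)) *\<^sub>R integral {0..t} (\<lambda>s. exp (lam * s) *\<^sub>R f s))
      \<le> exp (- (lam * t)) * (2 * M * exp (1 - sqrt t * n + lam * t) / lam)"
    unfolding norm_scaleR abs_exp_cancel by (intro mult_left_mono) auto
  also have "\<dots> = 2 * exp 1 * M * exp (- (sqrt t * n)) / lam"
    by (simp add: exp_add exp_diff exp_minus field_simps)
  also have "\<dots> \<le> 2 * exp 1 * M * exp (- (sqrt t * n)) / n\<^sup>2"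
    using assms lam by (intro divide_left_mono) auto
  finally show ?thesis .
qed

text \<open>The critical decay, improved by an exponential that corresponds to a radius of analyticity of the
  order \<open>\<surd>t\<close>. At time zero the exponential is \<open>1\<close>, so the condition on the data is that of
  \<open>\<Phi>(2)\<close>.\<close>

definition gevrey_weight :: "int^3 \<Rightarrow> real \<Rightarrow> real" where
  "gevrey_weight k t = inv_sq k * exp (- (sqrt t * real (sup_norm k)))"

lemma gevrey_weight_nonneg: "0 \<le> gevrey_weight k t"
  by (simp add: gevrey_weight_def)

lemma gevrey_weight_le_inv_sq: "t \<ge> 0 \<Longrightarrow> gevrey_weight k t \<le> inv_sq k"
  by (simp add: gevrey_weight_def mult_left_le)

text \<open>By the triangle inequality for \<open>k = l + (k - l)\<close> the exponential factor passes through
  convolutions without loss.\<close>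

lemma gevrey_weight_mult_le:
  assumes "t \<ge> 0"
  shows "gevrey_weight l t * gevrey_weight (k - l) t
    \<le> exp (- (sqrt t * real (sup_norm k))) * (inv_sq l * inv_sq (k - l))"
proof -
  have "sqrt t * real (sup_norm k) \<le> sqrt t * real (sup_norm l + sup_norm (k - l))"
    using assms sup_norm_split[of k l] by (intro mult_left_mono) auto
  hence "exp (- (sqrt t * real (sup_norm l))) * exp (- (sqrt t * real (sup_norm (k - l))))
      \<le> exp (- (sqrt t * real (sup_norm k)))"
    by (simp add: algebra_simps flip: exp_add)
  from mult_right_mono[OF this, of "inv_sq l * inv_sq (k - l)"] show ?thesis
    by (simp add: gevrey_weight_def mult_ac)
qed

text \<open>The system \<open>u\<^sub>k' = - lam k u\<^sub>k + \<Sum>\<^sub>l \<beta> k u\<^sub>l u\<^bsub>k-l\<^esub>\<close> in which the nonlinearity costs one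
  derivative and the dissipation gains two. The bound on the form forces \<open>\<beta> 0 = 0\<close>, so that the
  mean value stays zero.\<close>

locale quadratic_heat_system =
  fixes \<beta> :: "int^3 \<Rightarrow> 'b::banach \<Rightarrow> 'b \<Rightarrow> 'b" and K :: real and lam :: "int^3 \<Rightarrow> real"
  assumes bilinear: "\<And>k. bounded_bilinear (\<beta> k)"
    and bound: "\<And>k a b. norm (\<beta> k a b) \<le> K * real (sup_norm k) * norm a * norm b"
    and K_pos: "K > 0"
    and lam_ge: "\<And>k. (real (sup_norm k))\<^sup>2 \<le> lam k"
begin

definition quad :: "(int^3 \<Rightarrow> real \<Rightarrow> 'b) \<Rightarrow> (int^3 \<Rightarrow> real \<Rightarrow> 'b) \<Rightarrow> int^3 \<Rightarrow> real \<Rightarrow> 'b" where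
  "quad u v k t = (\<Sum>\<^sub>\<infinity>l. \<beta> k (u l t) (v (k - l) t))"

text \<open>The heat factor \<open>exp (- lam k (t - s))\<close> is split, so that the integrand does not depend on \<open>t\<close>
  and the fundamental theorem of calculus applies directly.\<close>

definition duhamel :: "(int^3 \<Rightarrow> 'b) \<Rightarrow> (int^3 \<Rightarrow> real \<Rightarrow> 'b) \<Rightarrow> int^3 \<Rightarrow> real \<Rightarrow> 'b" where
  "duhamel \<psi> u k t =
     exp (- (lam k * t)) *\<^sub>R (\<psi> k + integral {0..t} (\<lambda>s. exp (lam k * s) *\<^sub>R quad u u k s))"

definition gevrey_bounded :: "real \<Rightarrow> (int^3 \<Rightarrow> real \<Rightarrow> 'b) \<Rightarrow> bool" where
  "gevrey_bounded A u \<longleftrightarrow> (\<forall>k. \<forall>t\<ge>0. norm (u k t) \<le> A * gevrey_weight k t)"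

lemma quad_term_bound:
  assumes "gevrey_bounded A u" "gevrey_bounded B v" "A \<ge> 0" "B \<ge> 0" "t \<ge> 0"
  shows "norm (\<beta> k (u l t) (v (k - l) t))
    \<le> K * A * B * real (sup_norm k) * exp (- (sqrt t * real (sup_norm k))) * (inv_sq l * inv_sq (k - l))"
proof -
  have "norm (\<beta> k (u l t) (v (k - l) t))
      \<le> K * real (sup_norm k) * (norm (u l t) * norm (v (k - l) t))"
    using bound[of k "u l t" "v (k - l) t"] by (simp add: mult_ac)
  also have "\<dots> \<le> K * real (sup_norm k)
      * ((A * gevrey_weight l t) * (B * gevrey_weight (k - l) t))"
    using assms K_pos gevrey_weight_nonneg
    by (intro mult_left_mono mult_mono) (auto simp: gevrey_bounded_def)
  also have "\<dots> = K * real (sup_norm k) * A * B * (gevrey_weight l t * gevrey_weight (k - l) t)"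
    by (simp add: mult_ac)
  also have "\<dots> \<le> K * real (sup_norm k) * A * B
      * (exp (- (sqrt t * real (sup_norm k))) * (inv_sq l * inv_sq (k - l)))"
    using assms K_pos by (intro mult_left_mono gevrey_weight_mult_le) auto
  finally show ?thesis by (simp add: mult_ac)
qed

lemma quad_summable:
  assumes "gevrey_bounded A u" "gevrey_bounded B v" "A \<ge> 0" "B \<ge> 0" "t \<ge> 0"
  shows "(\<lambda>l. \<beta> k (u l t) (v (k - l) t)) summable_on UNIV"
proof (rule abs_summable_summable, rule Infinite_Sum.abs_summable_on_comparison_test')
  show "(\<lambda>l. K * A * B * real (sup_norm k) * exp (- (sqrt t * real (sup_norm k)))
      * (inv_sq l * inv_sq (k - l))) summable_on UNIV"
    by (intro summable_on_cmult_right inv_sq_convolution_summable)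
qed (rule quad_term_bound[OF assms])

text \<open>The factor \<open>|k|\<close> lost in the form is exactly the one gained in the convolution of the weights.\<close>

lemma quad_bound:
  assumes "gevrey_bounded A u" "gevrey_bounded B v" "A \<ge> 0" "B \<ge> 0" "t \<ge> 0"
  shows "norm (quad u v k t) \<le> 416 * K * A * B * exp (- (sqrt t * real (sup_norm k)))"
proof -
  let ?c = "K * A * B * real (sup_norm k) * exp (- (sqrt t * real (sup_norm k)))"
  let ?S = "\<Sum>\<^sub>\<infinity>l. inv_sq l * inv_sq (k - l)"
  have "((\<lambda>l. ?c * (inv_sq l * inv_sq (k - l))) has_sum (?c * ?S)) UNIV"
    by (intro has_sum_cmult_right has_sum_infsum inv_sq_convolution_summable)
  hence "norm (quad u v k t) \<le> ?c * ?S"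
    unfolding quad_def
    using quad_term_bound[OF assms]
    by (intro norm_infsum_le[OF has_sum_infsum[OF quad_summable[OF assms]]]) auto
  also have "\<dots> = (K * A * B * exp (- (sqrt t * real (sup_norm k)))) * (real (sup_norm k) * ?S)"
    by (simp add: mult_ac)
  also have "\<dots> \<le> (K * A * B * exp (- (sqrt t * real (sup_norm k)))) * 416"
    using assms K_pos by (intro mult_left_mono inv_sq_convolution) auto
  finally show ?thesis by (simp add: mult_ac)
qed

lemma quad_continuous:
  assumes "gevrey_bounded A u" "gevrey_bounded B v" "A \<ge> 0" "B \<ge> 0"
    and "\<And>k. continuous_on {0..} (u k)" "\<And>k. continuous_on {0..} (v k)"
  shows "continuous_on {0..} (quad u v k)"
proof -
  have "uniform_limit {0..} (\<lambda>X t. \<Sum>l\<in>X. \<beta> k (u l t) (v (k - l) t)) (quad u v k)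
      (finite_subsets_at_top UNIV)"
    unfolding quad_def
  proof (rule Weierstrass_m_test_general)
    show "(\<lambda>l. K * A * B * real (sup_norm k) * (inv_sq l * inv_sq (k - l))) summable_on UNIV"
      by (intro summable_on_cmult_right inv_sq_convolution_summable)
    fix l and t :: real assume "t \<in> {0..}"
    hence "t \<ge> 0" by simp
    note quad_term_bound[OF assms(1-4) this, of k l]
    also have "K * A * B * real (sup_norm k) * exp (- (sqrt t * real (sup_norm k))) *
        (inv_sq l * inv_sq (k - l))
       \<le> K * A * B * real (sup_norm k) * 1 * (inv_sq l * inv_sq (k - l))"
      using assms K_pos \<open>t \<ge> 0\<close> by (intro mult_right_mono mult_left_mono) auto
    finally show "norm (\<beta> k (u l t) (v (k - l) t))
        \<le> K * A * B * real (sup_norm k) * (inv_sq l * inv_sq (k - l))" by simp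
  qed
  thus ?thesis
    by (rule uniform_limit_theorem[rotated])
       (auto intro!: always_eventually continuous_on_sum bounded_bilinear.continuous_on[OF bilinear]
           assms)
qed

lemma quad_at_0: "quad u v 0 t = 0"
  using bound[of 0] by (simp add: quad_def)

lemma duhamel_term_bound:
  fixes f :: "int^3 \<Rightarrow> real \<Rightarrow> 'b"
  assumes "\<And>k. continuous_on {0..} (f k)" "M \<ge> 0" "t \<ge> 0"
    and f: "\<And>k s. s \<ge> 0 \<Longrightarrow> norm (f k s) \<le> M * exp (- (sqrt s * real (sup_norm k)))"
    and f0: "\<And>s. f 0 s = 0"
  shows "norm (exp (- (lam k * t)) *\<^sub>R integral {0..t} (\<lambda>s. exp (lam k * s) *\<^sub>R f k s))
    \<le> 2 * exp 1 * M * gevrey_weight k t"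
proof (cases "k = 0")
  case False
  have "norm (exp (- (lam k * t)) *\<^sub>R integral {0..t} (\<lambda>s. exp (lam k * s) *\<^sub>R f k s))
      \<le> 2 * exp 1 * M * exp (- (sqrt t * real (sup_norm k))) / (real (sup_norm k))\<^sup>2"
    by (rule gevrey_duhamel_bound) (use False assms lam_ge in auto)
  thus ?thesis by (simp add: gevrey_weight_def inv_sq_def)
qed (simp add: f0 gevrey_weight_def)

text \<open>Polarisation, which turns the bilinear bound into the Lipschitz estimate of the contraction.\<close>

lemma quad_diff:
  assumes "gevrey_bounded A u" "gevrey_bounded A v" "A \<ge> 0" "t \<ge> 0"
  shows "quad u u k t - quad v v k t
     = quad (\<lambda>k t. u k t - v k t) u k t + quad v (\<lambda>k t. u k t - v k t) k t"
proof -
  interpret bounded_bilinear "\<beta> k" by (rule bilinear)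
  have d: "gevrey_bounded (2 * A) (\<lambda>k t. u k t - v k t)"
    unfolding gevrey_bounded_def
  proof (intro allI impI)
    fix k and t :: real assume "t \<ge> 0"
    hence "norm (u k t) \<le> A * gevrey_weight k t" "norm (v k t) \<le> A * gevrey_weight k t"
      using assms(1,2) by (auto simp: gevrey_bounded_def)
    thus "norm (u k t - v k t) \<le> 2 * A * gevrey_weight k t"
      using norm_triangle_ineq4[of "u k t" "v k t"] by linarith
  qed
  have A2: "2 * A \<ge> 0" using assms by simp
  note s = quad_summable[OF assms(1,1,3,3,4), of k] quad_summable[OF assms(2,2,3,3,4), of k]
    quad_summable[OF d assms(1) A2 assms(3,4), of k] quad_summable[OF assms(2) d assms(3) A2
        assms(4), of k]
  have "quad u u k t = (\<Sum>\<^sub>\<infinity>l. \<beta> k (v l t) (v (k - l) t)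
      + (\<beta> k (u l t - v l t) (u (k - l) t) + \<beta> k (v l t) (u (k - l) t - v (k - l) t)))"
    by (simp add: quad_def diff_left diff_right)
  also have "\<dots> = quad v v k t
      + (quad (\<lambda>k t. u k t - v k t) u k t + quad v (\<lambda>k t. u k t - v k t) k t)"
    unfolding quad_def using s by (simp add: infsum_add summable_on_add)
  finally show ?thesis by simp
qed

lemma duhamel_continuous:
  assumes "continuous_on {0..} (quad u u k)"
  shows "continuous_on {0..} (duhamel \<psi> u k)"
proof -
  let ?g = "\<lambda>s. exp (lam k * s) *\<^sub>R quad u u k s"
  have "continuous_on {0..} (\<lambda>t. integral {0..t} ?g)"
    unfolding continuous_on_eq_continuous_within
  proof
    fix t :: real assume "t \<in> {0..}"
    hence "t \<ge> 0" by simp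
    have "?g integrable_on {0..t + 1}"
      by (intro integrable_continuous_interval continuous_intros continuous_on_subset[OF assms]) auto
    from indefinite_integral_continuous_1[OF this]
    have "continuous (at t within {0..t+1}) (\<lambda>t. integral {0..t} ?g)"
      using \<open>t \<ge> 0\<close> by (simp add: continuous_on_eq_continuous_within)
    moreover have "at t within {0..t+1} = at t within {0..}"
      by (rule at_within_nhd[of _ "{..<t+1}"]) (auto simp: \<open>t \<ge> 0\<close>)
    ultimately show "continuous (at t within {0..}) (\<lambda>t. integral {0..t} ?g)"
      by (simp add: continuous_within)
  qed
  thus ?thesis
    unfolding duhamel_def by (intro continuous_intros)
qed

text \<open>Global solvability for small data: by the bounds above the quadratic term maps the weighted ball of
  radius \<open>\<delta>\<close> into one of radius \<open>C \<delta>\<^sup>2\<close> and has Lipschitz constant \<open>2 C \<delta>\<close> on it, with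
  the same \<open>C\<close> for all times.\<close>

theorem mild_solution_exists:
  "\<exists>\<epsilon>>0. \<exists>\<delta>\<ge>0. \<forall>\<psi>. (\<forall>k. norm (\<psi> k) \<le> \<epsilon> * inv_sq k) \<longrightarrow>
    (\<exists>u. (\<forall>k. continuous_on {0..} (u k)) \<and> gevrey_bounded \<delta> u \<and>
         (\<forall>k. \<forall>t\<ge>0. u k t = duhamel \<psi> u k t))"
proof -
  define C where "C = 2 * exp 1 * (416 * K)"
  have C: "C > 0" using K_pos by (simp add: C_def)
  \<comment> \<open>The Lipschitz constant is then \<open>1/2\<close>, and the quadratic part is at most \<open>\<delta>/4\<close>,
      which leaves \<open>\<delta>/2\<close> for the data.\<close>
  define \<delta> where "\<delta> = 1 / (4 * C)"
  have \<delta>: "\<delta> > 0" "C * \<delta> = 1 / 4" using C by (auto simp: \<delta>_def)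
  define \<epsilon> where "\<epsilon> = \<delta> / (2 * exp 1)"
  have \<epsilon>: "\<epsilon> > 0" using \<delta> by (simp add: \<epsilon>_def)
  show ?thesis
  proof (rule exI[of _ \<epsilon>], rule conjI, rule \<epsilon>, rule exI[of _ \<delta>], rule conjI, use \<delta> in simp, intro
      allI impI)
    fix \<psi> :: "int^3 \<Rightarrow> 'b" assume \<psi>: "\<forall>k. norm (\<psi> k) \<le> \<epsilon> * inv_sq k"
    have heat: "norm (exp (- (lam k * t)) *\<^sub>R \<psi> k) \<le> \<delta> / 2 * gevrey_weight k t" if "t \<ge> 0" for k t
    proof -
      have l0: "lam k \<ge> 0" using lam_ge[of k] by (smt (verit) zero_le_power2)
      have "- (lam k * t) \<le> 1 - sqrt t * real (sup_norm k)"
        using gevrey_heat_exponent[of 0 t "real (sup_norm k)" "lam k"] that lam_ge[of k]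
          mult_nonneg_nonneg[OF l0 that] by simp
      hence "exp (- (lam k * t)) \<le> exp 1 * exp (- (sqrt t * real (sup_norm k)))"
        by (simp flip: exp_add)
      hence "exp (- (lam k * t)) * norm (\<psi> k)
          \<le> (exp 1 * exp (- (sqrt t * real (sup_norm k)))) * (\<epsilon> * inv_sq k)"
        using \<psi> by (intro mult_mono) auto
      thus ?thesis by (simp add: gevrey_weight_def \<epsilon>_def field_simps)
    qed
    have "\<exists>u. ((\<forall>k. continuous_on {0..} (u k)) \<and> (\<forall>k. \<forall>t\<ge>0. norm (u k t) \<le> \<delta> * gevrey_weight k t))
        \<and> (\<forall>k. \<forall>t\<ge>0. u k t = duhamel \<psi> u k t)"
    proof (rule weighted_contraction_fixed_point)
      show "gevrey_weight k t \<le> 1" if "t \<ge> 0" for k t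
        using gevrey_weight_le_inv_sq[OF that, of k] inv_sq_le_1[of k] by linarith
    next
      fix u :: "int^3 \<Rightarrow> real \<Rightarrow> 'b" assume u: "(\<forall>k. continuous_on {0..} (u k)) \<and> (\<forall>k.
          \<forall>t\<ge>0. norm (u k t) \<le> \<delta> * gevrey_weight k t)"
      hence g: "gevrey_bounded \<delta> u" by (simp add: gevrey_bounded_def)
      have cont: "continuous_on {0..} (quad u u k)" for k
        using g u \<delta> by (intro quad_continuous) auto
      have "norm (duhamel \<psi> u k t) \<le> \<delta> * gevrey_weight k t" if "t \<ge> 0" for k t
      proof -
        have "norm (duhamel \<psi> u k t) \<le> norm (exp (- (lam k * t)) *\<^sub>R \<psi> k)
            + norm (exp (- (lam k * t)) *\<^sub>R integral {0..t} (\<lambda>s. exp (lam k * s) *\<^sub>R quad u u k s))"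
          unfolding duhamel_def scaleR_add_right by (rule norm_triangle_ineq)
        also have "\<dots> \<le> \<delta> / 2 * gevrey_weight k t + 2 * exp 1 * (416 * K * \<delta> * \<delta>) * gevrey_weight k t"
          using \<delta> K_pos that g
          by (intro add_mono heat duhamel_term_bound cont quad_bound quad_at_0) auto
        also have "\<dots> = (\<delta> / 2 + (C * \<delta>) * \<delta>) * gevrey_weight k t"
          by (simp add: C_def algebra_simps)
        also have "\<dots> \<le> \<delta> * gevrey_weight k t"
          unfolding \<delta> using \<delta> by (intro mult_right_mono gevrey_weight_nonneg) auto
        finally show ?thesis .
      qed
      thus "(\<forall>k. continuous_on {0..} (duhamel \<psi> u k)) \<and>
          (\<forall>k. \<forall>t\<ge>0. norm (duhamel \<psi> u k t) \<le> \<delta> * gevrey_weight k t)"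
        using duhamel_continuous[OF cont] by blast
    next
      fix u v :: "int^3 \<Rightarrow> real \<Rightarrow> 'b" and D :: real and k and t :: real
      assume u: "(\<forall>k. continuous_on {0..} (u k)) \<and> (\<forall>k. \<forall>t\<ge>0. norm (u k t) \<le> \<delta> * gevrey_weight k t)"
        and v: "(\<forall>k. continuous_on {0..} (v k)) \<and> (\<forall>k. \<forall>t\<ge>0. norm (v k t) \<le> \<delta> * gevrey_weight k t)"
        and D: "D \<ge> 0" and uv: "\<And>k t. t \<ge> 0 \<Longrightarrow> norm (u k t - v k t) \<le> D * gevrey_weight k t"
        and t: "t \<ge> 0"
      let ?d = "\<lambda>k t. u k t - v k t"
      have g: "gevrey_bounded \<delta> u" "gevrey_bounded \<delta> v" "gevrey_bounded D ?d"
        using u v uv by (auto simp: gevrey_bounded_def)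
      let ?f = "\<lambda>k s. quad ?d u k s + quad v ?d k s"
      have cd: "continuous_on {0..} (?d k)" for k using u v by (intro continuous_intros) auto
      have cont: "continuous_on {0..} (quad u u k)" "continuous_on {0..} (quad v v k)"
        "continuous_on {0..} (?f k)" for k
        using g u v cd \<delta> D by (auto intro!: quad_continuous continuous_on_add)
      have int: "(\<lambda>s. exp (lam k * s) *\<^sub>R quad u u k s) integrable_on {0..t}"
        "(\<lambda>s. exp (lam k * s) *\<^sub>R quad v v k s) integrable_on {0..t}"
        by (intro integrable_continuous_interval continuous_intros continuous_on_subset[OF cont(1)]
            continuous_on_subset[OF cont(2)]; simp)+
      have "duhamel \<psi> u k t - duhamel \<psi> v k t = exp (- (lam k * t)) *\<^sub>R
          (integral {0..t} (\<lambda>s. exp (lam k * s) *\<^sub>R quad u u k s)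
            - integral {0..t} (\<lambda>s. exp (lam k * s) *\<^sub>R quad v v k s))"
        unfolding duhamel_def by (simp add: algebra_simps)
      also have "integral {0..t} (\<lambda>s. exp (lam k * s) *\<^sub>R quad u u k s)
            - integral {0..t} (\<lambda>s. exp (lam k * s) *\<^sub>R quad v v k s)
          = integral {0..t} (\<lambda>s. exp (lam k * s) *\<^sub>R quad u u k s - exp (lam k * s) *\<^sub>R quad v v k s)"
        using int by (rule Henstock_Kurzweil_Integration.integral_diff[symmetric])
      also have "\<dots> = integral {0..t} (\<lambda>s. exp (lam k * s) *\<^sub>R ?f k s)"
        using quad_diff[OF g(1,2)] \<delta>
        by (intro Henstock_Kurzweil_Integration.integral_cong) (simp flip: scaleR_diff_right)
      finally have "norm (duhamel \<psi> u k t - duhamel \<psi> v k t)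
          = norm (exp (- (lam k * t)) *\<^sub>R integral {0..t} (\<lambda>s. exp (lam k * s) *\<^sub>R ?f k s))" by simp
      also have "\<dots> \<le> 2 * exp 1 * (2 * (416 * K * \<delta> * D)) * gevrey_weight k t"
      proof (rule duhamel_term_bound)
        fix k and s :: real assume s: "s \<ge> 0"
        have "norm (?f k s) \<le> norm (quad ?d u k s) + norm (quad v ?d k s)" by (rule norm_triangle_ineq)
        also have "\<dots> \<le> 416 * K * D * \<delta> * exp (- (sqrt s * real (sup_norm k)))
            + 416 * K * \<delta> * D * exp (- (sqrt s * real (sup_norm k)))"
          using g \<delta> D s by (intro add_mono quad_bound) auto
        finally show "norm (?f k s) \<le> 2 * (416 * K * \<delta> * D) * exp (- (sqrt s * real (sup_norm k)))"
          by (simp add: algebra_simps)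
      qed (use cont \<delta> D t K_pos in \<open>auto simp: quad_at_0\<close>)
      also have "\<dots> = 2 * (C * \<delta>) * D * gevrey_weight k t" by (simp add: C_def)
      finally show "norm (duhamel \<psi> u k t - duhamel \<psi> v k t) \<le> D / 2 * gevrey_weight k t"
        using \<delta> by simp
    qed (use \<delta> gevrey_weight_nonneg in auto)
    thus "\<exists>u. (\<forall>k. continuous_on {0..} (u k)) \<and> gevrey_bounded \<delta> u \<and> (\<forall>k. \<forall>t\<ge>0. u k t = duhamel \<psi> u k t)"
      unfolding gevrey_bounded_def by blast
  qed
qed

end

section \<open>Termwise differentiation over the lattice\<close>

lemma sup_norm_exhausts:
  "filterlim (\<lambda>n. {k. sup_norm k \<le> n}) (finite_subsets_at_top UNIV) sequentially"
  unfolding filterlim_finite_subsets_at_top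
proof (intro allI impI)
  fix X :: "(int^3) set" assume "finite X \<and> X \<subseteq> UNIV"
  then obtain M where M: "\<And>l. l \<in> X \<Longrightarrow> sup_norm l \<le> M"
    using finite_imageI[of X sup_norm] by (meson finite_nat_set_iff_bounded_le image_eqI)
  show "\<forall>\<^sub>F n in sequentially. finite {k. sup_norm k \<le> n} \<and> X \<subseteq> {k. sup_norm k \<le> n} \<and> {k. sup_norm k
      \<le> n} \<subseteq> UNIV"
    using eventually_ge_at_top[of M] by eventually_elim (use M card_sup_norm_le in force)
qed

text \<open>A series over the lattice is the limit of its sums over the cubes \<open>{k. sup_norm k \<le> n}\<close>, which
  reduces the claim to termwise differentiation of a sequence.\<close>

lemma has_derivative_infsum:
  fixes f :: "int^3 \<Rightarrow> 'a::real_normed_vector \<Rightarrow> 'b::banach"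
  assumes S: "open S" "convex S" "x \<in> S"
    and der: "\<And>k x. x \<in> S \<Longrightarrow> (f k has_derivative f' k x) (at x)"
    and bound: "\<And>k x h. x \<in> S \<Longrightarrow> norm (f' k x h) \<le> M k * norm h"
    and M: "M summable_on UNIV" and M0: "\<And>k. M k \<ge> 0"
    and f: "\<And>x. x \<in> S \<Longrightarrow> (\<lambda>k. f k x) summable_on UNIV"
  shows "((\<lambda>x. \<Sum>\<^sub>\<infinity>k. f k x) has_derivative (\<lambda>h. \<Sum>\<^sub>\<infinity>k. f' k x h)) (at x)"
proof -
  let ?F = "\<lambda>n. {k. sup_norm k \<le> n}"
  \<comment> \<open>Dividing by the norm of \<open>h\<close> makes the M-test uniform in the direction.\<close>
  have "uniform_limit (S \<times> UNIV) (\<lambda>X (y, h). \<Sum>k\<in>X. f' k y h /\<^sub>R norm h)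
      (\<lambda>(y, h). \<Sum>\<^sub>\<infinity>k. f' k y h /\<^sub>R norm h) (finite_subsets_at_top UNIV)"
    using M
    by (intro uniform_limit_cong[THEN iffD1, OF _ _ Weierstrass_m_test_general[of UNIV "S \<times> UNIV"
        "\<lambda>k (y, h). f' k y h /\<^sub>R norm h" M]])
       (use bound M0 in \<open>auto simp: divide_simps\<close>)
  hence ul: "uniform_limit (S \<times> UNIV) (\<lambda>n (y, h). \<Sum>k\<in>?F n. f' k y h /\<^sub>R norm h)
      (\<lambda>(y, h). \<Sum>\<^sub>\<infinity>k. f' k y h /\<^sub>R norm h) sequentially"
    by (rule filterlim_compose[OF _ sup_norm_exhausts])
  have "\<exists>g. \<forall>y\<in>S. (\<lambda>n. \<Sum>k\<in>?F n. f k y) \<longlonglongrightarrow> g y \<and> (g has_derivative (\<lambda>h. \<Sum>\<^sub>\<infinity>k. f' k y h)) (at y within S)"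
  proof (rule has_derivative_sequence)
    show "convex S" "x \<in> S" by fact+
    show "((\<lambda>y. \<Sum>k\<in>?F n. f k y) has_derivative (\<lambda>h. \<Sum>k\<in>?F n. f' k y h)) (at y within S)"
        if "y \<in> S" for n y
      using that by (intro has_derivative_sum) (rule has_derivative_at_withinI[OF der])
    show "(\<lambda>n. \<Sum>k\<in>?F n. f k x) \<longlonglongrightarrow> (\<Sum>\<^sub>\<infinity>k. f k x)"
      using has_sum_infsum[OF f[OF S(3)]] unfolding has_sum_def
          by (rule filterlim_compose[OF _ sup_norm_exhausts])
    fix e :: real assume "e > 0"
    from uniform_limitD[OF ul this]
    show "\<forall>\<^sub>F n in sequentially. \<forall>y\<in>S. \<forall>h. norm ((\<Sum>k\<in>?F n. f' k y h) - (\<Sum>\<^sub>\<infinity>k. f' k y h)) \<le> e * norm h"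
    proof eventually_elim
      case (elim n)
      show ?case
      proof (intro ballI allI)
        fix y h assume y: "y \<in> S"
        show "norm ((\<Sum>k\<in>?F n. f' k y h) - (\<Sum>\<^sub>\<infinity>k. f' k y h)) \<le> e * norm h"
        proof (cases "h = 0")
          case True
          have "f' k y 0 = 0" for k using bound[OF y, of k 0] by simp
          thus ?thesis using True by simp
        next
          case False
          have "dist (\<Sum>k\<in>?F n. f' k y h /\<^sub>R norm h) (\<Sum>\<^sub>\<infinity>k. f' k y h /\<^sub>R norm h) < e"
            using elim y by auto
          also have "dist (\<Sum>k\<in>?F n. f' k y h /\<^sub>R norm h) (\<Sum>\<^sub>\<infinity>k. f' k y h /\<^sub>R norm h)
              = norm (((\<Sum>k\<in>?F n. f' k y h) - (\<Sum>\<^sub>\<infinity>k. f' k y h)) /\<^sub>R norm h)"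
            by (simp add: dist_norm infsum_scaleR_right scaleR_diff_right flip: scaleR_sum_right)
          finally show ?thesis using False by (simp add: divide_simps mult.commute)
        qed
      qed
    qed
  qed
  then obtain g where g: "\<And>y. y \<in> S \<Longrightarrow> (\<lambda>n. \<Sum>k\<in>?F n. f k y) \<longlonglongrightarrow> g y"
    "\<And>y. y \<in> S \<Longrightarrow> (g has_derivative (\<lambda>h. \<Sum>\<^sub>\<infinity>k. f' k y h)) (at y within S)" by blast
  have eq: "g y = (\<Sum>\<^sub>\<infinity>k. f k y)" if "y \<in> S" for y
  proof (rule LIMSEQ_unique[OF g(1)[OF that]])
    show "(\<lambda>n. \<Sum>k\<in>?F n. f k y) \<longlonglongrightarrow> (\<Sum>\<^sub>\<infinity>k. f k y)"
      using has_sum_infsum[OF f[OF that]] unfolding has_sum_def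
          by (rule filterlim_compose[OF _ sup_norm_exhausts])
  qed
  have "(g has_derivative (\<lambda>h. \<Sum>\<^sub>\<infinity>k. f' k x h)) (at x)"
    using g(2)[OF S(3)] at_within_open[OF S(3,1)] by simp
  thus ?thesis
    by (rule has_derivative_transform_within_open[OF _ S(1,3)]) (use eq in auto)
qed

section \<open>Rapidly decreasing coefficient families\<close>

definition poly_bounded :: "(int^3 \<Rightarrow> complex) \<Rightarrow> bool" where
  "poly_bounded m \<longleftrightarrow> (\<exists>A p. \<forall>k. norm (m k) \<le> A * weight k ^ p)"

text \<open>Faster than polynomial decay in the frequency, uniformly on \<open>[t0, \<infinity>)\<close> for every
  \<open>t0 > 0\<close>. No uniformity is
  asked as \<open>t\<close> tends to \<open>0\<close>, where the coefficients have only the decay of the initial value.\<close>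

definition rapid :: "(int^3 \<Rightarrow> real \<Rightarrow> complex) \<Rightarrow> bool" where
  "rapid a \<longleftrightarrow> (\<forall>k. continuous_on {0<..} (a k)) \<and>
     (\<forall>t0>0. \<forall>N. \<exists>C. \<forall>t\<ge>t0. \<forall>k. weight k ^ N * norm (a k t) \<le> C)"

text \<open>Rapid decay together with \<open>n\<close> time derivatives. The derivative family is a witness, not a function
  of the given family, because only its values at \<open>t > 0\<close> are determined.\<close>

primrec smooth_family :: "nat \<Rightarrow> (int^3 \<Rightarrow> real \<Rightarrow> complex) \<Rightarrow> bool" where
  "smooth_family 0 a \<longleftrightarrow> rapid a"
| "smooth_family (Suc n) a \<longleftrightarrow> rapid a \<and>
     (\<exists>a'. (\<forall>k. \<forall>t>0. (a k has_vector_derivative a' k t) (at t)) \<and> smooth_family n a')"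

definition conv :: "(int^3 \<Rightarrow> real \<Rightarrow> complex) \<Rightarrow> (int^3 \<Rightarrow> real \<Rightarrow> complex) \<Rightarrow> int^3 \<Rightarrow> real \<Rightarrow> complex" where
  "conv a b k t = (\<Sum>\<^sub>\<infinity>l. a l t * b (k - l) t)"

lemma rapidD:
  assumes "rapid a" "t0 > 0"
  obtains C where "C \<ge> 0" "\<And>t k. t \<ge> t0 \<Longrightarrow> weight k ^ N * norm (a k t) \<le> C"
    "\<And>t k. t \<ge> t0 \<Longrightarrow> norm (a k t) \<le> C / weight k ^ N"
proof -
  obtain C where C: "\<And>t k. t \<ge> t0 \<Longrightarrow> weight k ^ N * norm (a k t) \<le> C"
    using assms unfolding rapid_def by metis
  have "0 \<le> weight 0 ^ N * norm (a 0 t0)" by simp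
  hence "C \<ge> 0" using C[of t0 0] by linarith
  moreover have "norm (a k t) \<le> C / weight k ^ N" if "t \<ge> t0" for t k
    using C[OF that, of k] by (simp add: pos_le_divide_eq mult.commute)
  ultimately show ?thesis using that C by blast
qed

lemma rapid_continuous: "rapid a \<Longrightarrow> continuous_on {0<..} (a k)"
  by (simp add: rapid_def)

lemma rapid_abs_summable:
  assumes "rapid a" "t > 0"
  shows "(\<lambda>k. norm (a k t)) summable_on UNIV"
proof -
  obtain C where C: "\<And>s k. s \<ge> t \<Longrightarrow> norm (a k s) \<le> C / weight k ^ 4"
    using rapidD[OF assms] by metis
  have "(\<lambda>k. C * (1 / weight k ^ 4)) summable_on UNIV"
    by (intro summable_on_cmult_right inverse_weight_summable)
  thus ?thesis
    by (rule summable_on_comparison_test) (use C[of t] in auto)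
qed

lemma rapid_multiplier:
  assumes "poly_bounded m" "rapid a"
  shows "rapid (\<lambda>k t. m k * a k t)"
  unfolding rapid_def
proof (intro conjI allI impI)
  show "continuous_on {0<..} (\<lambda>t. m k * a k t)" for k
    using assms by (intro continuous_intros rapid_continuous)
  fix t0 :: real and N :: nat assume "t0 > 0"
  obtain A p where A: "\<And>k. norm (m k) \<le> A * weight k ^ p"
    using assms unfolding poly_bounded_def by blast
  have "A \<ge> 0" using order_trans[OF norm_ge_zero A[of 0]] by simp
  obtain C where C: "\<And>t k. t \<ge> t0 \<Longrightarrow> weight k ^ (N + p) * norm (a k t) \<le> C"
    using rapidD[OF assms(2) \<open>t0 > 0\<close>] by metis
  show "\<exists>C. \<forall>t\<ge>t0. \<forall>k. weight k ^ N * norm (m k * a k t) \<le> C"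
  proof (intro exI[of _ "A * C"] allI impI)
    fix t k assume "t \<ge> t0"
    have "weight k ^ N * norm (m k * a k t)
        \<le> weight k ^ N * ((A * weight k ^ p) * norm (a k t))"
      unfolding norm_mult by (intro mult_left_mono mult_right_mono A) auto
    also have "\<dots> = A * (weight k ^ (N + p) * norm (a k t))"
      by (simp add: power_add mult_ac)
    also have "\<dots> \<le> A * C" using \<open>A \<ge> 0\<close> \<open>t \<ge> t0\<close> by (intro mult_left_mono C)
    finally show "weight k ^ N * norm (m k * a k t) \<le> A * C" .
  qed
qed

lemma rapid_add:
  assumes "rapid a" "rapid b"
  shows "rapid (\<lambda>k t. a k t + b k t)"
  unfolding rapid_def
proof (intro conjI allI impI)
  show "continuous_on {0<..} (\<lambda>t. a k t + b k t)" for k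
    using assms by (intro continuous_intros rapid_continuous)
  fix t0 :: real and N :: nat assume "t0 > 0"
  obtain C where C: "\<And>t k. t \<ge> t0 \<Longrightarrow> weight k ^ N * norm (a k t) \<le> C"
    using rapidD[OF assms(1) \<open>t0 > 0\<close>] by metis
  obtain D where D: "\<And>t k. t \<ge> t0 \<Longrightarrow> weight k ^ N * norm (b k t) \<le> D"
    using rapidD[OF assms(2) \<open>t0 > 0\<close>] by metis
  show "\<exists>C. \<forall>t\<ge>t0. \<forall>k. weight k ^ N * norm (a k t + b k t) \<le> C"
  proof (intro exI[of _ "C + D"] allI impI)
    fix t k assume "t \<ge> t0"
    have "weight k ^ N * norm (a k t + b k t)
        \<le> weight k ^ N * (norm (a k t) + norm (b k t))"
      by (intro mult_left_mono norm_triangle_ineq) auto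
    also have "\<dots> \<le> C + D" using C[OF \<open>t \<ge> t0\<close>, of k] D[OF \<open>t \<ge> t0\<close>, of k] by (simp add: distrib_left)
    finally show "weight k ^ N * norm (a k t + b k t) \<le> C + D" .
  qed
qed

text \<open>The inequality \<open>1 + |k| \<le> (1 + |l|) (1 + |k - l|)\<close> distributes the polynomial weight over the two
  factors; four more powers on the first factor make the sum over \<open>l\<close> converge.\<close>

lemma conv_term_bound:
  assumes "rapid a" "rapid b" "t0 > 0"
  obtains C where "C \<ge> 0" "\<And>t k l. t \<ge> t0 \<Longrightarrow>
    weight k ^ N * norm (a l t * b (k - l) t) \<le> C * (1 / weight l ^ 4)"
proof -
  obtain C where C: "C \<ge> 0" "\<And>t k. t \<ge> t0 \<Longrightarrow> weight k ^ (N + 4) * norm (a k t) \<le> C"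
    using rapidD[OF assms(1,3)] by metis
  obtain D where D: "D \<ge> 0" "\<And>t k. t \<ge> t0 \<Longrightarrow> weight k ^ N * norm (b k t) \<le> D"
    using rapidD[OF assms(2,3)] by metis
  have "weight k ^ N * norm (a l t * b (k - l) t) \<le> C * D * (1 / weight l ^ 4)"
    if "t \<ge> t0" for t k l
  proof -
    let ?w = "\<lambda>k. 1 + real (sup_norm k)"
    have "?w k \<le> 1 + (real (sup_norm l) + real (sup_norm (k - l)))"
      using sup_norm_split[of k l] by linarith
    also have "\<dots> \<le> ?w l * ?w (k - l)" by (simp add: algebra_simps)
    finally have "?w k ^ N \<le> (?w l * ?w (k - l)) ^ N" by (intro power_mono) auto
    hence "?w k ^ N * norm (a l t * b (k - l) t) \<le> (?w l * ?w (k - l)) ^ N * norm (a l t * b (k - l) t)"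
      by (intro mult_right_mono) auto
    also have "\<dots> = (?w l ^ (N + 4) * norm (a l t)) * (?w (k - l) ^ N * norm (b (k - l) t)) *
        (1 / ?w l ^ 4)"
      by (simp add: norm_mult power_mult_distrib power_add)
    also have "\<dots> \<le> C * D * (1 / ?w l ^ 4)"
      using C D that by (intro mult_right_mono mult_mono) auto
    finally show ?thesis .
  qed
  moreover have "C * D \<ge> 0" using C D by simp
  ultimately show ?thesis using that by blast
qed

lemma conv_summable:
  assumes "rapid a" "rapid b" "t > 0"
  shows "(\<lambda>l. a l t * b (k - l) t) summable_on UNIV"
proof -
  obtain C where C: "\<And>s k l. s \<ge> t \<Longrightarrow>
    weight k ^ 0 * norm (a l s * b (k - l) s) \<le> C * (1 / weight l ^ 4)"
    using conv_term_bound[OF assms] by metis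
  show ?thesis
    by (rule abs_summable_summable, rule Infinite_Sum.abs_summable_on_comparison_test'[where g
        = "\<lambda>l. C * (1 / weight l ^ 4)"])
       (use C[of t k] in \<open>auto intro!: summable_on_cmult_right inverse_weight_summable simp del:
           times_divide_eq_right\<close>)
qed

lemma rapid_conv:
  assumes "rapid a" "rapid b"
  shows "rapid (conv a b)"
  unfolding rapid_def
proof (intro conjI allI impI)
  let ?q = "\<lambda>l. 1 / weight l ^ 4"
  fix k
  show "continuous_on {0<..} (conv a b k)"
  proof (rule continuous_at_imp_continuous_on, rule ballI)
    fix t :: real assume "t \<in> {0<..}"
    define t0 where "t0 = t / 2"
    have t0: "t0 > 0" "t \<in> {t0<..}" using \<open>t \<in> {0<..}\<close> by (auto simp: t0_def)
    obtain C where C: "\<And>t k l. t \<ge> t0 \<Longrightarrow> weight k ^ 0 * norm (a l t * b (k - l) t) \<le> C * ?q l"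
      using conv_term_bound[OF assms t0(1)] by metis
    have "uniform_limit {t0<..} (\<lambda>X t. \<Sum>l\<in>X. a l t * b (k - l) t) (conv a b k)
        (finite_subsets_at_top UNIV)"
      unfolding conv_def
    proof (rule Weierstrass_m_test_general)
      show "(\<lambda>l. C * ?q l) summable_on UNIV" by (intro summable_on_cmult_right inverse_weight_summable)
    qed (use C[where k = k] in auto)
    hence "continuous_on {t0<..} (conv a b k)"
    proof (rule uniform_limit_theorem[rotated])
      show "\<forall>\<^sub>F X in finite_subsets_at_top UNIV. continuous_on {t0<..} (\<lambda>t. \<Sum>l\<in>X. a l t * b (k - l) t)"
      proof (intro always_eventually allI continuous_on_sum continuous_on_mult)
        show "continuous_on {t0<..} (a l)" "continuous_on {t0<..} (b l)" for l
          using t0 assms by (auto intro: continuous_on_subset[OF rapid_continuous])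
      qed
    qed auto
    thus "isCont (conv a b k) t" using t0(2) continuous_on_eq_continuous_at[of "{t0<..}"] by auto
  qed
next
  let ?q = "\<lambda>l. 1 / weight l ^ 4"
  fix t0 :: real and N :: nat assume t0: "t0 > 0"
  obtain C where C: "C \<ge> 0" "\<And>t k l. t \<ge> t0 \<Longrightarrow> weight k ^ N * norm (a l t * b (k - l) t) \<le> C * ?q l"
    using conv_term_bound[OF assms t0] by metis
  show "\<exists>C. \<forall>t\<ge>t0. \<forall>k. weight k ^ N * norm (conv a b k t) \<le> C"
  proof (intro exI[of _ "C * (\<Sum>\<^sub>\<infinity>l. ?q l)"] allI impI)
    fix t k assume t: "t \<ge> t0"
    let ?w = "weight k ^ N"
    have "norm (conv a b k t) \<le> C / ?w * (\<Sum>\<^sub>\<infinity>l. ?q l)"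
      unfolding conv_def
    proof (rule norm_infsum_le)
      show "((\<lambda>l. a l t * b (k - l) t) has_sum (\<Sum>\<^sub>\<infinity>l. a l t * b (k - l) t)) UNIV"
        using t t0 by (intro has_sum_infsum conv_summable assms) auto
      show "((\<lambda>l. C / ?w * ?q l) has_sum (C / ?w * (\<Sum>\<^sub>\<infinity>l. ?q l))) UNIV"
        by (intro has_sum_cmult_right has_sum_infsum inverse_weight_summable)
      show "norm (a l t * b (k - l) t) \<le> C / ?w * ?q l" for l
        using C(2)[OF t, of k l] by (simp add: field_simps)
    qed
    thus "?w * norm (conv a b k t) \<le> C * (\<Sum>\<^sub>\<infinity>l. ?q l)"
      by (simp add: field_simps)
  qed
qed

lemma conv_has_vector_derivative:
  assumes "rapid a" "rapid b" "rapid a'" "rapid b'"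
    and a: "\<And>k t. t > 0 \<Longrightarrow> (a k has_vector_derivative a' k t) (at t)"
    and b: "\<And>k t. t > 0 \<Longrightarrow> (b k has_vector_derivative b' k t) (at t)"
    and "t > 0"
  shows "(conv a b k has_vector_derivative (conv a' b k t + conv a b' k t)) (at t)"
proof -
  let ?q = "\<lambda>l. 1 / weight l ^ 4"
  define t0 where "t0 = t / 2"
  have t0: "t0 > 0" "t \<in> {t0<..}" using assms by (auto simp: t0_def)
  obtain C where C: "C \<ge> 0" "\<And>t k l. t \<ge> t0 \<Longrightarrow> weight k ^ 0 * norm (a' l t * b (k - l) t) \<le> C * ?q l"
    using conv_term_bound[OF assms(3,2) t0(1)] by metis
  obtain D where D: "D \<ge> 0" "\<And>t k l. t \<ge> t0 \<Longrightarrow> weight k ^ 0 * norm (a l t * b' (k - l) t) \<le> D * ?q l"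
    using conv_term_bound[OF assms(1,4) t0(1)] by metis
  have "((\<lambda>t. \<Sum>\<^sub>\<infinity>l. a l t * b (k - l) t) has_derivative
      (\<lambda>h. \<Sum>\<^sub>\<infinity>l. h *\<^sub>R (a' l t * b (k - l) t + a l t * b' (k - l) t))) (at t)"
  proof (rule has_derivative_infsum[of "{t0<..}"])
    show "(\<lambda>l. C * ?q l + D * ?q l) summable_on UNIV"
      by (intro summable_on_add summable_on_cmult_right inverse_weight_summable)
    fix l and s :: real assume s: "s \<in> {t0<..}"
    show "((\<lambda>t. a l t * b (k - l) t) has_derivative
        (\<lambda>h. h *\<^sub>R (a' l s * b (k - l) s + a l s * b' (k - l) s))) (at s)"
      using has_vector_derivative_mult[OF a[where k = l and t = s] b[where k = "k - l" and t = s]] s t0(1)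
      unfolding has_vector_derivative_def by (simp add: add.commute)
    fix h :: real
    have "norm (a' l s * b (k - l) s + a l s * b' (k - l) s) \<le> C * ?q l + D * ?q l"
      using C(2)[of s k l] D(2)[of s k l] s by (intro norm_triangle_mono) auto
    thus "norm (h *\<^sub>R (a' l s * b (k - l) s + a l s * b' (k - l) s)) \<le> (C * ?q l + D * ?q l) * norm h"
      by (simp add: mult.commute[of _ "\<bar>h\<bar>"] mult_left_mono)
  qed (use t0 C D in \<open>auto intro!: conv_summable assms(1,2)\<close>)
  moreover have "(\<Sum>\<^sub>\<infinity>l. h *\<^sub>R (a' l t * b (k - l) t + a l t * b' (k - l) t))
      = h *\<^sub>R (conv a' b k t + conv a b' k t)" for h :: real
    using assms unfolding conv_def
    by (subst infsum_scaleR_right, subst infsum_add) (auto intro: conv_summable)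
  ultimately show ?thesis
    unfolding has_vector_derivative_def conv_def[abs_def] by simp
qed

lemma smooth_family_rapid: "smooth_family n a \<Longrightarrow> rapid a"
  by (cases n) auto

lemma smooth_family_mono: "smooth_family (Suc n) a \<Longrightarrow> smooth_family n a"
proof (induction n arbitrary: a)
  case (Suc n)
  thus ?case by (metis smooth_family.simps(2))
qed simp

lemma smooth_family_multiplier:
  assumes "poly_bounded m"
  shows "smooth_family n a \<Longrightarrow> smooth_family n (\<lambda>k t. m k * a k t)"
proof (induction n arbitrary: a)
  case 0
  thus ?case using rapid_multiplier[OF assms] by simp
next
  case (Suc n)
  then obtain a' where "rapid a" "\<And>k t. t > 0 \<Longrightarrow> (a k has_vector_derivative a' k t) (at t)"
      "smooth_family n a'"
    by auto
  moreover from this(2) have "\<And>k t. t > 0 \<Longrightarrow> ((\<lambda>t. m k * a k t) has_vector_derivative m k * a' k t) (at t)"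
    by (intro has_vector_derivative_mult_right)
  ultimately show ?case using Suc.IH rapid_multiplier[OF assms]
    by (auto intro!: exI[of _ "\<lambda>k t. m k * a' k t"])
qed

lemma smooth_family_add: "smooth_family n a \<Longrightarrow> smooth_family n b \<Longrightarrow> smooth_family n (\<lambda>k t. a k t + b k t)"
proof (induction n arbitrary: a b)
  case 0
  thus ?case using rapid_add by simp
next
  case (Suc n)
  then obtain a' where "rapid a" "\<And>k t. t > 0 \<Longrightarrow> (a k has_vector_derivative a' k t) (at t)"
      "smooth_family n a'"
    by auto
  moreover from Suc.prems obtain b' where "rapid b" "\<And>k t. t > 0 \<Longrightarrow> (b k has_vector_derivative b' k
      t) (at t)" "smooth_family n b'"
    by auto
  ultimately show ?case using Suc.IH rapid_add
    by (auto intro!: exI[of _ "\<lambda>k t. a' k t + b' k t"] has_vector_derivative_add)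
qed

lemma poly_bounded_const: "poly_bounded (\<lambda>k. c)"
  unfolding poly_bounded_def by (intro exI[of _ "norm c"] exI[of _ 0]) auto

lemma smooth_family_sum:
  assumes "finite I" "I \<noteq> {}" "\<And>i. i \<in> I \<Longrightarrow> smooth_family n (a i)"
  shows "smooth_family n (\<lambda>k t. \<Sum>i\<in>I. a i k t)"
  using assms by (induction rule: finite_ne_induct) (auto intro!: smooth_family_add)

lemma smooth_family_conv: "smooth_family n a \<Longrightarrow> smooth_family n b \<Longrightarrow> smooth_family n (conv a b)"
proof (induction n arbitrary: a b)
  case 0
  thus ?case using rapid_conv by simp
next
  case (Suc n)
  then obtain a' where a: "rapid a" "\<And>k t. t > 0 \<Longrightarrow> (a k has_vector_derivative a' k t) (at t)"
      "smooth_family n a'"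
    by auto
  from Suc.prems obtain b' where b: "rapid b" "\<And>k t. t > 0 \<Longrightarrow> (b k has_vector_derivative b' k t)
      (at t)" "smooth_family n b'"
    by auto
  have "smooth_family n (\<lambda>k t. conv a' b k t + conv a b' k t)"
    using Suc.IH[OF a(3) smooth_family_mono[OF Suc.prems(2)]]
      Suc.IH[OF smooth_family_mono[OF Suc.prems(1)] b(3)] by (rule smooth_family_add)
  moreover have "(conv a b k has_vector_derivative conv a' b k t + conv a b' k t) (at t)"
      if "t > 0" for k t
    by (rule conv_has_vector_derivative[OF a(1) b(1) smooth_family_rapid[OF a(3)]
        smooth_family_rapid[OF b(3)] a(2) b(2) that])
  ultimately show ?case using rapid_conv[OF a(1) b(1)]
    by (auto intro!: exI[of _ "\<lambda>k t. conv a' b k t + conv a b' k t"])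
qed

section \<open>Fourier synthesis of smooth functions\<close>

definition character :: "int^3 \<Rightarrow> real^3 \<Rightarrow> complex" where
  "character k x = exp (2 * of_real pi * \<i> * of_real (x \<bullet> ivec k))"

lemma norm_character [simp]: "norm (character k x) = 1"
  by (simp add: character_def norm_exp_eq_Re)

lemma ivec_add: "ivec (k + l) = ivec k + ivec l" by (simp add: ivec_def vec_eq_iff)
lemma ivec_diff: "ivec (k - l) = ivec k - ivec l" by (simp add: ivec_def vec_eq_iff)
lemma ivec_minus: "ivec (- k) = - ivec k" by (simp add: ivec_def vec_eq_iff)
lemma ivec_0 [simp]: "ivec 0 = 0" by (simp add: ivec_def vec_eq_iff)

lemma character_add: "character (k + l) x = character k x * character l x"
  by (simp add: character_def ivec_add inner_add_right algebra_simps flip: exp_add)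

lemma character_has_derivative:
  "(character k has_derivative (\<lambda>v. 2 * of_real pi * \<i> * of_real (v \<bullet> ivec k) * character k x)) (at x)"
proof -
  have "((\<lambda>x::real^3. complex_of_real (x \<bullet> ivec k)) has_derivative (\<lambda>v. complex_of_real
      (v \<bullet> ivec k))) (at x)"
    by (intro bounded_linear_imp_has_derivative bounded_linear_compose[OF bounded_linear_of_real
        bounded_linear_inner_left])
  hence "((\<lambda>x::real^3. 2 * of_real pi * \<i> * complex_of_real (x \<bullet> ivec k)) has_derivative
      (\<lambda>v. 2 * of_real pi * \<i> * complex_of_real (v \<bullet> ivec k))) (at x)"
    by (rule has_derivative_mult_right)
  from has_derivative_compose[OF this DERIV_exp[unfolded has_field_derivative_def]] show ?thesis
    unfolding character_def[abs_def] by (simp add: mult_ac)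
qed

definition synth :: "(int^3 \<Rightarrow> real \<Rightarrow> complex) \<Rightarrow> real \<Rightarrow> real^3 \<Rightarrow> complex" where
  "synth a t x = (\<Sum>\<^sub>\<infinity>k. a k t * character k x)"

lemma synth_abs_summable:
  assumes "rapid a" "t > 0"
  shows "(\<lambda>k. norm (a k t * character k x)) summable_on UNIV"
  using rapid_abs_summable[OF assms] by (simp add: norm_mult)

lemma synth_summable:
  assumes "rapid a" "t > 0"
  shows "(\<lambda>k. a k t * character k x) summable_on UNIV"
  using abs_summable_summable[OF synth_abs_summable[OF assms]] .

lemma synth_continuous:
  assumes "rapid a"
  shows "continuous_on (UNIV \<times> {0<..}) (\<lambda>(x, t). synth a t x)"
proof (rule continuous_at_imp_continuous_on, rule ballI)
  fix p :: "(real^3) \<times> real" assume "p \<in> UNIV \<times> {0<..}"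
  define t0 where "t0 = snd p / 2"
  have t0: "t0 > 0" "p \<in> UNIV \<times> {t0<..}" using \<open>p \<in> _\<close> by (auto simp: t0_def)
  obtain C where C: "\<And>t k. t \<ge> t0 \<Longrightarrow> norm (a k t) \<le> C / weight k ^ 4"
    using rapidD[OF assms t0(1)] by metis
  have "uniform_limit (UNIV \<times> {t0<..}) (\<lambda>X p. \<Sum>k\<in>X. a k (snd p) * character k (fst p))
      (\<lambda>p. \<Sum>\<^sub>\<infinity>k. a k (snd p) * character k (fst p)) (finite_subsets_at_top UNIV)"
  proof (rule Weierstrass_m_test_general)
    show "(\<lambda>k. C * (1 / weight k ^ 4)) summable_on UNIV"
      by (intro summable_on_cmult_right inverse_weight_summable)
  qed (use C in \<open>auto simp: norm_mult\<close>)
  hence "continuous_on (UNIV \<times> {t0<..}) (\<lambda>p. \<Sum>\<^sub>\<infinity>k. a k (snd p) * character k (fst p))"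
  proof (rule uniform_limit_theorem[rotated])
    show "\<forall>\<^sub>F X in finite_subsets_at_top UNIV.
        continuous_on (UNIV \<times> {t0<..}) (\<lambda>p. \<Sum>k\<in>X. a k (snd p) * character k (fst p))"
    proof (intro always_eventually allI continuous_on_sum continuous_on_mult)
      fix k
      show "continuous_on (UNIV \<times> {t0<..}) (\<lambda>p. a k (snd p))"
        using t0 by (intro continuous_on_compose2[OF rapid_continuous[OF assms]] continuous_intros) auto
      show "continuous_on (UNIV \<times> {t0<..}) (\<lambda>p. character k (fst p))"
        unfolding character_def by (intro continuous_intros)
    qed
  qed auto
  moreover have "open (UNIV \<times> {t0<..} :: ((real^3) \<times> real) set)" by (intro open_Times) auto
  ultimately have "isCont (\<lambda>p. \<Sum>\<^sub>\<infinity>k. a k (snd p) * character k (fst p)) p"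
    using t0(2) continuous_on_eq_continuous_at by blast
  thus "isCont (\<lambda>(x, t). synth a t x) p"
    by (simp add: case_prod_unfold synth_def)
qed

text \<open>The Fourier multiplier of the directional derivative along \<open>v\<close>.\<close>

definition deriv_symbol :: "real^3 \<Rightarrow> int^3 \<Rightarrow> complex" where
  "deriv_symbol v k = 2 * of_real pi * \<i> * of_real (v \<bullet> ivec k)"

lemma norm_deriv_symbol_le: "norm (deriv_symbol v k) \<le> 20 * norm v * weight k"
proof -
  have "norm (deriv_symbol v k) = 2 * pi * \<bar>v \<bullet> ivec k\<bar>"
    by (simp add: deriv_symbol_def norm_mult)
  also have "\<dots> \<le> (2 * 3.2) * (norm v * norm (ivec k))"
    using pi_less_4 pi_approx by (intro mult_mono Cauchy_Schwarz_ineq2) auto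
  also have "\<dots> \<le> (2 * 3.2) * (norm v * (3 * real (sup_norm k)))"
    by (intro mult_left_mono norm_ivec_le_sup_norm) auto
  also have "\<dots> = 19.2 * (norm v * real (sup_norm k))" by simp
  also have "\<dots> \<le> 20 * (norm v * weight k)"
    by (intro mult_mono) auto
  finally show ?thesis by simp
qed

lemma poly_bounded_deriv_symbol: "poly_bounded (deriv_symbol v)"
  unfolding poly_bounded_def
  by (intro exI[of _ "20 * norm v"] exI[of _ 1]) (use norm_deriv_symbol_le in auto)

text \<open>On a half-space \<open>t > t0 > 0\<close> the rapid decay of both families dominates the differentiated series,
  including the factor \<open>|k|\<close> from the space derivative.\<close>

lemma synth_has_derivative:
  assumes a: "rapid a" and a': "rapid a'" and der: "\<And>k t. t > 0 \<Longrightarrow> (a k has_vector_derivative a' k t)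
      (at t)"
    and t: "t > 0"
  shows "((\<lambda>(x, t). synth a t x) has_derivative
     (\<lambda>(v, \<tau>). synth (\<lambda>k t. deriv_symbol v k * a k t + of_real \<tau> * a' k t) t x)) (at (x, t))"
proof -
  let ?q = "\<lambda>l. 1 / weight l ^ 4"
  define t0 where "t0 = t / 2"
  define S :: "((real^3) \<times> real) set" where "S = UNIV \<times> {t0<..}"
  have t0: "t0 > 0" "(x, t) \<in> S" using t by (auto simp: t0_def S_def)
  obtain C where C: "C \<ge> 0" "\<And>t k. t \<ge> t0 \<Longrightarrow> norm (a k t) \<le> C / weight k ^ 5"
    using rapidD[OF a t0(1)] by metis
  obtain D where D: "D \<ge> 0" "\<And>t k. t \<ge> t0 \<Longrightarrow> norm (a' k t) \<le> D / weight k ^ 4"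
    using rapidD[OF a' t0(1)] by metis
  have "((\<lambda>p. \<Sum>\<^sub>\<infinity>k. a k (snd p) * character k (fst p)) has_derivative
      (\<lambda>h. \<Sum>\<^sub>\<infinity>k. (deriv_symbol (fst h) k * a k (snd (x, t)) + of_real (snd h) * a' k (snd (x, t))) *
          character k (fst (x, t)))) (at (x, t))"
  proof (rule has_derivative_infsum[of S])
    show "open S" "convex S" unfolding S_def by (auto intro!: open_Times convex_Times)
    show "(x, t) \<in> S" by fact
    show "(\<lambda>k. (20 * C + D) * ?q k) summable_on UNIV"
      by (intro summable_on_cmult_right inverse_weight_summable)
    show "0 \<le> (20 * C + D) * ?q k" for k using C D by simp
    fix p assume p: "p \<in> S"
    hence p0: "snd p > 0" "snd p \<ge> t0" using t0 by (auto simp: S_def)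
    show "(\<lambda>k. a k (snd p) * character k (fst p)) summable_on UNIV"
      by (rule synth_summable[OF a p0(1)])
    fix k
    have 1: "((\<lambda>p. a k (snd p)) has_derivative (\<lambda>h. snd h *\<^sub>R a' k (snd p))) (at p)"
      using has_derivative_compose[OF bounded_linear_imp_has_derivative[OF bounded_linear_snd]
          der[OF p0(1), unfolded has_vector_derivative_def]]
      by simp
    have 2: "((\<lambda>p. character k (fst p)) has_derivative (\<lambda>h. deriv_symbol (fst h) k * character k
        (fst p))) (at p)"
      using has_derivative_compose[OF bounded_linear_imp_has_derivative[OF bounded_linear_fst]
          character_has_derivative]
      by (simp add: deriv_symbol_def)
    show "((\<lambda>p. a k (snd p) * character k (fst p)) has_derivative
        (\<lambda>h. (deriv_symbol (fst h) k * a k (snd p) + of_real (snd h) * a' k (snd p)) * character k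
            (fst p))) (at p)"
      by (rule has_derivative_eq_rhs[OF has_derivative_mult[OF 1 2]])
         (simp add: fun_eq_iff algebra_simps scaleR_conv_of_real)
    fix h
    let ?w = "1 + real (sup_norm k)"
    have "norm (deriv_symbol (fst h) k * a k (snd p) + of_real (snd h) * a' k (snd p))
        \<le> (20 * norm (fst h) * ?w) * (C / ?w ^ 5) + norm (snd h) * (D / ?w ^ 4)"
      using C D p0
      by (intro norm_triangle_mono) (auto simp: norm_mult simp del: times_divide_eq_right intro!:
          mult_mono norm_deriv_symbol_le)
    also have "(20 * norm (fst h) * ?w) * (C / ?w ^ 5) = 20 * norm (fst h) * C * ?q k"
    proof -
      have "w / w ^ 5 = 1 / w ^ 4" if "w > 0" for w :: real
        using that by (simp add: divide_simps flip: power_Suc)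
      from this[of ?w] have "?w / ?w ^ 5 = 1 / ?w ^ 4" by simp
      hence "(20 * norm (fst h) * C) * (?w / ?w ^ 5) = (20 * norm (fst h) * C) * (1 / ?w ^ 4)" by simp
      thus ?thesis by (simp add: mult_ac)
    qed
    also have "20 * norm (fst h) * C * ?q k + norm (snd h) * (D / ?w ^ 4)
        = 20 * C * ?q k * norm (fst h) + D * ?q k * norm (snd h)" by (simp add: mult_ac)
    also have "\<dots> \<le> 20 * C * ?q k * norm h + D * ?q k * norm h"
      using C D by (intro add_mono mult_left_mono) (auto simp: norm_prod_def intro: real_le_rsqrt)
    also have "\<dots> = (20 * C + D) * ?q k * norm h" by (simp add: algebra_simps add_divide_distrib)
    finally show "norm ((deriv_symbol (fst h) k * a k (snd p) + of_real (snd h) * a' k (snd p)) *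
        character k (fst p))
        \<le> (20 * C + D) * ?q k * norm h" by (simp add: norm_mult)
  qed
  thus ?thesis by (simp add: synth_def case_prod_unfold)
qed

lemma Ck_on_cong:
  assumes "open S" "\<And>x. x \<in> S \<Longrightarrow> f x = g x"
  shows "Ck_on n S f \<longleftrightarrow> Ck_on n S g"
  using assms(2)
proof (induction n arbitrary: f g)
  case 0
  thus ?case by (simp cong: continuous_on_cong)
next
  case (Suc n)
  have der: "(f has_derivative D) (at x) \<longleftrightarrow> (g has_derivative D) (at x)" if "x \<in> S" for x D
    using has_derivative_transform_within_open[OF _ assms(1) that, of f D UNIV g]
      has_derivative_transform_within_open[OF _ assms(1) that, of g D UNIV f] Suc.prems by auto
  have "f differentiable (at x) \<longleftrightarrow> g differentiable (at x)" if "x \<in> S" for x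
    unfolding differentiable_def using der[OF that] by simp
  moreover have "frechet_derivative f (at x) v = frechet_derivative g (at x) v" if "x \<in> S" for x v
    unfolding frechet_derivative_def using der[OF that] by simp
  ultimately show ?case
    using Suc.IH[of "\<lambda>x. frechet_derivative f (at x) v" "\<lambda>x. frechet_derivative g (at x) v" for v] by auto
qed

lemma Ck_on_SucI:
  assumes "open S" "\<And>x. x \<in> S \<Longrightarrow> (f has_derivative D x) (at x)" "\<And>v. Ck_on n S (\<lambda>x. D x v)"
  shows "Ck_on (Suc n) S f"
proof -
  have "frechet_derivative f (at x) = D x" if "x \<in> S" for x
    using frechet_derivative_at[OF assms(2)[OF that]] by simp
  hence "Ck_on n S (\<lambda>x. frechet_derivative f (at x) v)" for v
    using Ck_on_cong[OF assms(1), of "\<lambda>x. frechet_derivative f (at x) v" "\<lambda>x. D x v"] assms(3) by simp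
  moreover have "f differentiable (at x)" if "x \<in> S" for x
    using assms(2)[OF that] by (rule differentiableI)
  ultimately show ?thesis by simp
qed

lemma open_positive_times: "open (UNIV \<times> {0<..} :: ((real^3) \<times> real) set)"
  by (intro open_Times) auto

text \<open>A directional derivative in space-time of a synthesised function is again synthesised, from a family
  with one time derivative less; space derivatives cost nothing.\<close>

lemma Ck_on_synth: "smooth_family n a \<Longrightarrow> Ck_on n (UNIV \<times> {0<..}) (\<lambda>(x, t). synth a t x)"
proof (induction n arbitrary: a)
  case 0
  thus ?case using synth_continuous by simp
next
  case (Suc n)
  then obtain a' where a: "rapid a" "\<And>k t. t > 0 \<Longrightarrow> (a k has_vector_derivative a' k t) (at t)"
      "smooth_family n a'"
    by auto
  define D where "D = (\<lambda>(x, t) (v, \<tau>). synth (\<lambda>k t. deriv_symbol v k * a k t + of_real \<tau> * a' k t) t x)"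
  show ?case
  proof (rule Ck_on_SucI[OF open_positive_times])
    show "((\<lambda>(x, t). synth a t x) has_derivative D p) (at p)" if "p \<in> UNIV \<times> {0<..}" for p
      using synth_has_derivative[OF a(1) smooth_family_rapid[OF a(3)] a(2), of "snd p" "fst p"] that
      by (auto simp: D_def case_prod_unfold)
    fix h :: "(real^3) \<times> real"
    obtain v \<tau> where h: "h = (v, \<tau>)" by force
    have "smooth_family n (\<lambda>k t. deriv_symbol v k * a k t + of_real \<tau> * a' k t)"
      using smooth_family_mono[OF Suc.prems] a
      by (intro smooth_family_add smooth_family_multiplier poly_bounded_deriv_symbol poly_bounded_const)
    from Suc.IH[OF this] show "Ck_on n (UNIV \<times> {0<..}) (\<lambda>p. D p h)"
      by (simp add: D_def h case_prod_unfold)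
  qed
qed

lemma has_derivative_vec:
  fixes f :: "'a::real_normed_vector \<Rightarrow> complex^3"
  assumes "\<And>j. ((\<lambda>x. f x $ j) has_derivative D j) (at x)"
  shows "(f has_derivative (\<lambda>v. \<chi> j. D j v)) (at x)"
  using assms by (subst has_derivative_componentwise_within)
    (auto simp: Basis_vec_def inner_axis intro!: has_derivative_inner_left)

lemma Ck_on_vec:
  fixes f :: "'a::real_normed_vector \<Rightarrow> complex^3"
  assumes "open S"
  shows "(\<And>j. Ck_on n S (\<lambda>x. f x $ j)) \<Longrightarrow> Ck_on n S f"
proof (induction n arbitrary: f)
  case 0
  have "continuous_on S (\<lambda>x. \<chi> j. f x $ j)"
    using 0 by (intro continuous_on_vec_lambda) auto
  thus ?case by simp
next
  case (Suc n)
  define D where "D x v = (\<chi> j. frechet_derivative (\<lambda>x. f x $ j) (at x) v)" for x v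
  show ?case
  proof (rule Ck_on_SucI[OF assms])
    fix x assume "x \<in> S"
    have "((\<lambda>x. f x $ j) has_derivative frechet_derivative (\<lambda>x. f x $ j) (at x)) (at x)" for j
      using Suc.prems[of j] \<open>x \<in> S\<close> frechet_derivative_works by auto
    thus "(f has_derivative D x) (at x)"
      unfolding D_def[abs_def] by (rule has_derivative_vec)
  next
    fix v show "Ck_on n S (\<lambda>x. D x v)"
      using Suc.prems by (intro Suc.IH) (auto simp: D_def)
  qed
qed

text \<open>The space-time derivative is applied to the family frozen at time \<open>t\<close>, whose time derivative
  is zero.\<close>

lemma synth_space_derivative:
  assumes "rapid a" "t > 0"
  shows "(synth a t has_derivative (\<lambda>v. synth (\<lambda>k t. deriv_symbol v k * a k t) t x)) (at x)"
proof -
  define b where "b = (\<lambda>k s::real. a k t)"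
  have b: "rapid b"
    unfolding rapid_def
  proof (intro conjI allI impI)
    fix t0 :: real and N
    obtain C where "\<And>s k. s \<ge> t \<Longrightarrow> weight k ^ N * norm (a k s) \<le> C"
      using rapidD[OF assms] by metis
    thus "\<exists>C. \<forall>s\<ge>t0. \<forall>k. weight k ^ N * norm (b k s) \<le> C"
      by (auto simp: b_def)
  qed (simp add: b_def)
  have "rapid (\<lambda>k s. 0)" by (auto simp: rapid_def)
  hence "((\<lambda>(x, t). synth b t x) has_derivative
     (\<lambda>(v, \<tau>). synth (\<lambda>k t. deriv_symbol v k * b k t + of_real \<tau> * 0) t x)) (at (x, t))"
    using assms by (intro synth_has_derivative b) (auto simp: b_def)
  moreover have "((\<lambda>x. (x, t)) has_derivative (\<lambda>v. (v, 0))) (at x)"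
    by (intro has_derivative_Pair has_derivative_ident has_derivative_const)
  ultimately have "((\<lambda>x. (\<lambda>(x, t). synth b t x) (x, t)) has_derivative
      (\<lambda>v. (\<lambda>(v, \<tau>). synth (\<lambda>k t. deriv_symbol v k * b k t + of_real \<tau> * 0) t x) (v, 0))) (at x)"
    by (intro has_derivative_compose[of "\<lambda>x. (x, t)" _ _ _ "\<lambda>(x, t). synth b t x"])
  thus ?thesis by (simp add: synth_def[abs_def] b_def)
qed

lemma synth_time_derivative:
  assumes "rapid a" "rapid a'" "\<And>k t. t > 0 \<Longrightarrow> (a k has_vector_derivative a' k t) (at t)" "t > 0"
  shows "((\<lambda>s. synth a s x) has_vector_derivative synth a' t x) (at t)"
proof -
  note * = synth_has_derivative[OF assms, of x]
  have "((\<lambda>s. (x, s)) has_derivative (\<lambda>\<tau>. (0, \<tau>))) (at t)"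
    by (intro has_derivative_Pair has_derivative_ident has_derivative_const)
  from has_derivative_compose[OF this *]
  have "((\<lambda>s. synth a s x) has_derivative (\<lambda>\<tau>. synth (\<lambda>k t. of_real \<tau> * a' k t) t x)) (at t)"
    by (simp add: deriv_symbol_def)
  moreover have "synth (\<lambda>k t. of_real \<tau> * a' k t) t x = \<tau> *\<^sub>R synth a' t x" for \<tau>
    unfolding synth_def infsum_scaleR_right[symmetric] by (simp add: scaleR_conv_of_real mult.assoc)
  ultimately show ?thesis unfolding has_vector_derivative_def by simp
qed

text \<open>Absolute convergence permits summing the double series along the lines \<open>l + m = k\<close>.\<close>

lemma synth_mult:
  assumes "rapid a" "rapid b" "t > 0"
  shows "synth a t x * synth b t x = synth (conv a b) t x"
proof -
  define A where "A k = a k t * character k x" for k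
  define B where "B k = b k t * character k x" for k
  have sA: "(\<lambda>k. norm (A k)) summable_on UNIV" and sB: "(\<lambda>k. norm (B k)) summable_on UNIV"
    using assms synth_abs_summable by (auto simp: A_def B_def)
  have AB: "(\<lambda>p. norm (case p of (l, m) \<Rightarrow> A l * B m)) summable_on UNIV \<times> UNIV"
    unfolding Infinite_Sum.abs_summable_on_Sigma_iff
  proof (intro conjI ballI)
    show "(\<lambda>m. norm (case (l, m) of (l, m) \<Rightarrow> A l * B m)) summable_on UNIV" for l
      using sB by (simp add: norm_mult summable_on_cmult_right)
    have "(\<lambda>l. norm (A l) * (\<Sum>\<^sub>\<infinity>m. norm (B m))) summable_on UNIV"
      by (rule summable_on_cmult_left[OF sA])
    thus "(\<lambda>l. norm (\<Sum>\<^sub>\<infinity>m. norm (case (l, m) of (l, m) \<Rightarrow> A l * B m))) summable_on UNIV"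
      by (simp add: norm_mult infsum_cmult_right' abs_mult infsum_nonneg)
  qed
  have bij: "bij_betw (\<lambda>(k, l). (l, k - l)) UNIV (UNIV :: ((int^3) \<times> (int^3)) set)"
    by (rule bij_betwI[where g = "\<lambda>(l, m). (l + m, l)"]) auto
  have AB': "(\<lambda>(k, l). A l * B (k - l)) summable_on UNIV \<times> UNIV"
    using abs_summable_summable[OF AB] summable_on_reindex_bij_betw[OF bij, of "\<lambda>(l, m). A l * B m"]
    by (simp add: case_prod_unfold)
  have "synth a t x * synth b t x = (\<Sum>\<^sub>\<infinity>l. \<Sum>\<^sub>\<infinity>m. A l * B m)"
    using sA sB by (simp add: synth_def A_def B_def infsum_cmult_right' infsum_cmult_left')
  also have "\<dots> = (\<Sum>\<^sub>\<infinity>(l, m)\<in>UNIV \<times> UNIV. A l * B m)"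
    using abs_summable_summable[OF AB] by (rule infsum_Sigma'_banach)
  also have "\<dots> = (\<Sum>\<^sub>\<infinity>(k, l)\<in>UNIV \<times> UNIV. A l * B (k - l))"
    using infsum_reindex_bij_betw[OF bij, of "\<lambda>(l, m). A l * B m"] by (simp add: case_prod_unfold)
  also have "\<dots> = (\<Sum>\<^sub>\<infinity>k. \<Sum>\<^sub>\<infinity>l. A l * B (k - l))"
    using AB' by (rule infsum_Sigma'_banach[symmetric])
  also have "\<dots> = (\<Sum>\<^sub>\<infinity>k. \<Sum>\<^sub>\<infinity>l. (a l t * b (k - l) t) * character k x)"
  proof -
    have "A l * B (k - l) = (a l t * b (k - l) t) * character k x" for k l
      using character_add[of l "k - l" x] by (simp add: A_def B_def)
    thus ?thesis by simp
  qed
  also have "\<dots> = synth (conv a b) t x"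
    by (simp add: synth_def conv_def infsum_cmult_left')
  finally show ?thesis .
qed

section \<open>Square-integrable functions on the torus\<close>

lemma character_has_component_form:
  "character k x = (\<Prod>j\<in>UNIV. exp (2 * of_real pi * \<i> * of_real (x $ j * of_int (k $ j))))"
  unfolding character_def
  by (subst exp_sum[symmetric]) (auto simp: inner_vec_def ivec_def sum_distrib_left)

lemma character_0 [simp]: "character 0 x = 1" by (simp add: character_def)

lemma cnj_character: "cnj (character k x) = character (- k) x"
  by (simp add: character_def ivec_minus exp_cnj)

lemma continuous_character: "continuous_on S (character k)"
  unfolding character_def by (intro continuous_intros)

lemma character_periodic: "periodic (character k)"
  unfolding periodic_def
proof (intro allI)
  fix x and m :: "int^3"
  have "complex_of_real (ivec m \<bullet> ivec k) = of_int (\<Sum>j\<in>UNIV. m $ j * k $ j)"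
    by (simp add: inner_vec_def ivec_def)
  hence "exp (2 * of_real pi * \<i> * complex_of_real (ivec m \<bullet> ivec k)) = 1"
    by (simp only:) (metis exp_2pi_1_int mult.assoc mult.commute)
  thus "character k (x + ivec m) = character k x"
    by (simp add: character_def inner_add_left distrib_left exp_add)
qed

lemma One_component: "(One :: real^'n) $ j = 1"
  by (simp add: cart_eq_inner_axis inner_sum_left inner_Basis axis_in_Basis_iff)

lemma mem_period_cell:
  fixes x :: "real^3"
  shows "x \<in> cbox 0 One \<longleftrightarrow> (\<forall>j. 0 \<le> x $ j \<and> x $ j \<le> 1)"
    and "x \<in> box 0 One \<longleftrightarrow> (\<forall>j. 0 < x $ j \<and> x $ j < 1)"
  unfolding mem_box_cart One_component by simp_all

lemma finite_measure_torus: "finite_measure torus"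
  by (intro finite_measure_lebesgue_on) auto

lemma torus_measurable_continuous:
  fixes f :: "real^3 \<Rightarrow> 'b::euclidean_space"
  assumes "continuous_on (cbox 0 One) f" shows "f \<in> borel_measurable torus"
  using assms by (intro continuous_imp_measurable_on_sets_lebesgue) auto

lemma torus_integrable_bounded:
  fixes f :: "real^3 \<Rightarrow> 'b::euclidean_space"
  assumes "f \<in> borel_measurable torus" "\<And>x. norm (f x) \<le> B"
  shows "integrable torus f"
  using assms finite_measure_torus by (intro finite_measure.integrable_const_bound) auto

lemma integral_exp_period:
  fixes n :: int
  shows "integrable lborel (\<lambda>t::real. indicator {0..1} t *\<^sub>R exp (2 * of_real pi * \<i> * of_real
      (t * of_int n)))"
    and "(LINT t|lborel. indicator {0..1} t *\<^sub>R exp (2 * of_real pi * \<i> * complex_of_real (t * of_int n)))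
      = (if n = 0 then 1 else 0)"
proof -
  let ?f = "\<lambda>t::real. exp (2 * of_real pi * \<i> * complex_of_real (t * of_int n))"
  have cont: "continuous_on {0..1} ?f" by (intro continuous_intros)
  show int: "integrable lborel (\<lambda>t::real. indicator {0..1} t *\<^sub>R ?f t)"
    using borel_integrable_atLeastAtMost'[OF cont] unfolding set_integrable_def .
  show "(LINT t|lborel. indicator {0..1} t *\<^sub>R ?f t) = (if n = 0 then 1 else 0)"
  proof (cases "n = 0")
    case False
    define c where "c = 2 * of_real pi * \<i> * (of_int n :: complex)"
    have c: "c \<noteq> 0" "exp c = 1"
      using False exp_2pi_1_int[of n] by (auto simp: c_def mult_ac)
    have f: "?f t = exp (c * of_real t)" for t by (simp add: c_def mult_ac)
    have "(LBINT t. indicator {0..1} t *\<^sub>R exp (c * of_real t))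
        = exp (c * of_real 1) / c - exp (c * of_real 0) / c"
    proof (rule integral_FTC_Icc)
      show "((\<lambda>t. exp (c * of_real t) / c) has_vector_derivative exp (c * of_real t))
          (at t within {0..1})" for t :: real
        using c by (auto intro!: derivative_eq_intros has_vector_derivative_real_field)
      show "continuous_on {0..1} (\<lambda>t. exp (c * complex_of_real t))" by (intro continuous_intros)
    qed auto
    also have "\<dots> = 0" using c by simp
    finally show ?thesis using False by (simp only: f) simp
  qed simp
qed

text \<open>By Fubini the integral is a product of three integrals over the unit interval, and one of them
  vanishes unless \<open>k = 0\<close>.\<close>

lemma integral_character:
  "(LINT x|torus. character k x) = (if k = 0 then 1 else 0)"
proof -
  let ?g = "\<lambda>n t::real. indicator {0..1} t *\<^sub>R exp (2 * of_real pi * \<i> * complex_of_real (t * of_int n))"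
  define f where "f b = ?g (k $ (THE j. b = axis j 1))" for b :: "real^3"
  have the: "(THE j'. axis j (1::real) = axis j' 1) = j" for j :: 3
    by (rule the_equality) (auto simp: axis_eq_axis)
  have cb: "indicator (cbox 0 One) x = (\<Prod>j\<in>UNIV. indicator {0..1} (x $ j) :: real)" for x :: "real^3"
  proof -
    have iff: "x \<in> cbox 0 One \<longleftrightarrow> (\<forall>j. x $ j \<in> {0..1})"
      by (simp add: mem_period_cell)
    show ?thesis
    proof (cases "x \<in> cbox 0 One")
      case True
      hence "indicator {0..1} (x $ j) = (1 :: real)" for j
        unfolding iff by (simp only: indicator_simps)
      thus ?thesis using True by simp
    next
      case False
      then obtain j where "x $ j \<notin> {0..1}" unfolding iff by blast
      hence "indicator {0..1} (x $ j) = (0 :: real)" by (rule indicator_simps(2))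
      hence "(\<Prod>j\<in>UNIV. indicator {0..1} (x $ j) :: real) = 0" by (intro prod_zero) auto
      thus ?thesis using False by simp
    qed
  qed
  have prod: "indicator (cbox 0 One) x *\<^sub>R character k x = (\<Prod>b\<in>Basis. f b (x \<bullet> b))" for x
  proof -
    have "(\<Prod>b\<in>Basis. f b (x \<bullet> b)) = (\<Prod>j\<in>UNIV. f (axis j 1) (x \<bullet> axis j 1))"
      by (simp add: Basis_vec_def UNION_singleton_eq_range prod.reindex inj_on_def axis_eq_axis)
    also have "\<dots> = (\<Prod>j\<in>UNIV. ?g (k $ j) (x $ j))"
      by (simp add: f_def the inner_axis)
    also have "\<dots> = indicator (cbox 0 One) x *\<^sub>R character k x"
      by (simp add: character_has_component_form cb scaleR_conv_of_real prod.distrib)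
    finally show ?thesis by simp
  qed
  interpret product_sigma_finite "\<lambda>b::real^3. lborel :: real measure" by standard
  have fi: "integrable lborel (f b)" for b unfolding f_def by (rule integral_exp_period)
  have "(LINT x|torus. character k x) = (LINT x|lebesgue. indicator (cbox 0 One) x *\<^sub>R character k x)"
    by (subst integral_restrict_space) auto
  also have "\<dots> = (LINT x|lborel. indicator (cbox 0 One) x *\<^sub>R character k x)"
    using borel_measurable_continuous_onI[OF continuous_character, of k]
    by (intro integral_completion borel_measurable_scaleR borel_measurable_indicator) auto
  also have "\<dots> = (LINT x|(distr (\<Pi>\<^sub>M b\<in>Basis. lborel) borel (\<lambda>f. \<Sum>b\<in>Basis. f b *\<^sub>R b)). (\<Prod>b\<in>Basis. f b
      (x \<bullet> b)))"
    unfolding prod by (subst lborel_eq) simp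
  also have "\<dots> = (LINT y|(\<Pi>\<^sub>M b\<in>(Basis::(real^3) set). lborel). (\<Prod>b\<in>Basis. f b ((\<Sum>c\<in>Basis. y c *\<^sub>R c)
      \<bullet> b)))"
  proof (rule integral_distr)
    have "f b \<in> borel_measurable borel" for b using fi[of b] by (simp add: integrable_iff_bounded)
    thus "(\<lambda>x. \<Prod>b\<in>Basis. f b (x \<bullet> b)) \<in> borel_measurable borel"
      by (intro borel_measurable_prod) (auto intro: measurable_compose[rotated])
  qed measurable
  also have "\<dots> = (LINT y|(\<Pi>\<^sub>M b\<in>(Basis::(real^3) set). lborel). (\<Prod>b\<in>Basis. f b (y b)))"
    by (intro Bochner_Integration.integral_cong prod.cong) (auto simp: inner_sum_left_Basis)
  also have "\<dots> = (\<Prod>b\<in>Basis. integral\<^sup>L lborel (f b))"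
    by (rule product_integral_prod) (use fi in auto)
  also have "\<dots> = (\<Prod>j\<in>UNIV. integral\<^sup>L lborel (f (axis j 1)))"
    by (simp add: Basis_vec_def UNION_singleton_eq_range prod.reindex inj_on_def axis_eq_axis)
  also have "\<dots> = (\<Prod>j\<in>UNIV. if k $ j = 0 then 1 else 0)"
    unfolding f_def the integral_exp_period ..
  also have "\<dots> = (if k = 0 then 1 else 0)"
    by (auto simp: vec_eq_iff)
  finally show ?thesis .
qed

definition square_integrable :: "(real^3 \<Rightarrow> complex) \<Rightarrow> bool" where
  "square_integrable f \<longleftrightarrow> f \<in> borel_measurable torus \<and> integrable torus (\<lambda>x. (norm (f x))\<^sup>2)"

definition sq_norm :: "(real^3 \<Rightarrow> complex) \<Rightarrow> real" where
  "sq_norm f = (LINT x|torus. (norm (f x))\<^sup>2)"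

abbreviation l2_ip :: "(real^3 \<Rightarrow> complex) \<Rightarrow> (real^3 \<Rightarrow> complex) \<Rightarrow> complex" where
  "l2_ip f g \<equiv> LINT x|torus. f x * cnj (g x)"

lemma sq_norm_nonneg [simp]: "sq_norm f \<ge> 0"
  unfolding sq_norm_def by (rule integral_nonneg_AE) simp

lemma norm_add_sq_le: "(norm (a + b))\<^sup>2 \<le> 2 * (norm a)\<^sup>2 + 2 * (norm (b::'b::real_normed_vector))\<^sup>2"
proof -
  have "(norm (a + b))\<^sup>2 \<le> (norm a + norm b)\<^sup>2" by (intro power_mono norm_triangle_ineq) auto
  also have "\<dots> \<le> 2 * (norm a)\<^sup>2 + 2 * (norm b)\<^sup>2"
    using zero_le_power2[of "norm a - norm b"] by (simp add: power2_eq_square algebra_simps)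
  finally show ?thesis .
qed

lemma square_integrable_measurable: "square_integrable f \<Longrightarrow> f \<in> borel_measurable torus"
  by (simp add: square_integrable_def)

lemma square_integrable_add:
  assumes "square_integrable f" "square_integrable g"
  shows "square_integrable (\<lambda>x. f x + g x)"
  unfolding square_integrable_def
proof
  show m: "(\<lambda>x. f x + g x) \<in> borel_measurable torus"
    using assms by (intro borel_measurable_add square_integrable_measurable)
  show "integrable torus (\<lambda>x. (norm (f x + g x))\<^sup>2)"
  proof (rule Bochner_Integration.integrable_bound)
    show "integrable torus (\<lambda>x. 2 * (norm (f x))\<^sup>2 + 2 * (norm (g x))\<^sup>2)"
      using assms by (intro Bochner_Integration.integrable_add integrable_mult_right)
          (auto simp: square_integrable_def)
    show "(\<lambda>x. (norm (f x + g x))\<^sup>2) \<in> borel_measurable torus" using m by measurable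
  qed (use norm_add_sq_le in auto)
qed

lemma square_integrable_mult:
  assumes "square_integrable f"
  shows "square_integrable (\<lambda>x. c * f x)"
  using assms by (auto simp: square_integrable_def norm_mult power_mult_distrib)

lemma square_integrable_diff:
  assumes "square_integrable f" "square_integrable g"
  shows "square_integrable (\<lambda>x. f x - g x)"
  using square_integrable_add[OF assms(1) square_integrable_mult[OF assms(2), of "-1"]] by simp

lemma sq_norm_add_le:
  assumes "square_integrable f" "square_integrable g"
  shows "sq_norm (\<lambda>x. f x + g x) \<le> 2 * sq_norm f + 2 * sq_norm g"
proof -
  have "sq_norm (\<lambda>x. f x + g x) \<le> (LINT x|torus. 2 * (norm (f x))\<^sup>2 + 2 * (norm (g x))\<^sup>2)"
    unfolding sq_norm_def using assms square_integrable_add[OF assms]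
    by (intro integral_mono Bochner_Integration.integrable_add integrable_mult_right norm_add_sq_le)
       (auto simp: square_integrable_def)
  also have "\<dots> = 2 * sq_norm f + 2 * sq_norm g"
    unfolding sq_norm_def using assms by (subst Bochner_Integration.integral_add)
        (auto simp: square_integrable_def)
  finally show ?thesis .
qed

lemma sq_norm_mult: "sq_norm (\<lambda>x. c * f x) = (norm c)\<^sup>2 * sq_norm f"
  by (simp add: sq_norm_def norm_mult power_mult_distrib)

lemma square_integrable_bounded:
  assumes "f \<in> borel_measurable torus" "\<And>x. norm (f x) \<le> B"
  shows "square_integrable f"
  unfolding square_integrable_def
proof
  show "integrable torus (\<lambda>x. (norm (f x))\<^sup>2)"
  proof (rule torus_integrable_bounded)
    show "norm ((norm (f x))\<^sup>2) \<le> B\<^sup>2" for x using assms(2)[of x] by (simp add: power_mono)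
    show "(\<lambda>x. (norm (f x))\<^sup>2) \<in> borel_measurable torus" using assms(1) by measurable
  qed
qed fact

lemma square_integrable_product:
  assumes "square_integrable f" "square_integrable g"
  shows "integrable torus (\<lambda>x. f x * cnj (g x))"
proof (rule Bochner_Integration.integrable_bound)
  show "integrable torus (\<lambda>x. (norm (f x))\<^sup>2 + (norm (g x))\<^sup>2)"
    using assms by (intro Bochner_Integration.integrable_add) (auto simp: square_integrable_def)
  have "(\<lambda>x. cnj (g x)) \<in> borel_measurable torus"
    using square_integrable_measurable[OF assms(2)]
    by (rule measurable_compose) (intro borel_measurable_continuous_onI continuous_intros)
  thus "(\<lambda>x. f x * cnj (g x)) \<in> borel_measurable torus"
    using square_integrable_measurable[OF assms(1)] by (intro borel_measurable_times)
  have "norm (f x * cnj (g x)) \<le> norm ((norm (f x))\<^sup>2 + (norm (g x))\<^sup>2)" for x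
  proof -
    have "2 * norm (f x) * norm (g x) \<le> (norm (f x))\<^sup>2 + (norm (g x))\<^sup>2" by (rule sum_squares_bound)
    moreover have "0 \<le> norm (f x) * norm (g x)" by simp
    ultimately have "norm (f x) * norm (g x) \<le> (norm (f x))\<^sup>2 + (norm (g x))\<^sup>2" by linarith
    thus ?thesis by (simp add: norm_mult)
  qed
  thus "AE x in torus. norm (f x * cnj (g x)) \<le> norm ((norm (f x))\<^sup>2 + (norm (g x))\<^sup>2)" by simp
qed

text \<open>Young's inequality: if the square norm of \<open>f\<close> stays bounded and that of \<open>g\<close> tends to zero, a
  suitable \<open>\<eta>\<close> makes the right-hand side small.\<close>

lemma norm_inner_product_le:
  assumes "square_integrable f" "square_integrable g" "\<eta> > 0"
  shows "norm (l2_ip f g) \<le> \<eta> * sq_norm f + sq_norm g / \<eta>"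
proof -
  have i: "integrable torus (\<lambda>x. \<eta> * (norm (f x))\<^sup>2)" "integrable torus (\<lambda>x. (norm (g x))\<^sup>2 / \<eta>)"
    using assms by (auto simp: square_integrable_def)
  have "norm (l2_ip f g) \<le> (LINT x|torus. norm (f x * cnj (g x)))"
    by (rule integral_norm_bound)
  also have "\<dots> \<le> (LINT x|torus. \<eta> * (norm (f x))\<^sup>2 + (norm (g x))\<^sup>2 / \<eta>)"
  proof (rule integral_mono)
    show "integrable torus (\<lambda>x. norm (f x * cnj (g x)))"
      using square_integrable_product[OF assms(1,2)] by (rule integrable_norm)
    show "integrable torus (\<lambda>x. \<eta> * (norm (f x))\<^sup>2 + (norm (g x))\<^sup>2 / \<eta>)"
      using i by (rule Bochner_Integration.integrable_add)
    fix x
    have "2 * (\<eta> * norm (f x)) * norm (g x) \<le> (\<eta> * norm (f x))\<^sup>2 + (norm (g x))\<^sup>2"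
        by (rule sum_squares_bound)
    moreover have "0 \<le> \<eta> * norm (f x) * norm (g x)" using assms by simp
    ultimately have "\<eta> * (norm (f x) * norm (g x)) \<le> (\<eta> * norm (f x))\<^sup>2 + (norm (g x))\<^sup>2" by simp
    also have "\<dots> = \<eta> * (\<eta> * (norm (f x))\<^sup>2 + (norm (g x))\<^sup>2 / \<eta>)"
      using assms by (simp add: power_mult_distrib power2_eq_square field_simps)
    finally show "norm (f x * cnj (g x)) \<le> \<eta> * (norm (f x))\<^sup>2 + (norm (g x))\<^sup>2 / \<eta>"
      using assms by (simp add: norm_mult)
  qed
  also have "\<dots> = \<eta> * sq_norm f + sq_norm g / \<eta>"
    unfolding sq_norm_def using i by (subst Bochner_Integration.integral_add) auto
  finally show ?thesis .
qed

text \<open>Generating the trigonometric polynomials by rules makes closure under products, and continuity of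
  linear functionals of them, plain inductions.\<close>

inductive trig_poly :: "(real^3 \<Rightarrow> complex) \<Rightarrow> bool" where
  character: "trig_poly (character k)"
| scale: "trig_poly f \<Longrightarrow> trig_poly (\<lambda>x. c * f x)"
| add: "trig_poly f \<Longrightarrow> trig_poly g \<Longrightarrow> trig_poly (\<lambda>x. f x + g x)"

lemma trig_poly_const: "trig_poly (\<lambda>x. c)"
  using trig_poly.scale[OF trig_poly.character[of 0], of c] by simp

lemma trig_poly_mult:
  assumes "trig_poly f" "trig_poly g"
  shows "trig_poly (\<lambda>x. f x * g x)"
  using assms(1)
proof induction
  case (character k)
  show ?case using assms(2)
  proof induction
    case (character l)
    have "(\<lambda>x. character k x * character l x) = character (k + l)"
      by (simp add: character_add fun_eq_iff)
    thus ?case using trig_poly.character by metis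
  next
    case (scale f c)
    thus ?case using trig_poly.scale[OF scale.IH, of c] by (simp add: mult_ac)
  next
    case (add f g)
    thus ?case using trig_poly.add[OF add.IH] by (simp add: distrib_left)
  qed
next
  case (scale f c)
  thus ?case using trig_poly.scale[OF scale.IH, of c] by (simp add: mult_ac)
next
  case (add f g)
  thus ?case using trig_poly.add[OF add.IH] by (simp add: distrib_right)
qed

lemma trig_poly_square_integrable: "trig_poly f \<Longrightarrow> square_integrable f"
proof (induction rule: trig_poly.induct)
  case (character k)
  show ?case
    by (rule square_integrable_bounded[of _ 1])
       (auto intro: torus_measurable_continuous continuous_character)
qed (auto intro: square_integrable_add square_integrable_mult)

lemma trig_poly_sum: "finite I \<Longrightarrow> (\<And>i. i \<in> I \<Longrightarrow> trig_poly (f i)) \<Longrightarrow> trig_poly (\<lambda>x. \<Sum>i\<in>I. f i x)"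
  by (induction rule: finite_induct) (auto intro: trig_poly_const trig_poly.add)

section \<open>Density of trigonometric polynomials\<close>

definition trig_approximable :: "(real^3 \<Rightarrow> complex) \<Rightarrow> bool" where
  "trig_approximable f \<longleftrightarrow> square_integrable f \<and>
     (\<forall>e>0. \<exists>h. trig_poly h \<and> sq_norm (\<lambda>x. f x - h x) < e)"

lemma trig_approximable_closed:
  assumes "square_integrable f" "\<And>e. e > 0 \<Longrightarrow> \<exists>g. trig_approximable g \<and> sq_norm (\<lambda>x. f x - g x) < e"
  shows "trig_approximable f"
  unfolding trig_approximable_def
proof (intro conjI allI impI)
  fix e :: real assume "e > 0"
  then obtain g where g: "trig_approximable g" "sq_norm (\<lambda>x. f x - g x) < e / 4"
    using assms(2)[of "e / 4"] by auto
  then obtain h where h: "trig_poly h" "sq_norm (\<lambda>x. g x - h x) < e / 4"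
    using \<open>e > 0\<close> unfolding trig_approximable_def by (metis divide_pos_pos zero_less_numeral)
  have "sq_norm (\<lambda>x. (f x - g x) + (g x - h x)) \<le> 2 * sq_norm (\<lambda>x. f x - g x) + 2 * sq_norm (\<lambda>x. g x
      - h x)"
    using g h assms(1) trig_poly_square_integrable
    by (intro sq_norm_add_le square_integrable_diff) (auto simp: trig_approximable_def)
  thus "\<exists>h. trig_poly h \<and> sq_norm (\<lambda>x. f x - h x) < e" using g h by (intro exI[of _ h]) auto
qed fact

lemma trig_approximable_limit:
  assumes "square_integrable f" "\<And>n. trig_approximable (g n)"
    and "(\<lambda>n. sq_norm (\<lambda>x. f x - g n x)) \<longlonglongrightarrow> 0"
  shows "trig_approximable f"
proof (rule trig_approximable_closed[OF assms(1)])
  fix e :: real assume "e > 0"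
  with assms(3) have "\<forall>\<^sub>F n in sequentially. sq_norm (\<lambda>x. f x - g n x) < e" by (rule order_tendstoD)
  thus "\<exists>g. trig_approximable g \<and> sq_norm (\<lambda>x. f x - g x) < e"
    using assms(2) eventually_happens' sequentially_bot by blast
qed

text \<open>Dominated convergence, in the form in which cut-offs and truncations are removed below.\<close>

lemma trig_approximable_dominated:
  assumes f: "square_integrable f" and g: "\<And>n. trig_approximable (g n)"
    and lim: "AE x in torus. (\<lambda>n. g n x) \<longlonglongrightarrow> f x"
    and w: "integrable torus w" and le: "\<And>n x. (norm (f x - g n x))\<^sup>2 \<le> w x"
  shows "trig_approximable f"
proof (rule trig_approximable_limit[OF f g])
  have "(\<lambda>n. LINT x|torus. (norm (f x - g n x))\<^sup>2) \<longlonglongrightarrow> (LINT x|torus. 0)"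
  proof (rule integral_dominated_convergence[OF _ _ w])
    show "(\<lambda>x. (norm (f x - g n x))\<^sup>2) \<in> borel_measurable torus" for n
      using square_integrable_diff[OF f, of "g n"] g[of n]
      by (auto simp: square_integrable_def trig_approximable_def)
    show "AE x in torus. (\<lambda>n. (norm (f x - g n x))\<^sup>2) \<longlonglongrightarrow> 0"
      using lim
    proof eventually_elim
      case (elim x)
      have "(\<lambda>n. (norm (f x - g n x))\<^sup>2) \<longlonglongrightarrow> (norm (f x - f x))\<^sup>2"
        by (intro tendsto_intros elim)
      thus ?case by simp
    qed
  qed (use le in auto)
  thus "(\<lambda>n. sq_norm (\<lambda>x. f x - g n x)) \<longlonglongrightarrow> 0" by (simp add: sq_norm_def)
qed

lemma trig_approximable_add:
  assumes "trig_approximable f" "trig_approximable g"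
  shows "trig_approximable (\<lambda>x. f x + g x)"
  unfolding trig_approximable_def
proof (intro conjI allI impI)
  have s: "square_integrable f" "square_integrable g" using assms by (auto simp: trig_approximable_def)
  thus "square_integrable (\<lambda>x. f x + g x)" by (rule square_integrable_add)
  fix e :: real assume "e > 0"
  hence "e / 4 > 0" by simp
  then obtain h1 h2 where h: "trig_poly h1" "sq_norm (\<lambda>x. f x - h1 x) < e / 4"
    "trig_poly h2" "sq_norm (\<lambda>x. g x - h2 x) < e / 4"
    using assms unfolding trig_approximable_def by metis
  have "sq_norm (\<lambda>x. (f x - h1 x) + (g x - h2 x)) \<le> 2 * sq_norm (\<lambda>x. f x - h1 x)
      + 2 * sq_norm (\<lambda>x. g x - h2 x)"
    using s h(1,3)[THEN trig_poly_square_integrable] by (intro sq_norm_add_le square_integrable_diff)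
  hence "sq_norm (\<lambda>x. (f x + g x) - (h1 x + h2 x)) < e" using h by (simp add: algebra_simps)
  thus "\<exists>h. trig_poly h \<and> sq_norm (\<lambda>x. f x + g x - h x) < e"
    using trig_poly.add[OF h(1,3)] by blast
qed

lemma trig_approximable_scale:
  assumes "trig_approximable f"
  shows "trig_approximable (\<lambda>x. c * f x)"
  unfolding trig_approximable_def
proof (intro conjI allI impI)
  show "square_integrable (\<lambda>x. c * f x)"
    using assms by (auto simp: trig_approximable_def intro: square_integrable_mult)
  fix e :: real assume "e > 0"
  have pos: "(norm c)\<^sup>2 + 1 > 0" by (simp add: add_nonneg_pos)
  hence "e / ((norm c)\<^sup>2 + 1) > 0" using \<open>e > 0\<close> by simp
  then obtain h where h: "trig_poly h" "sq_norm (\<lambda>x. f x - h x) < e / ((norm c)\<^sup>2 + 1)"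
    using assms unfolding trig_approximable_def by metis
  have "sq_norm (\<lambda>x. c * f x - c * h x) = (norm c)\<^sup>2 * sq_norm (\<lambda>x. f x - h x)"
    using sq_norm_mult[of c "\<lambda>x. f x - h x"] by (simp add: algebra_simps)
  also have "\<dots> \<le> ((norm c)\<^sup>2 + 1) * sq_norm (\<lambda>x. f x - h x)" by (intro mult_right_mono) auto
  also have "\<dots> < e" using h(2) pos by (simp add: pos_less_divide_eq mult.commute)
  finally show "\<exists>h. trig_poly h \<and> sq_norm (\<lambda>x. c * f x - h x) < e"
    using trig_poly.scale[OF h(1), of c] by blast
qed

text \<open>The Stone-Weierstrass theorem needs functions that separate points. Characters do not separate
  opposite boundary points of the period cell, but polynomials separate the points of this compact
  image of the torus.\<close>

definition torus_embedding :: "real^3 \<Rightarrow> complex^3" where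
  "torus_embedding x = (\<chi> j. character (axis j 1) x)"

lemma continuous_torus_embedding: "continuous_on S torus_embedding"
  unfolding torus_embedding_def by (intro continuous_on_vec_lambda continuous_character)

lemma ivec_axis: "ivec (axis j 1) = axis j 1"
  by (simp add: ivec_def axis_def vec_eq_iff)

lemma torus_embedding_eq:
  assumes "torus_embedding x = torus_embedding y" "x \<in> box 0 One" "y \<in> cbox 0 One"
  shows "x = y"
  unfolding vec_eq_iff
proof
  fix j
  have "character (axis j 1) x = character (axis j 1) y"
    using assms(1) by (simp add: torus_embedding_def vec_eq_iff)
  hence "exp (2 * of_real pi * \<i> * of_real (x $ j)) = exp (2 * of_real pi * \<i> * of_real (y $ j))"
    by (simp add: character_def ivec_axis inner_axis)
  then obtain n :: int where n: "2 * of_real pi * \<i> * complex_of_real (x $ j)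
      = 2 * of_real pi * \<i> * of_real (y $ j) + (of_int (2 * n) * pi) * \<i>"
    unfolding exp_eq by blast
  have "2 * pi * x $ j = 2 * pi * y $ j + 2 * of_int n * pi"
    using arg_cong[OF n, of Im] by simp
  hence "(2 * pi) * x $ j = (2 * pi) * (y $ j + of_int n)" by (simp add: algebra_simps)
  hence "x $ j = y $ j + of_int n" by simp
  moreover have "0 < x $ j" "x $ j < 1" "0 \<le> y $ j" "y $ j \<le> 1"
    using assms(2,3) by (auto simp: mem_period_cell)
  ultimately have "- 1 < real_of_int n" "real_of_int n < 1" by linarith+
  hence "n = 0" by linarith
  thus "x $ j = y $ j" using \<open>x $ j = y $ j + of_int n\<close> by simp
qed

text \<open>The real coordinates of the embedding are \<open>cos (2\<pi> x\<^sub>j)\<close> and \<open>sin (2\<pi> x\<^sub>j)\<close>.\<close>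

lemma trig_poly_linear_embedding:
  assumes "bounded_linear f"
  shows "trig_poly (\<lambda>x. complex_of_real (f (torus_embedding x)))"
proof -
  interpret f: bounded_linear f by fact
  have emb: "torus_embedding x = (\<Sum>j\<in>UNIV. Re (character (axis j 1) x) *\<^sub>R axis j 1
      + Im (character (axis j 1) x) *\<^sub>R axis j \<i>)" for x
    by (simp add: vec_eq_iff torus_embedding_def axis_def if_distrib[of "\<lambda>z. _ *\<^sub>R z"] if_distrib[of
        "\<lambda>z. _ + z"]
        sum.If_cases complex_eq_iff sum.distrib cong: if_cong)
  have re: "complex_of_real (Re (character k x)) = 1/2 * (character k x + character (- k) x)" for k x
    by (simp add: complex_eq_iff flip: cnj_character)
  have im: "complex_of_real (Im (character k x)) = - \<i> / 2 * (character k x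
      + (- 1) * character (- k) x)" for k x
    by (simp add: complex_eq_iff flip: cnj_character)
  have "complex_of_real (f (torus_embedding x)) =
      (\<Sum>j\<in>UNIV. of_real (f (axis j 1)) * of_real (Re (character (axis j 1) x))
        + of_real (f (axis j \<i>)) * of_real (Im (character (axis j 1) x)))" for x
    by (subst emb) (simp add: f.sum f.add f.scaleR mult.commute)
  hence "complex_of_real (f (torus_embedding x)) =
      (\<Sum>j\<in>UNIV. of_real (f (axis j 1)) * (1/2 * (character (axis j 1) x + character (- axis j 1) x))
        + of_real (f (axis j \<i>)) * (- \<i> / 2 * (character (axis j 1) x
            + (- 1) * character (- axis j 1) x)))" for x
    by (simp only: re im)
  moreover have "trig_poly (\<lambda>x. \<Sum>j\<in>UNIV. of_real (f (axis j 1)) * (1/2 * (character (axis j 1) x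
      + character (- axis j 1) x))
        + of_real (f (axis j \<i>)) * (- \<i> / 2 * (character (axis j 1) x
            + (- 1) * character (- axis j 1) x)))"
    by (intro trig_poly_sum trig_poly.intros) auto
  ultimately show ?thesis by simp
qed

lemma trig_poly_polynomial_embedding:
  assumes "real_polynomial_function p"
  shows "trig_poly (\<lambda>x. complex_of_real (p (torus_embedding x)))"
  using assms
proof induction
  case (add f g)
  thus ?case using trig_poly.add by simp
next
  case (mult f g)
  thus ?case using trig_poly_mult by simp
qed (auto intro: trig_poly_linear_embedding trig_poly_const)

text \<open>A function vanishing outside the open period cell takes equal values at points with equal image under
  the embedding, since only boundary points of the cell are identified. It therefore factors through
  a continuous function on the compact image, which real polynomials approximate uniformly; these pull
  back to trigonometric polynomials.\<close>

lemma trig_approximable_continuous: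
  fixes \<phi> :: "real^3 \<Rightarrow> real"
  assumes cont: "continuous_on UNIV \<phi>" and zero: "\<And>x. x \<notin> box 0 One \<Longrightarrow> \<phi> x = 0"
  shows "trig_approximable (\<lambda>x. of_real (\<phi> x))"
proof -
  let ?Q = "cbox 0 One :: (real^3) set"
  define S where "S = torus_embedding ` ?Q"
  have "compact S" unfolding S_def
    by (intro compact_continuous_image continuous_torus_embedding compact_cbox)
  define F where "F z = \<phi> (SOME x. x \<in> ?Q \<and> torus_embedding x = z)" for z
  have F: "F (torus_embedding x) = \<phi> x" if "x \<in> ?Q" for x
  proof -
    define y where "y = (SOME y. y \<in> ?Q \<and> torus_embedding y = torus_embedding x)"
    have y: "y \<in> ?Q" "torus_embedding y = torus_embedding x"
      using someI[of "\<lambda>y. y \<in> ?Q \<and> torus_embedding y = torus_embedding x" x] that by (auto simp: y_def)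
    have "\<phi> y = \<phi> x"
      using torus_embedding_eq[of x y] torus_embedding_eq[of y x] y that zero by metis
    thus ?thesis by (simp add: F_def y_def)
  qed
  have "continuous_on S F"
    unfolding continuous_on_closed_vimage[OF compact_imp_closed[OF \<open>compact S\<close>]]
  proof (intro allI impI)
    fix B :: "real set" assume "closed B"
    have "F -` B \<inter> S = torus_embedding ` (\<phi> -` B \<inter> ?Q)"
      using F by (auto simp: S_def)
    moreover have "closed (\<phi> -` B \<inter> ?Q)"
      using \<open>closed B\<close> continuous_on_closed_vimage[of ?Q \<phi>] continuous_on_subset[OF cont, of ?Q] by auto
    hence "compact (\<phi> -` B \<inter> ?Q)"
      using compact_Int_closed[OF compact_cbox[of 0 "One :: real^3"]]
          by (metis Int_left_absorb Int_commute)
    ultimately show "closed (F -` B \<inter> S)"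
      using compact_imp_closed[OF compact_continuous_image[OF continuous_torus_embedding]] by metis
  qed
  have meas: "(\<lambda>x. complex_of_real (\<phi> x)) \<in> borel_measurable torus"
    by (intro torus_measurable_continuous continuous_intros continuous_on_subset[OF cont]) auto
  have "bounded (\<phi> ` ?Q)"
    by (intro compact_imp_bounded compact_continuous_image continuous_on_subset[OF cont]) auto
  then obtain M where M: "\<And>x. x \<in> ?Q \<Longrightarrow> norm (\<phi> x) \<le> M" by (auto simp: bounded_iff)
  have sq: "square_integrable (\<lambda>x. of_real (\<phi> x))"
  proof (rule square_integrable_bounded[OF meas])
    show "norm (complex_of_real (\<phi> x)) \<le> max M 0" for x
      using M[of x] zero[of x] box_subset_cbox[of 0 "One :: real^3"]
          by (cases "x \<in> box 0 One") (auto simp: max_def)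
  qed
  show ?thesis
    unfolding trig_approximable_def
  proof (intro conjI allI impI sq)
    fix e :: real assume "e > 0"
    define d where "d = min 1 (e / 2)"
    have d: "d > 0" "d * d < e"
      using \<open>e > 0\<close> by (auto simp: d_def min_def field_simps)
    have "d\<^sup>2 < e" using d by (simp add: power2_eq_square)
    obtain p where p: "real_polynomial_function p" "\<And>z. z \<in> S \<Longrightarrow> \<bar>F z - p z\<bar> < d"
      using Stone_Weierstrass_real_polynomial_function[OF \<open>compact S\<close> \<open>continuous_on S F\<close> \<open>d > 0\<close>]
          by blast
    let ?h = "\<lambda>x. complex_of_real (p (torus_embedding x))"
    have h: "trig_poly ?h" by (rule trig_poly_polynomial_embedding) fact
    have le: "(norm (of_real (\<phi> x) - ?h x))\<^sup>2 \<le> d\<^sup>2" if "x \<in> ?Q" for x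
      using p(2)[of "torus_embedding x"] F[OF that] that
      by (intro power_mono) (auto simp: S_def simp flip: of_real_diff)
    have "sq_norm (\<lambda>x. of_real (\<phi> x) - ?h x) \<le> (LINT x|torus. d\<^sup>2)"
      unfolding sq_norm_def
      using square_integrable_diff[OF sq trig_poly_square_integrable[OF h]] le finite_measure_torus
      by (intro integral_mono_AE AE_I2) (auto simp: square_integrable_def finite_measure.integrable_const)
    also have "\<dots> = d\<^sup>2" by (simp add: measure_restrict_space)
    finally show "\<exists>h. trig_poly h \<and> sq_norm (\<lambda>x. of_real (\<phi> x) - h x) < e"
      using h \<open>d\<^sup>2 < e\<close> by (intro exI[of _ ?h]) auto
  qed
qed

text \<open>A measurable function is almost everywhere the limit of continuous functions. Clipping these at the
  bound \<open>M\<close> and cutting them off near the boundary of the cell keeps the limit on the open cell,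
  whose complement in the closed cell is negligible.\<close>

lemma trig_approximable_bounded_real:
  fixes g :: "real^3 \<Rightarrow> real"
  assumes g: "g \<in> borel_measurable torus" and M: "\<And>x. \<bar>g x\<bar> \<le> M"
  shows "trig_approximable (\<lambda>x. of_real (g x))"
proof -
  let ?Q = "cbox 0 One :: (real^3) set"
  have "M \<ge> 0" using M[of 0] by linarith
  have "g measurable_on ?Q" using g by (subst measurable_on_iff_borel_measurable) auto
  then obtain N f where N: "negligible N" and f: "\<And>n. continuous_on UNIV (f n)"
    and lim: "\<And>x. x \<notin> N \<Longrightarrow> (\<lambda>n. f n x) \<longlonglongrightarrow> (if x \<in> ?Q then g x else 0)"
    unfolding measurable_on_def by blast
  define cut where "cut n x = min 1 (real n * setdist {x} (- box 0 One))" for n and x :: "real^3"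
  have cut: "0 \<le> cut n x" "cut n x \<le> 1" for n x by (auto simp: cut_def)
  define \<phi> where "\<phi> n x = cut n x * max (- M) (min M (f n x))" for n and x :: "real^3"
  have \<phi>_le: "\<bar>\<phi> n x\<bar> \<le> M" for n x
  proof -
    have "\<bar>\<phi> n x\<bar> \<le> 1 * M"
      unfolding \<phi>_def abs_mult using cut[of n x] \<open>M \<ge> 0\<close> by (intro mult_mono) auto
    thus ?thesis by simp
  qed
  have \<phi>: "trig_approximable (\<lambda>x. of_real (\<phi> n x))" for n
  proof (rule trig_approximable_continuous)
    show "continuous_on UNIV (\<phi> n)"
      unfolding \<phi>_def cut_def by (intro continuous_intros f continuous_on_setdist)
    show "\<phi> n x = 0" if "x \<notin> box 0 One" for x
      using that by (simp add: \<phi>_def cut_def setdist_sing_in_set)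
  qed
  have sq: "square_integrable (\<lambda>x. of_real (g x))"
    using g M by (intro square_integrable_bounded[of _ M]) auto
  have conv: "(\<lambda>n. \<phi> n x) \<longlonglongrightarrow> g x" if "x \<in> box 0 One" "x \<notin> N" for x
  proof -
    have "- box 0 One \<noteq> ({} :: (real^3) set)"
      by (metis bounded_box Compl_empty_eq double_complement not_bounded_UNIV)
    hence "setdist {x} (- box 0 One) > 0"
      using that(1) setdist_eq_0_sing_1[of x "- box 0 One"] setdist_pos_le[of "{x}" "- box 0 One"]
          closed_Compl[OF open_box[of 0 "One::real^3"]]
      by (metis ComplD closure_closed less_eq_real_def)
    hence "filterlim (\<lambda>n. real n * setdist {x} (- box 0 One)) at_top sequentially"
      by (intro filterlim_at_top_mult_tendsto_pos[OF tendsto_const] filterlim_real_sequentially)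
    hence "\<forall>\<^sub>F n in sequentially. real n * setdist {x} (- box 0 One) \<ge> 1"
      by (simp add: filterlim_at_top)
    hence "\<forall>\<^sub>F n in sequentially. cut n x = 1" by eventually_elim (simp add: cut_def)
    hence "(\<lambda>n. cut n x) \<longlonglongrightarrow> 1" by (rule tendsto_eventually)
    moreover have "(\<lambda>n. max (- M) (min M (f n x))) \<longlonglongrightarrow> max (- M) (min M (g x))"
      using lim[OF that(2)] that(1) box_subset_cbox[of 0 "One :: real^3"] by (intro tendsto_intros) auto
    ultimately have "(\<lambda>n. \<phi> n x) \<longlonglongrightarrow> 1 * max (- M) (min M (g x))"
      unfolding \<phi>_def by (rule tendsto_mult)
    thus ?thesis using M[of x] by (simp add: max_def min_def abs_le_iff split: if_splits)
  qed
  have ae: "AE x in torus. x \<in> box 0 One \<and> x \<notin> N"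
  proof -
    have "negligible (N \<union> (?Q - box 0 One))" using N negligible_frontier_interval[of 0 "One ::
        real^3"] by auto
    hence "AE x in lebesgue. x \<notin> N \<union> (?Q - box 0 One)"
      unfolding negligible_iff_null_sets by (rule AE_not_in)
    hence "AE x in lebesgue. x \<in> ?Q \<longrightarrow> x \<in> box 0 One \<and> x \<notin> N"
      by eventually_elim auto
    thus ?thesis by (subst AE_restrict_space_iff) auto
  qed
  show ?thesis
  proof (rule trig_approximable_dominated[OF sq \<phi>])
    show "AE x in torus. (\<lambda>n. complex_of_real (\<phi> n x)) \<longlonglongrightarrow> of_real (g x)"
      using ae by eventually_elim (intro tendsto_of_real conv; simp)
    show "integrable torus (\<lambda>x. (2 * M)\<^sup>2)"
      using finite_measure_torus by (rule finite_measure.integrable_const)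
    fix n x
    have "norm (complex_of_real (g x) - of_real (\<phi> n x)) \<le> 2 * M"
      using M[of x] \<phi>_le[of n x] by (simp flip: of_real_diff)
    thus "(norm (complex_of_real (g x) - of_real (\<phi> n x)))\<^sup>2 \<le> (2 * M)\<^sup>2"
      by (rule power_mono) simp
  qed
qed

lemma trig_approximable_real:
  fixes g :: "real^3 \<Rightarrow> real"
  assumes sq: "square_integrable (\<lambda>x. of_real (g x))"
  shows "trig_approximable (\<lambda>x. of_real (g x))"
proof -
  define \<phi> where "\<phi> n x = max (- real n) (min (real n) (g x))" for n and x :: "real^3"
  have "(\<lambda>x. Re (complex_of_real (g x))) \<in> borel_measurable torus"
    using square_integrable_measurable[OF sq] by measurable
  hence g: "g \<in> borel_measurable torus" by simp
  have \<phi>: "trig_approximable (\<lambda>x. of_real (\<phi> n x))" for n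
  proof (rule trig_approximable_bounded_real)
    show "\<phi> n \<in> borel_measurable torus" unfolding \<phi>_def using g by measurable
    show "\<bar>\<phi> n x\<bar> \<le> real n" for x by (auto simp: \<phi>_def)
  qed
  show ?thesis
  proof (rule trig_approximable_dominated[OF sq \<phi>])
    show "AE x in torus. (\<lambda>n. complex_of_real (\<phi> n x)) \<longlonglongrightarrow> of_real (g x)"
    proof (rule AE_I2)
      fix x
      have "\<forall>\<^sub>F n in sequentially. \<bar>g x\<bar> \<le> real n"
        using filterlim_real_sequentially by (simp add: filterlim_at_top)
      hence "\<forall>\<^sub>F n in sequentially. complex_of_real (\<phi> n x) = of_real (g x)"
        by eventually_elim (auto simp: \<phi>_def max_def min_def abs_le_iff)
      thus "(\<lambda>n. complex_of_real (\<phi> n x)) \<longlonglongrightarrow> of_real (g x)" by (rule tendsto_eventually)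
    qed
    show "integrable torus (\<lambda>x. (norm (complex_of_real (g x)))\<^sup>2)"
      using sq by (simp add: square_integrable_def)
    fix n x
    have "norm (complex_of_real (g x) - of_real (\<phi> n x)) \<le> norm (complex_of_real (g x))"
      by (simp add: \<phi>_def flip: of_real_diff)
    thus "(norm (complex_of_real (g x) - of_real (\<phi> n x)))\<^sup>2 \<le> (norm (complex_of_real (g x)))\<^sup>2"
      by (rule power_mono) simp
  qed
qed

theorem trig_approximable_square_integrable:
  assumes "square_integrable f"
  shows "trig_approximable f"
proof -
  have f: "f \<in> borel_measurable torus" using assms by (rule square_integrable_measurable)
  have part: "square_integrable (\<lambda>x. of_real (g x))"
    if "g \<in> borel_measurable torus" "\<And>x. \<bar>g x\<bar> \<le> norm (f x)" for g :: "real^3 \<Rightarrow> real"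
    unfolding square_integrable_def
  proof
    show "(\<lambda>x. complex_of_real (g x)) \<in> borel_measurable torus" using that(1) by measurable
    show "integrable torus (\<lambda>x. (norm (complex_of_real (g x)))\<^sup>2)"
    proof (rule Bochner_Integration.integrable_bound)
      show "integrable torus (\<lambda>x. (norm (f x))\<^sup>2)" using assms by (simp add: square_integrable_def)
      show "(\<lambda>x. (norm (complex_of_real (g x)))\<^sup>2) \<in> borel_measurable torus" using that(1) by simp
      have "(norm (complex_of_real (g x)))\<^sup>2 \<le> (norm (f x))\<^sup>2" for x
        using that(2)[of x] by (intro power_mono) auto
      thus "AE x in torus. norm ((norm (complex_of_real (g x)))\<^sup>2) \<le> norm ((norm (f x))\<^sup>2)" by simp
    qed
  qed
  have "trig_approximable (\<lambda>x. of_real (Re (f x)) + \<i> * of_real (Im (f x)))"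
    using f by (intro trig_approximable_add trig_approximable_scale trig_approximable_real part)
      (auto simp: abs_Re_le_cmod abs_Im_le_cmod)
  thus ?thesis by (simp flip: complex_eq)
qed

text \<open>The functions \<open>t \<mapsto> \<langle>v t, h\<rangle>\<close> are continuous for trigonometric polynomials \<open>h\<close>, and the uniform
  bound on the square norm makes them converge uniformly in \<open>t\<close> when \<open>h\<close> tends to \<open>g\<close>.\<close>

theorem weak_continuity_from_coefficients:
  assumes sq: "\<And>t. t \<in> T \<Longrightarrow> square_integrable (v t)" and B: "\<And>t. t \<in> T \<Longrightarrow> sq_norm (v t) \<le> B"
    and coeff: "\<And>k. continuous_on T (\<lambda>t. l2_ip (v t) (character k))"
    and g: "square_integrable g"
  shows "continuous_on T (\<lambda>t. l2_ip (v t) g)"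
proof -
  have trig: "continuous_on T (\<lambda>t. l2_ip (v t) h)" if "trig_poly h" for h
    using that
  proof induction
    case (scale f c)
    have "continuous_on T (\<lambda>t. cnj c * (l2_ip (v t) f))"
      by (intro continuous_intros scale.IH)
    thus ?case by (simp add: mult_ac flip: integral_mult_right_zero)
  next
    case (add f g)
    have "continuous_on T (\<lambda>t. (l2_ip (v t) f) + (l2_ip (v t) g))"
      by (intro continuous_intros add.IH)
    thus ?case
      by (rule continuous_on_eq)
         (use add.hyps sq in \<open>simp add: distrib_left Bochner_Integration.integral_add
             square_integrable_product trig_poly_square_integrable\<close>)
  qed (rule coeff)
  have "\<exists>h. trig_poly h \<and> (\<forall>t\<in>T. dist (l2_ip (v t) h) (l2_ip (v t) g) < e)"
    if "e > 0" for e
  proof -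
    \<comment> \<open>Half of \<open>e\<close> is spent on the bound \<open>B\<close>, the other half on the distance of \<open>h\<close> to \<open>g\<close>.\<close>
    define \<eta> where "\<eta> = e / (2 * (\<bar>B\<bar> + 1))"
    have \<eta>: "\<eta> > 0" using that by (simp add: \<eta>_def)
    hence "\<eta> * (e / 2) > 0" using that by simp
    then obtain h where h: "trig_poly h" "sq_norm (\<lambda>x. g x - h x) < \<eta> * (e / 2)"
      using trig_approximable_square_integrable[OF g] unfolding trig_approximable_def by blast
    have hs: "square_integrable h" using h(1) by (rule trig_poly_square_integrable)
    have "dist (l2_ip (v t) h) (l2_ip (v t) g) < e" if t: "t \<in> T" for t
    proof -
      have "(l2_ip (v t) g) - (l2_ip (v t) h)
          = (LINT x|torus. v t x * cnj (g x - h x))"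
        using square_integrable_product[OF sq[OF t] g] square_integrable_product[OF sq[OF t] hs]
        by (simp add: right_diff_distrib)
      hence "dist (l2_ip (v t) h) (l2_ip (v t) g)
          = norm (LINT x|torus. v t x * cnj (g x - h x))"
        by (simp add: dist_norm norm_minus_commute)
      also have "\<dots> \<le> \<eta> * sq_norm (v t) + sq_norm (\<lambda>x. g x - h x) / \<eta>"
        by (intro norm_inner_product_le sq t square_integrable_diff g hs \<eta>)
      also have "\<dots> \<le> \<eta> * (\<bar>B\<bar> + 1) + sq_norm (\<lambda>x. g x - h x) / \<eta>"
        using B[OF t] \<eta> by (intro add_right_mono mult_left_mono) auto
      also have "\<eta> * (\<bar>B\<bar> + 1) = e / 2" by (simp add: \<eta>_def field_simps)
      also have "e / 2 + sq_norm (\<lambda>x. g x - h x) / \<eta> < e / 2 + e / 2"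
        using h(2) \<eta> by (simp add: field_simps)
      finally show ?thesis by simp
    qed
    with h(1) show ?thesis by blast
  qed
  hence "\<forall>n. \<exists>h. trig_poly h \<and> (\<forall>t\<in>T. dist (l2_ip (v t) h) (l2_ip (v t) g) < 1 / real (Suc n))"
    by simp
  from choice[OF this] obtain h where "\<forall>n. trig_poly (h n) \<and> (\<forall>t\<in>T.
      dist (l2_ip (v t) (h n)) (l2_ip (v t) g) < 1 / real (Suc n))" ..
  hence h: "\<And>n. trig_poly (h n)"
    "\<And>n t. t \<in> T \<Longrightarrow> dist (l2_ip (v t) (h n)) (l2_ip (v t) g) < 1 / real (Suc n)"
    by (simp_all only: Ball_def)
  have "uniform_limit T (\<lambda>n t. l2_ip (v t) (h n)) (\<lambda>t. l2_ip (v t) g) sequentially"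
  proof (rule uniform_limitI)
    fix e :: real assume "e > 0"
    have "(\<lambda>n. 1 / real (Suc n)) \<longlonglongrightarrow> 0" by (rule LIMSEQ_Suc[OF lim_1_over_n])
    from order_tendstoD(2)[OF this \<open>e > 0\<close>]
    show "\<forall>\<^sub>F n in sequentially. \<forall>t\<in>T. dist (l2_ip (v t) (h n)) (l2_ip (v t) g) < e"
    proof eventually_elim
      case (elim n)
      show ?case using less_trans[OF h(2) elim] by blast
    qed
  qed
  thus ?thesis
    by (rule uniform_limit_theorem[rotated]) (auto intro!: always_eventually trig h)
qed

section \<open>Absolutely convergent Fourier series in L2\<close>

lemma torus_integral_tendsto:
  fixes S :: "nat \<Rightarrow> real^3 \<Rightarrow> 'b::euclidean_space"
  assumes "\<And>n. S n \<in> borel_measurable torus" "f \<in> borel_measurable torus"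
    "\<And>n x. norm (S n x) \<le> A" "\<And>x. (\<lambda>n. S n x) \<longlonglongrightarrow> f x"
  shows "(\<lambda>n. LINT x|torus. S n x) \<longlonglongrightarrow> (LINT x|torus. f x)"
proof (rule integral_dominated_convergence[where w = "\<lambda>x. A"])
  show "integrable torus (\<lambda>x. A)"
    using finite_measure_torus by (rule finite_measure.integrable_const)
qed (use assms in auto)

text \<open>Absolute convergence bounds the sums over cubes uniformly, so integrals of the series are limits of
  integrals of finite sums by dominated convergence.\<close>

locale absolutely_convergent_fourier =
  fixes a :: "int^3 \<Rightarrow> complex"
  assumes summable: "(\<lambda>k. norm (a k)) summable_on UNIV"
begin

definition fsum :: "real^3 \<Rightarrow> complex" where "fsum x = (\<Sum>\<^sub>\<infinity>k. a k * character k x)"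

definition cube_sum :: "nat \<Rightarrow> real^3 \<Rightarrow> complex" where
  "cube_sum n x = (\<Sum>k | sup_norm k \<le> n. a k * character k x)"

lemma cube_sum_measurable: "cube_sum n \<in> borel_measurable torus"
  unfolding cube_sum_def
  by (intro torus_measurable_continuous continuous_intros continuous_character)

lemma cube_sum_tendsto: "(\<lambda>n. cube_sum n x) \<longlonglongrightarrow> fsum x"
proof -
  have "(\<lambda>k. a k * character k x) summable_on UNIV"
    by (rule abs_summable_summable) (use summable in \<open>simp add: norm_mult\<close>)
  from has_sum_infsum[OF this] show ?thesis
    unfolding has_sum_def fsum_def cube_sum_def by (rule filterlim_compose[OF _ sup_norm_exhausts])
qed

lemma fsum_measurable: "fsum \<in> borel_measurable torus"
  by (rule borel_measurable_LIMSEQ_metric[OF cube_sum_measurable cube_sum_tendsto])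

lemma norm_cube_sum_le: "norm (cube_sum n x) \<le> (\<Sum>\<^sub>\<infinity>k. norm (a k))"
proof -
  have "norm (cube_sum n x) \<le> (\<Sum>k | sup_norm k \<le> n. norm (a k * character k x))"
    unfolding cube_sum_def by (rule norm_sum)
  also have "\<dots> = (\<Sum>k | sup_norm k \<le> n. norm (a k))" by (simp add: norm_mult)
  also have "\<dots> \<le> (\<Sum>\<^sub>\<infinity>k. norm (a k))"
    by (rule finite_sum_le_infsum[OF summable]) (auto simp: card_sup_norm_le)
  finally show ?thesis .
qed

lemma norm_fsum_le: "norm (fsum x) \<le> (\<Sum>\<^sub>\<infinity>k. norm (a k))"
  by (rule LIMSEQ_le_const2[OF tendsto_norm[OF cube_sum_tendsto]]) (use norm_cube_sum_le in auto)

lemma square_integrable_fsum: "square_integrable fsum"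
  by (rule square_integrable_bounded[OF fsum_measurable norm_fsum_le])

lemma cube_sum_coefficient:
  "l2_ip (cube_sum n) (character m) = (if sup_norm m \<le> n then a m else 0)"
proof -
  have int: "integrable torus (character k)" for k
    by (rule torus_integrable_bounded[of _ 1]) (auto intro: torus_measurable_continuous
        continuous_character)
  have "cube_sum n x * cnj (character m x) = (\<Sum>k | sup_norm k \<le> n. a k * character (k - m) x)" for x
    using character_add[of _ "- m" x] by (simp add: cube_sum_def sum_distrib_right cnj_character
        mult.assoc)
  hence "(l2_ip (cube_sum n) (character m))
      = (\<Sum>k | sup_norm k \<le> n. a k * (LINT x|torus. character (k - m) x))"
    using int by (simp add: Bochner_Integration.integral_sum)
  also have "\<dots> = (\<Sum>k | sup_norm k \<le> n. if k = m then a k else 0)"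
    by (intro sum.cong) (auto simp: integral_character)
  also have "\<dots> = (if sup_norm m \<le> n then a m else 0)"
    by (simp add: card_sup_norm_le)
  finally show ?thesis .
qed

lemma fsum_coefficient: "l2_ip fsum (character m) = a m"
proof (rule LIMSEQ_unique)
  show "(\<lambda>n. l2_ip (cube_sum n) (character m)) \<longlonglongrightarrow> (l2_ip fsum (character m))"
  proof (rule torus_integral_tendsto)
    have m: "(\<lambda>x. cnj (character m x)) \<in> borel_measurable torus"
      by (intro torus_measurable_continuous continuous_intros continuous_character)
    show "(\<lambda>x. cube_sum n x * cnj (character m x)) \<in> borel_measurable torus" for n
      by (intro borel_measurable_times cube_sum_measurable m)
    show "(\<lambda>x. fsum x * cnj (character m x)) \<in> borel_measurable torus"
      by (intro borel_measurable_times fsum_measurable m)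
    show "norm (cube_sum n x * cnj (character m x)) \<le> (\<Sum>\<^sub>\<infinity>k. norm (a k))" for n x
      using norm_cube_sum_le by (simp add: norm_mult)
  qed (intro tendsto_intros cube_sum_tendsto)
  have "\<forall>\<^sub>F n in sequentially. (l2_ip (cube_sum n) (character m)) = a m"
    using eventually_ge_at_top[of "sup_norm m"] by eventually_elim (simp add: cube_sum_coefficient)
  thus "(\<lambda>n. l2_ip (cube_sum n) (character m)) \<longlonglongrightarrow> a m" by (rule tendsto_eventually)
qed

lemma sq_norm_cube_sum: "sq_norm (cube_sum n) = (\<Sum>k | sup_norm k \<le> n. (norm (a k))\<^sup>2)"
proof -
  have int: "integrable torus (\<lambda>x. cube_sum n x * cnj (character k x))" for k
    using square_integrable_bounded[OF cube_sum_measurable norm_cube_sum_le]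
      trig_poly_square_integrable[OF trig_poly.character] by (rule square_integrable_product)
  have "complex_of_real ((norm (cube_sum n x))\<^sup>2)
      = (\<Sum>k | sup_norm k \<le> n. cnj (a k) * (cube_sum n x * cnj (character k x)))" for x
    by (subst complex_norm_square, subst (2) cube_sum_def) (simp add: sum_distrib_left mult_ac)
  hence "complex_of_real (sq_norm (cube_sum n))
      = (LINT x|torus. (\<Sum>k | sup_norm k \<le> n. cnj (a k) * (cube_sum n x * cnj (character k x))))"
    unfolding sq_norm_def by (simp flip: integral_complex_of_real)
  also have "\<dots> = (\<Sum>k | sup_norm k \<le> n. cnj (a k) * a k)"
    using int by (simp add: Bochner_Integration.integral_sum cube_sum_coefficient)
  also have "\<dots> = complex_of_real (\<Sum>k | sup_norm k \<le> n. (norm (a k))\<^sup>2)"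
    by (simp add: complex_norm_square mult.commute del: of_real_power)
  finally show ?thesis by (simp only: of_real_eq_iff)
qed

lemma sq_norm_fsum_le:
  assumes "\<And>n. (\<Sum>k | sup_norm k \<le> n. (norm (a k))\<^sup>2) \<le> C"
  shows "sq_norm fsum \<le> C"
proof (rule LIMSEQ_le_const2)
  let ?A = "\<Sum>\<^sub>\<infinity>k. norm (a k)"
  show "(\<lambda>n. sq_norm (cube_sum n)) \<longlonglongrightarrow> sq_norm fsum"
    unfolding sq_norm_def
  proof (rule torus_integral_tendsto)
    show "(\<lambda>x. (norm (cube_sum n x))\<^sup>2) \<in> borel_measurable torus" for n using cube_sum_measurable
        by measurable
    show "(\<lambda>x. (norm (fsum x))\<^sup>2) \<in> borel_measurable torus" using fsum_measurable by measurable
    show "norm ((norm (cube_sum n x))\<^sup>2) \<le> ?A\<^sup>2" for n x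
      using norm_cube_sum_le[of n x] by (simp add: power_mono)
  qed (intro tendsto_intros cube_sum_tendsto)
  show "\<exists>N. \<forall>n\<ge>N. sq_norm (cube_sum n) \<le> C" using assms by (simp add: sq_norm_cube_sum)
qed

end

section \<open>Vector fields\<close>

definition vsynth :: "(3 \<Rightarrow> int^3 \<Rightarrow> real \<Rightarrow> complex) \<Rightarrow> real \<Rightarrow> real^3 \<Rightarrow> complex^3" where
  "vsynth A t x = (\<chi> j. synth (A j) t x)"

lemma partial_synth:
  assumes "rapid a" "t > 0"
  shows "partial j (synth a t) x = synth (\<lambda>k t. deriv_symbol (axis j 1) k * a k t) t x"
  unfolding partial_def frechet_derivative_at[OF synth_space_derivative[OF assms, of x], symmetric] ..

lemma partial_vsynth:
  assumes "\<And>m. rapid (A m)" "t > 0"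
  shows "partial j (vsynth A t) = vsynth (\<lambda>m k t. deriv_symbol (axis j 1) k * A m k t) t"
proof
  fix x
  have "(vsynth A t has_derivative (\<lambda>v. \<chi> m. synth (\<lambda>k t. deriv_symbol v k * A m k t) t x)) (at x)"
    using synth_space_derivative[OF assms(1,2)] by (intro has_derivative_vec) (simp add: vsynth_def)
  from frechet_derivative_at[OF this, symmetric]
  show "partial j (vsynth A t) x = vsynth (\<lambda>m k t. deriv_symbol (axis j 1) k * A m k t) t x"
    by (simp add: partial_def) (simp add: vsynth_def)
qed

lemma vsynth_time_derivative:
  assumes "\<And>m. rapid (A m)" "\<And>m. rapid (A' m)" "t > 0"
    and "\<And>m k t. t > 0 \<Longrightarrow> (A m k has_vector_derivative A' m k t) (at t)"
  shows "((\<lambda>s. vsynth A s x) has_vector_derivative vsynth A' t x) (at t)"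
proof -
  have "((\<lambda>s. vsynth A s x $ m) has_derivative (\<lambda>h. h *\<^sub>R synth (A' m) t x)) (at t)" for m
    using synth_time_derivative[OF assms(1)[of m] assms(2)[of m] assms(4)[where m = m] assms(3), of x]
    by (simp add: vsynth_def has_vector_derivative_def)
  moreover have "(\<chi> m. h *\<^sub>R synth (A' m) t x) = h *\<^sub>R vsynth A' t x" for h
    by (simp add: vsynth_def vec_eq_iff)
  ultimately show ?thesis
    using has_derivative_vec[of "\<lambda>s. vsynth A s x" "\<lambda>m h. h *\<^sub>R synth (A' m) t x" t]
    by (simp add: has_vector_derivative_def)
qed

lemma synth_add:
  assumes "rapid a" "rapid b" "t > 0"
  shows "synth (\<lambda>k t. a k t + b k t) t x = synth a t x + synth b t x"
  unfolding synth_def distrib_right using assms by (intro infsum_add synth_summable)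

lemma synth_sum:
  assumes "finite I" "\<And>i. i \<in> I \<Longrightarrow> rapid (a i)" "t > 0"
  shows "rapid (\<lambda>k t. \<Sum>i\<in>I. a i k t) \<and> synth (\<lambda>k t. \<Sum>i\<in>I. a i k t) t x = (\<Sum>i\<in>I. synth (a i) t x)"
  using assms
proof (induction rule: finite_induct)
  case empty
  show ?case by (auto simp: rapid_def synth_def)
next
  case (insert i I)
  thus ?case by (auto simp: synth_add intro!: rapid_add)
qed

lemma synth_cong:
  assumes "\<And>k. a k t = b k t" shows "synth a t x = synth b t x"
  using assms by (simp add: synth_def)

lemma synth_periodic: "periodic (synth a t)"
  using character_periodic unfolding periodic_def synth_def by simp

lemma vsynth_periodic: "periodic (vsynth A t)"
  using synth_periodic unfolding periodic_def vsynth_def by simp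

lemma L2_torus_component:
  assumes "f \<in> L2_torus" shows "square_integrable (\<lambda>x. f x $ j)"
  unfolding square_integrable_def
proof
  have f: "f \<in> borel_measurable torus" "integrable torus (\<lambda>x. (norm (f x))\<^sup>2)"
    using assms by (auto simp: L2_torus_def)
  show m: "(\<lambda>x. f x $ j) \<in> borel_measurable torus"
    using f(1) by (rule measurable_compose) (intro borel_measurable_continuous_onI continuous_intros)
  show "integrable torus (\<lambda>x. (norm (f x $ j))\<^sup>2)"
  proof (rule Bochner_Integration.integrable_bound[OF f(2)])
    show "(\<lambda>x. (norm (f x $ j))\<^sup>2) \<in> borel_measurable torus" using m by measurable
    have "(norm (f x $ j))\<^sup>2 \<le> (norm (f x))\<^sup>2" for x
        by (intro power_mono Finite_Cartesian_Product.norm_nth_le) auto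
    thus "AE x in torus. norm ((norm (f x $ j))\<^sup>2) \<le> norm ((norm (f x))\<^sup>2)" by simp
  qed
qed

lemma L2_torusI:
  assumes "periodic f" "f \<in> borel_measurable torus" "\<And>j. square_integrable (\<lambda>x. f x $ j)"
  shows "f \<in> L2_torus"
proof -
  have "(norm (f x))\<^sup>2 = (\<Sum>j\<in>UNIV. (norm (f x $ j))\<^sup>2)" for x
    by (simp add: norm_vec_def L2_set_def sum_nonneg)
  moreover have "integrable torus (\<lambda>x. \<Sum>j\<in>UNIV. (norm (f x $ j))\<^sup>2)"
    using assms(3) by (intro Bochner_Integration.integrable_sum) (auto simp: square_integrable_def)
  ultimately show ?thesis using assms by (simp add: L2_torus_def)
qed

lemma L2_inner_components:
  assumes "f \<in> L2_torus" "g \<in> L2_torus"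
  shows "L2_inner f g = (\<Sum>j\<in>UNIV. LINT x|torus. f x $ j * cnj (g x $ j))"
  unfolding L2_inner_def
  by (intro Bochner_Integration.integral_sum square_integrable_product L2_torus_component assms)

lemma fourier_coeff_component:
  "fourier_coeff f k $ j = l2_ip (\<lambda>x. f x $ j) (character k)"
  by (simp add: fourier_coeff_def character_def exp_cnj)

text \<open>Membership in \<open>\<Phi>(2)\<close> makes the supremum in the norm one over a bounded set, hence an upper bound
  for every coefficient.\<close>

lemma Phi_2_coefficient_bound:
  assumes "\<psi> \<in> Phi 2" "Phi_norm 2 \<psi> < \<epsilon>"
  shows "norm (fourier_coeff \<psi> k) \<le> \<epsilon> * inv_sq k"
proof (cases "k = 0")
  case True
  thus ?thesis using assms by (simp add: Phi_def)
next
  case False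
  obtain c where c: "\<And>k. k \<noteq> 0 \<Longrightarrow> norm (fourier_coeff \<psi> k) \<le> c / norm (ivec k) powr 2"
    using assms(1) by (auto simp: Phi_def)
  have pos: "norm (ivec k) > 0" if "k \<noteq> 0" for k
    using that sup_norm_le_norm_ivec[of k] by (smt (verit) of_nat_0_less_iff sup_norm_pos_iff)
  have "bdd_above ((\<lambda>k. norm (ivec k) powr 2 * norm (fourier_coeff \<psi> k)) ` (UNIV - {0}))"
  proof (rule bdd_aboveI2)
    fix k :: "int^3" assume "k \<in> UNIV - {0}"
    thus "norm (ivec k) powr 2 * norm (fourier_coeff \<psi> k) \<le> c"
      using c[of k] pos[of k] by (simp add: pos_le_divide_eq mult.commute)
  qed
  hence "norm (ivec k) powr 2 * norm (fourier_coeff \<psi> k) \<le> Phi_norm 2 \<psi>"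
    unfolding Phi_norm_def using False by (intro cSUP_upper) auto
  hence le: "(norm (ivec k))\<^sup>2 * norm (fourier_coeff \<psi> k) \<le> \<epsilon>"
    using assms(2) pos[OF False] by simp
  have "(real (sup_norm k))\<^sup>2 * norm (fourier_coeff \<psi> k) \<le> (norm (ivec k))\<^sup>2 * norm (fourier_coeff \<psi> k)"
    by (intro mult_right_mono power_mono sup_norm_le_norm_ivec) auto
  with le have "(real (sup_norm k))\<^sup>2 * norm (fourier_coeff \<psi> k) \<le> \<epsilon>" by linarith
  thus ?thesis using False by (simp add: inv_sq_def pos_le_divide_eq mult.commute)
qed

lemma smooth_on_character: "smooth_on UNIV (character k)"
proof -
  have "Ck_on n UNIV (\<lambda>x. c * character k x)" for n c
  proof (induction n arbitrary: c)
    case 0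
    show ?case by (simp, intro continuous_intros continuous_character)
  next
    case (Suc n)
    have "((\<lambda>x. c * character k x) has_derivative (\<lambda>v. c * deriv_symbol v k * character k x))
        (at x)" for x
      using has_derivative_mult_right[OF character_has_derivative, of c k x]
          by (simp add: deriv_symbol_def mult.assoc)
    thus ?case by (rule Ck_on_SucI[OF open_UNIV _ Suc])
  qed
  from this[of _ 1] show ?thesis by (simp add: smooth_on_def)
qed

lemma deriv_symbol_split: "deriv_symbol v k = deriv_symbol v l + deriv_symbol v (k - l)"
  by (simp add: deriv_symbol_def ivec_diff inner_diff_right algebra_simps)

text \<open>The character of frequency \<open>-k\<close> is an admissible test function.\<close>

lemma weakly_divergence_free_coefficients:
  assumes "\<psi> \<in> L2_torus" "weakly_divergence_free \<psi>"
  shows "(\<Sum>j\<in>UNIV. deriv_symbol (axis j 1) k * fourier_coeff \<psi> k $ j) = 0"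
proof -
  have "partial j (character (- k)) x = - deriv_symbol (axis j 1) k * cnj (character k x)" for j x
    unfolding partial_def frechet_derivative_at[OF character_has_derivative, symmetric]
    by (simp add: cnj_character deriv_symbol_def ivec_minus)
  moreover have "(LINT x|torus. (\<Sum>j\<in>UNIV. \<psi> x $ j * partial j (character (- k)) x)) = 0"
    using assms(2) smooth_on_character[of "- k"] character_periodic[of "- k"]
    unfolding weakly_divergence_free_def by blast
  ultimately have "(LINT x|torus. (\<Sum>j\<in>UNIV. \<psi> x $ j * (- deriv_symbol (axis j 1) k * cnj
      (character k x)))) = 0"
    by (simp only:)
  hence "(LINT x|torus. (\<Sum>j\<in>UNIV. - deriv_symbol (axis j 1) k * (\<psi> x $ j * cnj (character k x)))) = 0"
    by (simp only: mult_ac)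
  also have "(LINT x|torus. (\<Sum>j\<in>UNIV. - deriv_symbol (axis j 1) k * (\<psi> x $ j * cnj (character k x))))
      = (\<Sum>j\<in>UNIV. - deriv_symbol (axis j 1) k * fourier_coeff \<psi> k $ j)"
    unfolding fourier_coeff_component
    using square_integrable_product[OF L2_torus_component[OF assms(1)]
        trig_poly_square_integrable[OF trig_poly.character]]
    by (subst Bochner_Integration.integral_sum) (auto intro!: integrable_mult_right simp del:
        mult_minus_left)
  finally show ?thesis by (simp add: sum_negf)
qed

section \<open>The Navier-Stokes system in Fourier space\<close>

text \<open>The matrix of the orthogonal projection onto the complement of \<open>k\<close>, which removes gradients. At
  \<open>k = 0\<close> the quotient is \<open>0 / 0 = 0\<close>, and the projection is the identity.\<close>

definition leray :: "3 \<Rightarrow> 3 \<Rightarrow> int^3 \<Rightarrow> complex" where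
  "leray j m k = (if j = m then 1 else 0) - of_real (ivec k $ j * ivec k $ m / (norm (ivec k))\<^sup>2)"

text \<open>The nonlinearity in the conservative form \<open>- P div (a \<otimes> b)\<close>. The derivative then acts with the
  frequency \<open>k\<close> of the product, which gives the bound by \<open>|k|\<close> that the fixed point argument needs.\<close>

definition ns_form :: "int^3 \<Rightarrow> complex^3 \<Rightarrow> complex^3 \<Rightarrow> complex^3" where
  "ns_form k a b = (\<chi> j. - (\<Sum>m\<in>UNIV. leray j m k * (\<Sum>i\<in>UNIV. deriv_symbol (axis i 1) k *
      (a $ i * b $ m))))"

text \<open>The Fourier multiplier of \<open>-\<Delta>\<close>.\<close>

definition heat_symbol :: "int^3 \<Rightarrow> real" where
  "heat_symbol k = 4 * pi\<^sup>2 * (norm (ivec k))\<^sup>2"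

lemma deriv_symbol_axis: "deriv_symbol (axis j 1) k = 2 * of_real pi * \<i> * of_real (ivec k $ j)"
  by (simp add: deriv_symbol_def inner_axis')

lemma norm_leray_le: "norm (leray j m k) \<le> 2"
proof -
  have "\<bar>ivec k $ j * ivec k $ m / (norm (ivec k))\<^sup>2\<bar> \<le> 1"
  proof (cases "ivec k = 0")
    case False
    have "\<bar>ivec k $ j\<bar> * \<bar>ivec k $ m\<bar> \<le> norm (ivec k) * norm (ivec k)"
      by (intro mult_mono component_le_norm_cart) auto
    thus ?thesis using False by (simp add: abs_mult power2_eq_square)
  qed simp
  hence "norm (complex_of_real (ivec k $ j * ivec k $ m / (norm (ivec k))\<^sup>2)) \<le> 1"
    by (simp only: norm_of_real)
  thus ?thesis unfolding leray_def
    by (intro order_trans[OF norm_triangle_ineq4]) auto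
qed

lemma norm_deriv_symbol_axis_le: "norm (deriv_symbol (axis j 1) k) \<le> 8 * real (sup_norm k)"
proof -
  have "norm (deriv_symbol (axis j 1) k) = 2 * pi * \<bar>ivec k $ j\<bar>"
      by (simp add: deriv_symbol_axis norm_mult)
  also have "\<dots> \<le> 8 * real (sup_norm k)"
    using pi_less_4 abs_le_sup_norm[of k j] by (intro mult_mono) (auto simp: ivec_def)
  finally show ?thesis .
qed

lemma poly_bounded_leray: "poly_bounded (leray j m)"
  unfolding poly_bounded_def
  by (intro exI[of _ 2] exI[of _ 0]) (use norm_leray_le in auto)

text \<open>The constant collects 27 triples of indices, the factor 2 of the projection and the factor 8 of
  the derivative.\<close>

lemma norm_ns_form_le: "norm (ns_form k a b) \<le> 432 * real (sup_norm k) * norm a * norm b"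
proof -
  let ?c = "8 * real (sup_norm k) * (norm a * norm b)"
  have "norm (ns_form k a b $ j) \<le> (\<Sum>m\<in>(UNIV::3 set). 2 * (\<Sum>i\<in>(UNIV::3 set). ?c))" for j
    unfolding ns_form_def vec_lambda_beta norm_minus_cancel
  proof (rule sum_norm_le)
    fix m
    have "norm (deriv_symbol (axis i 1) k * (a $ i * b $ m)) \<le> ?c" for i
      unfolding norm_mult
      by (intro mult_mono norm_deriv_symbol_axis_le Finite_Cartesian_Product.norm_nth_le) auto
    hence "norm (\<Sum>i\<in>UNIV. deriv_symbol (axis i 1) k * (a $ i * b $ m)) \<le> (\<Sum>i\<in>(UNIV::3 set). ?c)"
      by (rule sum_norm_le)
    thus "norm (leray j m k * (\<Sum>i\<in>UNIV. deriv_symbol (axis i 1) k * (a $ i * b $ m)))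
        \<le> 2 * (\<Sum>i\<in>(UNIV::3 set). ?c)"
      unfolding norm_mult by (intro mult_mono norm_leray_le) auto
  qed
  hence le: "norm (ns_form k a b $ j) \<le> 18 * ?c" for j by simp
  have "norm (ns_form k a b) \<le> (\<Sum>j\<in>UNIV. norm (ns_form k a b $ j))" unfolding norm_vec_def
      by (rule L2_set_le_sum) simp
  also have "\<dots> \<le> (\<Sum>j\<in>(UNIV::3 set). 18 * ?c)" by (intro sum_mono le)
  finally show ?thesis by simp
qed

lemma bounded_bilinear_ns_form: "bounded_bilinear (ns_form k)"
proof
  show "ns_form k (a + a') b = ns_form k a b + ns_form k a' b" for a a' b
    by (simp add: vec_eq_iff ns_form_def distrib_right distrib_left sum.distrib)
  show "ns_form k a (b + b') = ns_form k a b + ns_form k a b'" for a b b'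
    by (simp add: vec_eq_iff ns_form_def distrib_right distrib_left sum.distrib)
  show "ns_form k (r *\<^sub>R a) b = r *\<^sub>R ns_form k a b" for r a b
    by (simp add: vec_eq_iff ns_form_def flip: scaleR_sum_right)
  show "ns_form k a (r *\<^sub>R b) = r *\<^sub>R ns_form k a b" for r a b
    by (simp add: vec_eq_iff ns_form_def flip: scaleR_sum_right)
  show "\<exists>K. \<forall>a b. norm (ns_form k a b) \<le> norm a * norm b * K"
    by (intro exI[of _ "432 * real (sup_norm k)"]) (use norm_ns_form_le in \<open>simp add: mult_ac\<close>)
qed

lemma sup_norm_sq_le_heat_symbol: "(real (sup_norm k))\<^sup>2 \<le> heat_symbol k"
proof -
  have "1 * (real (sup_norm k))\<^sup>2 \<le> (4 * pi\<^sup>2) * (norm (ivec k))\<^sup>2"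
  proof (intro mult_mono power_mono sup_norm_le_norm_ivec)
    have "1\<^sup>2 \<le> pi\<^sup>2" using pi_ge_two by (intro power_mono) auto
    thus "1 \<le> 4 * pi\<^sup>2" by simp
  qed auto
  thus ?thesis by (simp add: heat_symbol_def)
qed

interpretation ns: quadratic_heat_system ns_form 432 heat_symbol
  by (rule quadratic_heat_system.intro)
     (use bounded_bilinear_ns_form norm_ns_form_le sup_norm_sq_le_heat_symbol in auto)

lemma sum_deriv_symbol_leray: "(\<Sum>j\<in>UNIV. deriv_symbol (axis j 1) k * leray j m k) = 0"
proof (cases "k = 0")
  case False
  hence "ivec k \<noteq> 0" using sup_norm_le_norm_ivec[of k] by (auto simp: not_le)
  hence nz: "(norm (ivec k))\<^sup>2 \<noteq> 0" by simp
  have "(\<Sum>j\<in>UNIV. ivec k $ j * (ivec k $ j * ivec k $ m / (norm (ivec k))\<^sup>2))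
      = (\<Sum>j\<in>UNIV. (ivec k $ j)\<^sup>2) * ivec k $ m / (norm (ivec k))\<^sup>2"
    by (simp add: sum_distrib_right sum_divide_distrib power2_eq_square mult.assoc)
  also have "(\<Sum>j\<in>UNIV. (ivec k $ j)\<^sup>2) = (norm (ivec k))\<^sup>2"
    by (simp add: norm_vec_def L2_set_def sum_nonneg)
  finally have "(\<Sum>j\<in>UNIV. ivec k $ j * (ivec k $ j * ivec k $ m / (norm (ivec k))\<^sup>2)) = ivec k $ m"
    using nz by simp
  hence "complex_of_real (\<Sum>j\<in>UNIV. ivec k $ j * (ivec k $ j * ivec k $ m / (norm (ivec k))\<^sup>2))
      = of_real (ivec k $ m)" by (rule arg_cong)
  moreover have "(\<Sum>j\<in>UNIV. deriv_symbol (axis j 1) k * leray j m k)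
     = deriv_symbol (axis m 1) k - 2 * of_real pi * \<i> *
        complex_of_real (\<Sum>j\<in>UNIV. ivec k $ j * (ivec k $ j * ivec k $ m / (norm (ivec k))\<^sup>2))"
    by (simp add: leray_def deriv_symbol_axis right_diff_distrib sum_subtractf sum_distrib_left mult.assoc
        if_distrib[of "\<lambda>x. _ * x"] cong: if_cong)
  ultimately show ?thesis by (simp add: deriv_symbol_axis)
qed (simp add: deriv_symbol_def)

lemma sum_deriv_symbol_ns_form: "(\<Sum>j\<in>UNIV. deriv_symbol (axis j 1) k * ns_form k a b $ j) = 0"
proof -
  let ?c = "\<lambda>m. \<Sum>i\<in>UNIV. deriv_symbol (axis i 1) k * (a $ i * b $ m)"
  have "(\<Sum>j\<in>UNIV. deriv_symbol (axis j 1) k * ns_form k a b $ j)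
      = - (\<Sum>j\<in>UNIV. \<Sum>m\<in>UNIV. deriv_symbol (axis j 1) k * leray j m k * ?c m)"
    by (simp add: ns_form_def sum_negf sum_distrib_left mult.assoc)
  also have "(\<Sum>j\<in>UNIV. \<Sum>m\<in>UNIV. deriv_symbol (axis j 1) k * leray j m k * ?c m)
      = (\<Sum>m\<in>UNIV. \<Sum>j\<in>UNIV. deriv_symbol (axis j 1) k * leray j m k * ?c m)" by (rule sum.swap)
  also have "\<dots> = (\<Sum>m\<in>UNIV. (\<Sum>j\<in>UNIV. deriv_symbol (axis j 1) k * leray j m k) * ?c m)"
    by (simp only: sum_distrib_right)
  finally show ?thesis by (simp add: sum_deriv_symbol_leray)
qed

text \<open>With \<open>d N \<le> c\<close> and \<open>d \<le> 1\<close> one has \<open>(d (1 + n))\<^sup>N \<le> exp (d n)\<^sup>N \<le> exp (c n)\<close>.\<close>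

lemma exponential_dominates_weight:
  assumes "c > 0"
  shows "\<exists>C. \<forall>n::nat. (1 + real n) ^ N * exp (- (c * real n)) \<le> C"
proof -
  define d where "d = min 1 (c / (real N + 1))"
  have d: "0 < d" "d \<le> 1" "d * real N \<le> c"
  proof -
    have "d * real N \<le> c / (real N + 1) * real N" by (intro mult_right_mono) (auto simp: d_def)
    also have "\<dots> \<le> c" using assms by (simp add: field_simps)
    finally show "d * real N \<le> c" .
  qed (use assms in \<open>auto simp: d_def\<close>)
  have "(1 + real n) ^ N * exp (- (c * real n)) \<le> 1 / d ^ N" for n
  proof -
    have "d * (1 + real n) \<le> 1 + d * real n" using d by (simp add: distrib_left)
    also have "\<dots> \<le> exp (d * real n)" by (rule exp_ge_add_one_self)
    finally have "(d * (1 + real n)) ^ N \<le> exp (d * real n) ^ N" using d by (intro power_mono) auto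
    also have "\<dots> = exp (d * real N * real n)" by (simp add: mult_ac flip: exp_of_nat_mult)
    also have "\<dots> \<le> exp (c * real n)" using d by (simp add: mult_right_mono)
    finally have "d ^ N * (1 + real n) ^ N \<le> exp (c * real n)" by (simp add: power_mult_distrib)
    thus ?thesis using d by (simp add: exp_minus field_simps)
  qed
  thus ?thesis by blast
qed

text \<open>This is what the exponential in the weight is for: at positive times it beats every power of \<open>|k|\<close>.\<close>

lemma gevrey_bounded_rapid:
  assumes "ns.gevrey_bounded \<delta> U" "\<And>k. continuous_on {0..} (U k)" "\<delta> \<ge> 0"
  shows "rapid (\<lambda>k t. U k t $ j)"
  unfolding rapid_def
proof (intro conjI allI impI)
  show "continuous_on {0<..} (\<lambda>t. U k t $ j)" for k
    by (intro continuous_intros continuous_on_subset[OF assms(2)]) auto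
  fix t0 :: real and N :: nat assume t0: "t0 > 0"
  obtain C where C: "\<And>n::nat. (1 + real n) ^ N * exp (- (sqrt t0 * real n)) \<le> C"
    using exponential_dominates_weight[of "sqrt t0" N] t0 by auto
  show "\<exists>C. \<forall>t\<ge>t0. \<forall>k. weight k ^ N * norm (U k t $ j) \<le> C"
  proof (intro exI[of _ "\<delta> * C"] allI impI)
    fix t k assume t: "t \<ge> t0"
    let ?n = "real (sup_norm k)"
    have "norm (U k t $ j) \<le> norm (U k t)" by (rule Finite_Cartesian_Product.norm_nth_le)
    also have "\<dots> \<le> \<delta> * gevrey_weight k t" using assms t t0 by (simp add: ns.gevrey_bounded_def)
    also have "\<dots> \<le> \<delta> * (1 * exp (- (sqrt t0 * ?n)))"
      unfolding gevrey_weight_def using assms t t0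
      by (intro mult_left_mono mult_mono inv_sq_le_1) (auto intro: mult_right_mono)
    finally have "(1 + ?n) ^ N * norm (U k t $ j) \<le> (1 + ?n) ^ N * (\<delta> * exp (- (sqrt t0 * ?n)))"
      by (intro mult_left_mono) auto
    also have "\<dots> = \<delta> * ((1 + ?n) ^ N * exp (- (sqrt t0 * ?n)))" by simp
    also have "\<dots> \<le> \<delta> * C" using assms by (intro mult_left_mono C)
    finally show "(1 + ?n) ^ N * norm (U k t $ j) \<le> \<delta> * C" .
  qed
qed

text \<open>The coefficients of \<open>div (u \<otimes> u)\<close>, which is the convection term for divergence-free fields.\<close>

definition convection_coeff :: "(3 \<Rightarrow> int^3 \<Rightarrow> real \<Rightarrow> complex) \<Rightarrow> 3 \<Rightarrow> int^3 \<Rightarrow> real \<Rightarrow> complex" where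
  "convection_coeff a m k t = (\<Sum>i\<in>UNIV. deriv_symbol (axis i 1) k * conv (a i) (a m) k t)"

lemma smooth_family_convection_coeff:
  assumes "\<And>i. smooth_family n (a i)"
  shows "smooth_family n (convection_coeff a m)"
  unfolding convection_coeff_def[abs_def]
  by (intro smooth_family_sum smooth_family_multiplier smooth_family_conv poly_bounded_deriv_symbol
      assms) auto

lemma infsum_vec_nth:
  fixes f :: "'i \<Rightarrow> complex^3"
  assumes "f summable_on A"
  shows "infsum f A $ j = (\<Sum>\<^sub>\<infinity>x\<in>A. f x $ j)"
proof -
  have "infsum ((\<lambda>v. v $ j) \<circ> f) A = infsum f A $ j"
  proof (rule infsum_comm_additive[OF _ _ assms])
    show "Modules.additive (\<lambda>v :: complex^3. v $ j)" by (rule Modules.additive.intro) simp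
  qed (intro continuous_intros)
  thus ?thesis by (simp add: o_def)
qed

lemma infsum_sum:
  fixes f :: "'j \<Rightarrow> 'i \<Rightarrow> 'b::{topological_comm_monoid_add, t2_space}"
  assumes "finite J" "\<And>j. j \<in> J \<Longrightarrow> f j summable_on A"
  shows "(\<lambda>x. \<Sum>j\<in>J. f j x) summable_on A \<and> (\<Sum>\<^sub>\<infinity>x\<in>A. \<Sum>j\<in>J. f j x) = (\<Sum>j\<in>J. infsum (f j) A)"
  using assms
proof (induction rule: finite_induct)
  case (insert j J)
  thus ?case by (auto simp: infsum_add intro: summable_on_add)
qed simp

lemma quad_ns_form_component:
  assumes "ns.gevrey_bounded \<delta> U" "\<delta> \<ge> 0" "t > 0" and rapid: "\<And>j. rapid (\<lambda>k t. U k t $ j)"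
  shows "ns.quad U U k t $ j
    = - (\<Sum>m\<in>UNIV. leray j m k * convection_coeff (\<lambda>j k t. U k t $ j) m k t)"
proof -
  have s: "(\<lambda>l. U l t $ i * U (k - l) t $ m) summable_on UNIV" for i m
    using conv_summable[OF rapid rapid assms(3)] .
  have "ns.quad U U k t $ j = (\<Sum>\<^sub>\<infinity>l. ns_form k (U l t) (U (k - l) t) $ j)"
    unfolding ns.quad_def using assms by (intro infsum_vec_nth ns.quad_summable) auto
  also have "\<dots> = (\<Sum>\<^sub>\<infinity>l. - (\<Sum>m\<in>UNIV. leray j m k * (\<Sum>i\<in>UNIV. deriv_symbol (axis i 1) k *
      (U l t $ i * U (k - l) t $ m))))"
    by (simp add: ns_form_def)
  also have "\<dots> = - (\<Sum>m\<in>UNIV. \<Sum>\<^sub>\<infinity>l. leray j m k * (\<Sum>i\<in>UNIV. deriv_symbol (axis i 1) k * (U l t $ i * U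
      (k - l) t $ m)))"
    unfolding infsum_uminus
    by (subst infsum_sum[THEN conjunct2])
       (auto intro!: summable_on_cmult_right infsum_sum[THEN conjunct1] s)
  finally have quad: "ns.quad U U k t $ j = - (\<Sum>m\<in>UNIV. \<Sum>\<^sub>\<infinity>l. leray j m k
      * (\<Sum>i\<in>UNIV. deriv_symbol (axis i 1) k * (U l t $ i * U (k - l) t $ m)))" .
  have "(\<Sum>\<^sub>\<infinity>l. leray j m k * (\<Sum>i\<in>UNIV. deriv_symbol (axis i 1) k * (U l t $ i * U (k - l) t $ m)))
      = leray j m k * convection_coeff (\<lambda>j k t. U k t $ j) m k t" for m
    unfolding convection_coeff_def conv_def
    by (simp only: infsum_cmult_right', subst infsum_sum[THEN conjunct2])
       (auto simp: infsum_cmult_right' intro!: summable_on_cmult_right s)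
  thus ?thesis unfolding quad by (simp only:)
qed

text \<open>Leibniz rule in Fourier space: the multiplier at \<open>k\<close> is the sum of those at \<open>l\<close> and \<open>k - l\<close>, and
  the part at \<open>l\<close> adds up to the divergence.\<close>

lemma convection_vsynth:
  assumes a: "\<And>j. rapid (a j)" and t: "t > 0"
    and div: "\<And>k. (\<Sum>j\<in>UNIV. deriv_symbol (axis j 1) k * a j k t) = 0"
  shows "convection (vsynth a t) x $ m = synth (convection_coeff a m) t x"
proof -
  let ?f = "\<lambda>i. deriv_symbol (axis i 1)"
  have r: "rapid (\<lambda>k t. ?f i k * a j k t)" for i j
    by (intro rapid_multiplier poly_bounded_deriv_symbol a)
  have split: "?f i k * conv (a i) (a m) k t
      = conv (\<lambda>k t. ?f i k * a i k t) (a m) k t + conv (a i) (\<lambda>k t. ?f i k * a m k t) k t" for i k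
  proof -
    have "?f i k * conv (a i) (a m) k t = (\<Sum>\<^sub>\<infinity>l. ?f i k * (a i l t * a m (k - l) t))"
      by (simp add: conv_def infsum_cmult_right')
    also have "\<dots> = (\<Sum>\<^sub>\<infinity>l. ?f i l * a i l t * a m (k - l) t + a i l t * (?f i (k - l) * a m (k - l) t))"
      by (intro infsum_cong) (subst deriv_symbol_split, simp add: algebra_simps)
    also have "\<dots> = conv (\<lambda>k t. ?f i k * a i k t) (a m) k t + conv (a i) (\<lambda>k t. ?f i k * a m k t) k t"
      unfolding conv_def using conv_summable[OF r a t] conv_summable[OF a r t] by (intro infsum_add)
    finally show ?thesis .
  qed
  have zero: "(\<Sum>i\<in>UNIV. conv (\<lambda>k t. ?f i k * a i k t) (a m) k t) = 0" for k
  proof -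
    have "(\<Sum>i\<in>UNIV. conv (\<lambda>k t. ?f i k * a i k t) (a m) k t)
        = (\<Sum>\<^sub>\<infinity>l. \<Sum>i\<in>UNIV. ?f i l * a i l t * a m (k - l) t)"
      unfolding conv_def using conv_summable[OF r a t]
      by (intro infsum_sum[THEN conjunct2, symmetric]) auto
    also have "\<dots> = (\<Sum>\<^sub>\<infinity>l. (\<Sum>i\<in>UNIV. ?f i l * a i l t) * a m (k - l) t)"
      by (simp only: sum_distrib_right)
    finally show ?thesis by (simp add: div)
  qed
  have coeff: "convection_coeff a m k t = (\<Sum>i\<in>UNIV. conv (a i) (\<lambda>k t. ?f i k * a m k t) k t)" for k
    unfolding convection_coeff_def split sum.distrib zero by simp
  have "convection (vsynth a t) x $ m
      = (\<Sum>i\<in>UNIV. synth (a i) t x * synth (\<lambda>k t. ?f i k * a m k t) t x)"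
    using a t by (simp add: convection_def partial_vsynth) (simp add: vsynth_def)
  also have "\<dots> = (\<Sum>i\<in>UNIV. synth (conv (a i) (\<lambda>k t. ?f i k * a m k t)) t x)"
    by (intro sum.cong refl synth_mult a r t)
  also have "\<dots> = synth (\<lambda>k t. \<Sum>i\<in>UNIV. conv (a i) (\<lambda>k t. ?f i k * a m k t) k t) t x"
    by (rule synth_sum[OF finite_class.finite_UNIV _ t, THEN conjunct2, symmetric]) (intro rapid_conv a r)
  also have "\<dots> = synth (convection_coeff a m) t x"
    by (intro synth_cong) (simp add: coeff)
  finally show ?thesis .
qed

lemma laplacian_vsynth:
  assumes a: "\<And>j. rapid (a j)" and t: "t > 0"
  shows "laplacian (vsynth a t) x $ m = synth (\<lambda>k t. - of_real (heat_symbol k) * a m k t) t x"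
proof -
  let ?f = "\<lambda>i. deriv_symbol (axis i 1)"
  have r: "rapid (\<lambda>k t. ?f i k * a j k t)" for i j
    by (intro rapid_multiplier poly_bounded_deriv_symbol a)
  have r2: "rapid (\<lambda>k t. ?f i k * (?f i k * a j k t))" for i j
    by (intro rapid_multiplier poly_bounded_deriv_symbol a)
  have "laplacian (vsynth a t) x $ m = (\<Sum>i\<in>UNIV. synth (\<lambda>k t. ?f i k * (?f i k * a m k t)) t x)"
    using a r t by (simp add: laplacian_def partial_vsynth) (simp add: vsynth_def)
  also have "\<dots> = synth (\<lambda>k t. \<Sum>i\<in>UNIV. ?f i k * (?f i k * a m k t)) t x"
    by (rule synth_sum[OF finite_class.finite_UNIV _ t, THEN conjunct2, symmetric]) (rule r2)
  also have "\<dots> = synth (\<lambda>k t. - of_real (heat_symbol k) * a m k t) t x"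
  proof (rule synth_cong)
    fix k
    have "(norm (ivec k))\<^sup>2 = (\<Sum>i\<in>UNIV. (ivec k $ i)\<^sup>2)"
      by (simp add: norm_vec_def L2_set_def sum_nonneg)
    hence "(\<Sum>i\<in>UNIV. ?f i k * ?f i k) = - of_real (heat_symbol k)"
      by (simp add: deriv_symbol_axis heat_symbol_def power2_eq_square sum_distrib_left sum_negf mult_ac)
    moreover have "(\<Sum>i\<in>UNIV. ?f i k * (?f i k * a m k t)) = (\<Sum>i\<in>UNIV. ?f i k * ?f i k) * a m k t"
      by (simp only: sum_distrib_right mult.assoc)
    ultimately show "(\<Sum>i\<in>UNIV. ?f i k * (?f i k * a m k t)) = - of_real (heat_symbol k) * a m k t"
      by simp
  qed
  finally show ?thesis .
qed

section \<open>From the fixed point to a regular solution\<close>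

lemma mild_solution_ode:
  assumes U: "ns.gevrey_bounded \<delta> U" "\<delta> \<ge> 0" "\<And>k. continuous_on {0..} (U k)"
    and mild: "\<And>k t. t \<ge> 0 \<Longrightarrow> U k t = ns.duhamel \<psi> U k t" and t: "t > 0"
  shows "(U k has_vector_derivative (- heat_symbol k *\<^sub>R U k t + ns.quad U U k t)) (at t)"
proof -
  let ?l = "heat_symbol k"
  let ?g = "\<lambda>s. exp (?l * s) *\<^sub>R ns.quad U U k s"
  have "continuous_on {0..t+1} ?g"
    by (intro continuous_intros continuous_on_subset[OF ns.quad_continuous[OF U(1,1,2,2,3,3)]]) auto
  from integral_has_vector_derivative[OF this, of t]
  have "((\<lambda>s. integral {0..s} ?g) has_vector_derivative ?g t) (at t)"
    using t at_within_Icc_at[of 0 t "t + 1"] by auto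
  hence "((\<lambda>s. \<psi> k + integral {0..s} ?g) has_vector_derivative 0 + ?g t) (at t)"
    by (intro has_vector_derivative_add has_vector_derivative_const)
  moreover have "((\<lambda>s. exp (- (?l * s))) has_field_derivative - ?l * exp (- (?l * t))) (at t)"
    by (auto intro!: derivative_eq_intros)
  ultimately have "(ns.duhamel \<psi> U k has_vector_derivative
      (exp (- (?l * t)) *\<^sub>R (0 + ?g t) + (- ?l * exp (- (?l * t))) *\<^sub>R (\<psi> k + integral {0..t} ?g))) (at t)"
    unfolding ns.duhamel_def[abs_def] by (intro has_vector_derivative_scaleR)
  moreover have "exp (- (?l * t)) *\<^sub>R (0 + ?g t) + (- ?l * exp (- (?l * t))) *\<^sub>R (\<psi> k + integral {0..t} ?g)
      = - ?l *\<^sub>R U k t + ns.quad U U k t"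
    using mild[of t k] t by (simp add: ns.duhamel_def flip: exp_add)
  ultimately have "(ns.duhamel \<psi> U k has_vector_derivative (- ?l *\<^sub>R U k t + ns.quad U U k t))
      (at t)" by simp
  thus ?thesis
    by (rule has_vector_derivative_transform_within_open[of _ _ _ "{0<..}"]) (use t mild in auto)
qed

definition ns_rhs :: "(3 \<Rightarrow> int^3 \<Rightarrow> real \<Rightarrow> complex) \<Rightarrow> 3 \<Rightarrow> int^3 \<Rightarrow> real \<Rightarrow> complex" where
  "ns_rhs a j k t = - of_real (heat_symbol k) * a j k t
     + (\<Sum>m\<in>UNIV. - leray j m k * convection_coeff a m k t)"

lemma poly_bounded_minus: "poly_bounded m \<Longrightarrow> poly_bounded (\<lambda>k. - m k)"
  by (simp add: poly_bounded_def)

lemma poly_bounded_heat_symbol: "poly_bounded (\<lambda>k. of_real (heat_symbol k))"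
  unfolding poly_bounded_def
proof (intro exI allI)
  fix k
  have "heat_symbol k \<le> 4 * 4\<^sup>2 * (3 * weight k)\<^sup>2"
    unfolding heat_symbol_def using pi_less_4 norm_ivec_le_sup_norm[of k]
    by (intro mult_mono power_mono) auto
  moreover have "0 \<le> heat_symbol k" by (simp add: heat_symbol_def)
  ultimately show "norm (complex_of_real (heat_symbol k)) \<le> 576 * weight k ^ 2"
    unfolding power_mult_distrib norm_of_real by simp
qed

lemma smooth_family_ns_rhs:
  assumes "\<And>j. smooth_family n (a j)"
  shows "smooth_family n (ns_rhs a j)"
  unfolding ns_rhs_def[abs_def]
  by (intro smooth_family_add smooth_family_sum smooth_family_multiplier poly_bounded_minus
      poly_bounded_heat_symbol poly_bounded_leray smooth_family_convection_coeff assms) auto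

text \<open>The right-hand side of the equation uses only multipliers and convolutions, which preserve the number
  of time derivatives; a solution with \<open>n\<close> of them therefore has \<open>n + 1\<close>.\<close>

lemma smooth_family_bootstrap:
  assumes "\<And>j. rapid (a j)"
    and "\<And>j k t. t > 0 \<Longrightarrow> (a j k has_vector_derivative ns_rhs a j k t) (at t)"
  shows "smooth_family n (a j)"
proof (induction n arbitrary: j)
  case (Suc n)
  thus ?case using assms smooth_family_ns_rhs[of n a] by (auto intro!: exI[of _ "ns_rhs a j"])
qed (simp add: assms)

text \<open>The solution with mean value zero of \<open>-\<Delta> p = div (u \<cdot> \<nabla>u)\<close>.\<close>

definition pressure_coeff :: "(3 \<Rightarrow> int^3 \<Rightarrow> real \<Rightarrow> complex) \<Rightarrow> int^3 \<Rightarrow> real \<Rightarrow> complex" where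
  "pressure_coeff a k t =
     (\<Sum>m\<in>UNIV. \<i> * of_real (ivec k $ m / (2 * pi * (norm (ivec k))\<^sup>2)) * convection_coeff a m k t)"

lemma smooth_family_pressure_coeff:
  assumes "\<And>j. smooth_family n (a j)"
  shows "smooth_family n (pressure_coeff a)"
proof -
  have "poly_bounded (\<lambda>k. \<i> * of_real (ivec k $ m / (2 * pi * (norm (ivec k))\<^sup>2)))" for m
    unfolding poly_bounded_def
  proof (intro exI allI)
    fix k
    have "\<bar>ivec k $ m / (2 * pi * (norm (ivec k))\<^sup>2)\<bar> \<le> 1"
    proof (cases "k = 0")
      case False
      hence 1: "1 \<le> norm (ivec k)"
        using sup_norm_le_norm_ivec[of k] sup_norm_pos_iff[of k] by linarith
      have "\<bar>ivec k $ m\<bar> \<le> norm (ivec k) * norm (ivec k)"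
        using component_le_norm_cart[of "ivec k" m] mult_mono[OF order_refl 1, of "norm (ivec k)"] by simp
      also have "\<dots> \<le> 2 * pi * (norm (ivec k))\<^sup>2"
        using pi_ge_two mult_right_mono[of 1 "2 * pi" "(norm (ivec k))\<^sup>2"] by (simp add: power2_eq_square)
      finally show ?thesis using 1 by (simp add: abs_mult divide_le_eq)
    qed simp
    thus "norm (\<i> * complex_of_real (ivec k $ m / (2 * pi * (norm (ivec k))\<^sup>2))) \<le> 1 * weight k ^ 0"
      unfolding norm_mult norm_of_real by simp
  qed
  thus ?thesis
    unfolding pressure_coeff_def[abs_def]
    by (intro smooth_family_sum smooth_family_multiplier smooth_family_convection_coeff assms) auto
qed

text \<open>The pressure gradient is minus the part of the convection term that the projection removes.\<close>

lemma ns_coefficient_balance: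
  "ns_rhs a j k t - (- of_real (heat_symbol k) * a j k t) + convection_coeff a j k t
    + deriv_symbol (axis j 1) k * pressure_coeff a k t = 0"
proof -
  let ?N = "\<lambda>m. convection_coeff a m k t"
  have "deriv_symbol (axis j 1) k * (\<i> * of_real (ivec k $ m / (2 * pi * (norm (ivec k))\<^sup>2)))
      = - of_real (ivec k $ j * ivec k $ m / (norm (ivec k))\<^sup>2)" for m
  proof -
    have "deriv_symbol (axis j 1) k * (\<i> * of_real (ivec k $ m / (2 * pi * (norm (ivec k))\<^sup>2)))
        = (\<i> * \<i>) * complex_of_real (2 * pi * (ivec k $ j) * (ivec k $ m / (2 * pi * (norm (ivec k))\<^sup>2)))"
      unfolding deriv_symbol_axis of_real_mult of_real_numeral by (simp only: mult_ac)
    also have "2 * pi * (ivec k $ j) * (ivec k $ m / (2 * pi * (norm (ivec k))\<^sup>2))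
        = ivec k $ j * ivec k $ m / (norm (ivec k))\<^sup>2" by simp
    finally show ?thesis by (simp only: i_squared mult_minus1)
  qed
  hence *: "deriv_symbol (axis j 1) k * (\<i> * of_real (ivec k $ m / (2 * pi * (norm (ivec k))\<^sup>2)))
      = leray j m k - (if j = m then 1 else 0)" for m
    by (simp only: leray_def) simp
  have "deriv_symbol (axis j 1) k * pressure_coeff a k t
      = (\<Sum>m\<in>UNIV. (leray j m k - (if j = m then 1 else 0)) * ?N m)"
    unfolding pressure_coeff_def sum_distrib_left mult.assoc[symmetric]
    by (simp only: *[unfolded mult.assoc[symmetric]])
  also have "\<dots> = (\<Sum>m\<in>UNIV. leray j m k * ?N m) - ?N j"
    by (simp add: left_diff_distrib sum_subtractf if_distrib[of "\<lambda>x. x * _"] cong: if_cong)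
  finally show ?thesis by (simp add: ns_rhs_def sum_negf)
qed

text \<open>The initial value and the projected nonlinearity are orthogonal to \<open>k\<close>, a linear condition that
  passes through the series and the time integral.\<close>

lemma mild_solution_divergence_free:
  assumes U: "ns.gevrey_bounded \<delta> U" "\<delta> \<ge> 0" "\<And>k. continuous_on {0..} (U k)"
    and mild: "\<And>k t. t \<ge> 0 \<Longrightarrow> U k t = ns.duhamel \<psi> U k t" and t: "t \<ge> 0"
    and \<psi>: "\<And>k. (\<Sum>j\<in>UNIV. deriv_symbol (axis j 1) k * \<psi> k $ j) = 0"
  shows "(\<Sum>j\<in>UNIV. deriv_symbol (axis j 1) k * U k t $ j) = 0"
proof -
  define L where "L v = (\<Sum>j\<in>UNIV. deriv_symbol (axis j 1) k * v $ j)" for v :: "complex^3"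
  have L: "bounded_linear L" unfolding L_def
    by (intro bounded_linear_sum bounded_linear_const_mult bounded_linear_vec_nth)
  interpret L: bounded_linear L by fact
  let ?g = "\<lambda>s. exp (heat_symbol k * s) *\<^sub>R ns.quad U U k s"
  have Lq: "L (ns.quad U U k s) = 0" if "s \<ge> 0" for s
  proof -
    have s: "(\<lambda>l. ns_form k (U l s) (U (k - l) s)) summable_on UNIV"
      by (rule ns.quad_summable[OF U(1,1,2,2) that])
    have "infsum (L \<circ> (\<lambda>l. ns_form k (U l s) (U (k - l) s))) UNIV = L (ns.quad U U k s)"
      unfolding ns.quad_def
      by (rule infsum_comm_additive[OF _ _ s])
        (auto intro!: Modules.additive.intro L.add L.isCont)
    moreover have "L (ns_form k a b) = 0" for a b unfolding L_def by (rule sum_deriv_symbol_ns_form)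
    ultimately show ?thesis by (simp add: o_def)
  qed
  have "?g integrable_on {0..t}"
    by (intro integrable_continuous_interval continuous_intros
        continuous_on_subset[OF ns.quad_continuous[OF U(1,1,2,2,3,3)]]) auto
  from integral_linear[OF this L]
  have "L (integral {0..t} ?g) = integral {0..t} (L \<circ> ?g)" by simp
  also have "\<dots> = integral {0..t} (\<lambda>s. 0)"
    by (intro Henstock_Kurzweil_Integration.integral_cong) (simp add: L.scaleR Lq)
  finally have "L (integral {0..t} ?g) = 0" by simp
  moreover have "L (\<psi> k) = 0" using \<psi> by (simp add: L_def)
  ultimately have "L (U k t) = 0"
    unfolding mild[OF t] ns.duhamel_def by (simp add: L.scaleR L.add)
  thus ?thesis by (simp add: L_def)
qed

lemma vsynth_navier_stokes:
  assumes a: "\<And>j. rapid (a j)"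
    and ode: "\<And>j k t. t > 0 \<Longrightarrow> (a j k has_vector_derivative ns_rhs a j k t) (at t)"
    and div: "\<And>k t. t > 0 \<Longrightarrow> (\<Sum>j\<in>UNIV. deriv_symbol (axis j 1) k * a j k t) = 0"
    and u: "\<And>t. t > 0 \<Longrightarrow> u t = vsynth a t"
  shows "navier_stokes u (synth (pressure_coeff a))"
  unfolding navier_stokes_def
proof (intro allI impI conjI)
  fix t :: real and x assume t: "t > 0"
  have sf: "smooth_family 0 (a j)" for j using a by simp
  have r: "rapid (ns_rhs a j)" "rapid (convection_coeff a j)" "rapid (pressure_coeff a)" for j
    using smooth_family_ns_rhs[OF sf] smooth_family_convection_coeff[OF sf]
        smooth_family_pressure_coeff[OF sf] by auto
  have rh: "rapid (\<lambda>k t. of_real (heat_symbol k) * a j k t)" for j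
    by (intro rapid_multiplier poly_bounded_heat_symbol a)
  have rp: "rapid (\<lambda>k t. deriv_symbol (axis j 1) k * pressure_coeff a k t)" for j
    by (intro rapid_multiplier poly_bounded_deriv_symbol r)
  have "((\<lambda>s. vsynth a s x) has_vector_derivative vsynth (ns_rhs a) t x) (at t)"
    by (intro vsynth_time_derivative a r t ode)
  hence "((\<lambda>s. u s x) has_vector_derivative vsynth (ns_rhs a) t x) (at t)"
    by (rule has_vector_derivative_transform_within_open[of _ _ _ "{0<..}"]) (use t u in auto)
  hence time: "vector_derivative (\<lambda>s. u s x) (at t) = vsynth (ns_rhs a) t x"
    by (rule vector_derivative_at)
  show "vector_derivative (\<lambda>s. u s x) (at t) - laplacian (u t) x + convection (u t) x
      + gradient (synth (pressure_coeff a) t) x = 0"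
    unfolding vec_eq_iff
  proof
    fix j
    have "(vector_derivative (\<lambda>s. u s x) (at t) - laplacian (u t) x + convection (u t) x
        + gradient (synth (pressure_coeff a) t) x) $ j
      = synth (ns_rhs a j) t x - synth (\<lambda>k t. - of_real (heat_symbol k) * a j k t) t x
        + synth (convection_coeff a j) t x + synth (\<lambda>k t. deriv_symbol (axis j 1) k * pressure_coeff
            a k t) t x"
      using laplacian_vsynth[OF a t] convection_vsynth[OF a t div[OF t]] t u
      by (simp add: time gradient_def partial_synth[OF r(3) t]) (simp add: vsynth_def)
    also have "synth (\<lambda>k t. - of_real (heat_symbol k) * a j k t) t x
        = - synth (\<lambda>k t. of_real (heat_symbol k) * a j k t) t x"
      by (simp add: synth_def infsum_uminus)
    also have "synth (ns_rhs a j) t x - - synth (\<lambda>k t. of_real (heat_symbol k) * a j k t) t x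
        + synth (convection_coeff a j) t x + synth (\<lambda>k t. deriv_symbol (axis j 1) k * pressure_coeff
            a k t) t x
      = synth (\<lambda>k t. ns_rhs a j k t + of_real (heat_symbol k) * a j k t
          + convection_coeff a j k t + deriv_symbol (axis j 1) k * pressure_coeff a k t) t x"
      using t by (simp add: synth_add rapid_add r rh rp)
    also have "\<dots> = 0"
      using ns_coefficient_balance[of a j _ t] by (simp add: synth_def)
    finally show "(vector_derivative (\<lambda>s. u s x) (at t) - laplacian (u t) x + convection (u t) x
        + gradient (synth (pressure_coeff a) t) x) $ j = 0 $ j" by simp
  qed
  have rf: "rapid (\<lambda>k t. deriv_symbol (axis j 1) k * a j k t)" for j
    by (intro rapid_multiplier poly_bounded_deriv_symbol a)
  have "divergence (u t) x = (\<Sum>j\<in>UNIV. synth (\<lambda>k t. deriv_symbol (axis j 1) k * a j k t) t x)"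
    using partial_synth[OF a t] by (simp add: divergence_def u[OF t] vsynth_def)
  also have "\<dots> = synth (\<lambda>k t. \<Sum>j\<in>UNIV. deriv_symbol (axis j 1) k * a j k t) t x"
    by (rule synth_sum[OF finite_class.finite_UNIV _ t, THEN conjunct2, symmetric]) (rule rf)
  also have "\<dots> = 0" using div[OF t] by (simp add: synth_def)
  finally show "divergence (u t) x = 0" .
qed

text \<open>At positive times the square norm is at most \<open>\<delta>\<^sup>2 \<Sum> |k|\<^sup>-\<^sup>4\<close>, uniformly as \<open>t\<close> tends to \<open>0\<close>.
  The value at time zero is \<open>\<psi>\<close> itself rather than its Fourier series, which need not converge
  absolutely; only its coefficients have to match the initial values.\<close>

lemma vsynth_weakly_continuous:
  assumes \<psi>: "\<psi> \<in> L2_torus" and U: "ns.gevrey_bounded \<delta> U" "\<delta> \<ge> 0" "\<And>k. continuous_on {0..} (U k)"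
    and U0: "\<And>k. U k 0 = fourier_coeff \<psi> k"
    and u0: "u 0 = \<psi>" and u: "\<And>t. t > 0 \<Longrightarrow> u t = vsynth (\<lambda>j k t. U k t $ j) t"
  shows "weakly_continuous_L2 u"
proof -
  let ?a = "\<lambda>j k t. U k t $ j"
  have a: "rapid (?a j)" for j by (rule gevrey_bounded_rapid[OF U(1,3,2)])
  have ac: "absolutely_convergent_fourier (\<lambda>k. ?a j k t)" if "t > 0" for j t
    using rapid_abs_summable[OF a that] by (simp add: absolutely_convergent_fourier_def)
  have comp: "(\<lambda>x. u t x $ j) = absolutely_convergent_fourier.fsum (\<lambda>k. ?a j k t)" if "t > 0" for j t
    using ac[OF that] by (simp add: u[OF that] vsynth_def synth_def
        absolutely_convergent_fourier.fsum_def fun_eq_iff)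
  have L2: "u t \<in> L2_torus" if "t \<ge> 0" for t
  proof (cases "t = 0")
    case False
    hence t: "t > 0" using that by simp
    show ?thesis
    proof (rule L2_torusI)
      show "periodic (u t)" using vsynth_periodic u[OF t] by simp
      have "continuous_on UNIV (synth (?a j) t)" for j
        using continuous_at_imp_continuous_on has_derivative_continuous[OF synth_space_derivative[OF
            a t]] by blast
      hence "continuous_on (cbox 0 One) (u t)"
        unfolding u[OF t] vsynth_def[abs_def] by (intro continuous_on_vec_lambda)
            (auto intro: continuous_on_subset)
      thus "u t \<in> borel_measurable torus" by (rule torus_measurable_continuous)
      show "square_integrable (\<lambda>x. u t x $ j)" for j
        unfolding comp[OF t] by (rule absolutely_convergent_fourier.square_integrable_fsum[OF ac[OF t]])
    qed
  qed (simp add: u0 \<psi>)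
  have coeff: "l2_ip (\<lambda>x. u t x $ j) (character k) = ?a j k t" if "t \<ge> 0" for t j k
  proof (cases "t = 0")
    case True
    thus ?thesis by (simp add: u0 U0 fourier_coeff_component)
  next
    case False
    hence t: "t > 0" using that by simp
    show ?thesis
      using absolutely_convergent_fourier.fsum_coefficient[OF ac[OF t, of j], of k]
      by (simp flip: comp[OF t])
  qed
  define C where "C = \<delta>\<^sup>2 * (\<Sum>\<^sub>\<infinity>k. (inv_sq k)\<^sup>2)"
  have bound: "sq_norm (\<lambda>x. u t x $ j) \<le> max C (sq_norm (\<lambda>x. \<psi> x $ j))" if "t \<ge> 0" for t j
  proof (cases "t = 0")
    case False
    hence t: "t > 0" using that by simp
    have "(\<Sum>k | sup_norm k \<le> n. (norm (?a j k t))\<^sup>2) \<le> C" for n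
    proof -
      have "(norm (?a j k t))\<^sup>2 \<le> \<delta>\<^sup>2 * (inv_sq k)\<^sup>2" for k
      proof -
        have "norm (?a j k t) \<le> norm (U k t)" by (rule Finite_Cartesian_Product.norm_nth_le)
        also have "\<dots> \<le> \<delta> * gevrey_weight k t" using U(1) that by (simp add: ns.gevrey_bounded_def)
        also have "\<dots> \<le> \<delta> * inv_sq k" using U(2) that by (intro mult_left_mono gevrey_weight_le_inv_sq)
        finally have "(norm (?a j k t))\<^sup>2 \<le> (\<delta> * inv_sq k)\<^sup>2" by (intro power_mono) auto
        thus ?thesis by (simp add: power_mult_distrib)
      qed
      hence "(\<Sum>k | sup_norm k \<le> n. (norm (?a j k t))\<^sup>2) \<le> (\<Sum>k | sup_norm k \<le> n. \<delta>\<^sup>2 * (inv_sq k)\<^sup>2)"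
        by (intro sum_mono)
      also have "\<dots> = \<delta>\<^sup>2 * (\<Sum>k | sup_norm k \<le> n. (inv_sq k)\<^sup>2)" by (simp add: sum_distrib_left)
      also have "\<dots> \<le> C"
        unfolding C_def by (intro mult_left_mono finite_sum_le_infsum inv_sq_squared_summable)
          (auto simp: card_sup_norm_le)
      finally show ?thesis .
    qed
    from absolutely_convergent_fourier.sq_norm_fsum_le[OF ac[OF t] this]
    show ?thesis by (simp add: comp[OF t])
  qed (simp add: u0)
  have "continuous_on {0..} (\<lambda>t. l2_ip (\<lambda>x. u t x $ j) h)" if "square_integrable h" for j h
  proof (rule weak_continuity_from_coefficients[OF _ bound _ that])
    show "square_integrable (\<lambda>x. u t x $ j)" if "t \<in> {0..}" for t
      using L2_torus_component[OF L2] that by simp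
    show "continuous_on {0..} (\<lambda>t. l2_ip (\<lambda>x. u t x $ j) (character k))" for k
    proof (rule continuous_on_eq)
      show "continuous_on {0..} (\<lambda>t. U k t $ j)" by (intro continuous_intros U(3))
    qed (simp add: coeff)
  qed auto
  hence "continuous_on {0..} (\<lambda>t. \<Sum>j\<in>UNIV. LINT x|torus. u t x $ j * cnj (g x $ j))"
      if "g \<in> L2_torus" for g
    using L2_torus_component[OF that] by (intro continuous_on_sum) auto
  hence "continuous_on {0..} (\<lambda>t. L2_inner (u t) g)" if "g \<in> L2_torus" for g
    by (rule continuous_on_eq) (use that L2 L2_inner_components in auto)
  thus ?thesis using L2 by (simp add: weakly_continuous_L2_def)
qed

theorem corollary1:
  shows "\<exists>\<epsilon>::real. \<epsilon> > 0 \<and>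
    (\<forall>\<psi>. \<psi> \<in> Phi 2 \<and> Phi_norm 2 \<psi> < \<epsilon> \<and> weakly_divergence_free \<psi> \<longrightarrow>
      (\<exists>u. global_regular_solution \<psi> u))"
proof -
  obtain \<epsilon> \<delta> where \<epsilon>: "\<epsilon> > 0" and \<delta>: "\<delta> \<ge> 0" and
    ex: "\<And>\<psi>. (\<And>k. norm (\<psi> k) \<le> \<epsilon> * inv_sq k) \<Longrightarrow>
      \<exists>U. (\<forall>k. continuous_on {0..} (U k)) \<and> ns.gevrey_bounded \<delta> U \<and> (\<forall>k. \<forall>t\<ge>0. U k t
          = ns.duhamel \<psi> U k t)"
    using ns.mild_solution_exists by metis
  have "\<exists>u. global_regular_solution \<psi> u"
    if \<psi>: "\<psi> \<in> Phi 2" "Phi_norm 2 \<psi> < \<epsilon>" "weakly_divergence_free \<psi>" for \<psi>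
  proof -
    let ?c = "fourier_coeff \<psi>"
    have L2: "\<psi> \<in> L2_torus" using \<psi>(1) by (simp add: Phi_def)
    obtain U where U: "ns.gevrey_bounded \<delta> U" "\<And>k. continuous_on {0..} (U k)"
      and mild: "\<And>k t. t \<ge> 0 \<Longrightarrow> U k t = ns.duhamel ?c U k t"
      using ex[of ?c] Phi_2_coefficient_bound[OF \<psi>(1,2)] by blast
    define a where "a j k t = U k t $ j" for j k t
    define u where "u t = (if t \<le> 0 then \<psi> else vsynth a t)" for t
    have a: "rapid (a j)" for j
      unfolding a_def[abs_def] by (rule gevrey_bounded_rapid[OF U \<delta>])
    have ode: "(a j k has_vector_derivative ns_rhs a j k t) (at t)" if t: "t > 0" for j k t
    proof -
      have "((\<lambda>s. U k s $ j) has_vector_derivative (- heat_symbol k *\<^sub>R U k t + ns.quad U U k t) $ j)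
          (at t)"
        by (rule bounded_linear.has_vector_derivative[OF bounded_linear_vec_nth
            mild_solution_ode[OF U(1) \<delta> U(2) mild t]])
      moreover have "(- heat_symbol k *\<^sub>R U k t + ns.quad U U k t) $ j = ns_rhs a j k t"
        using quad_ns_form_component[OF U(1) \<delta> t a[unfolded a_def[abs_def]], of k j]
        by (simp add: ns_rhs_def a_def[abs_def] sum_negf) (simp add: scaleR_conv_of_real)
      ultimately show ?thesis by (simp add: a_def[abs_def])
    qed
    have smooth: "smooth_family n (a j)" for n j
      by (rule smooth_family_bootstrap[OF a ode])
    have div: "(\<Sum>j\<in>UNIV. deriv_symbol (axis j 1) k * a j k t) = 0" if "t > 0" for k t
      using mild_solution_divergence_free[OF U(1) \<delta> U(2) mild _
          weakly_divergence_free_coefficients[OF L2 \<psi>(3)]] that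
      by (simp add: a_def)
    have "global_regular_solution \<psi> u"
      unfolding global_regular_solution_def
    proof (intro conjI exI[of _ "synth (pressure_coeff a)"] allI impI)
      show "weakly_continuous_L2 u"
      proof (rule vsynth_weakly_continuous[OF L2 U(1) \<delta> U(2)])
        show "U k 0 = fourier_coeff \<psi> k" for k using mild[of 0 k] by (simp add: ns.duhamel_def)
      qed (auto simp: u_def a_def[abs_def])
      show "AE x in torus. u 0 x = \<psi> x" by (simp add: u_def)
      show "smooth_on (UNIV \<times> {0<..}) (\<lambda>(x, t). u t x)"
        unfolding smooth_on_def
      proof
        fix n
        have "Ck_on n (UNIV \<times> {0<..}) (\<lambda>(x, t). vsynth a t x)"
          using Ck_on_synth[OF smooth]
          by (intro Ck_on_vec open_positive_times) (simp add: vsynth_def case_prod_unfold)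
        thus "Ck_on n (UNIV \<times> {0<..}) (\<lambda>(x, t). u t x)"
          by (subst Ck_on_cong[OF open_positive_times, of _ "\<lambda>(x, t). vsynth a t x"]) (auto simp: u_def)
      qed
      show "periodic (synth (pressure_coeff a) t)" for t by (rule synth_periodic)
      show "smooth_on (UNIV \<times> {0<..}) (\<lambda>(x, t). synth (pressure_coeff a) t x)"
        unfolding smooth_on_def by (intro allI Ck_on_synth smooth_family_pressure_coeff smooth)
      show "navier_stokes u (synth (pressure_coeff a))"
        by (rule vsynth_navier_stokes[OF a ode div]) (auto simp: u_def)
    qed
    thus ?thesis by blast
  qed
  with \<epsilon> show ?thesis by blast
qed

end
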